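(* Let $(M^n,g)$ be an oriented Riemannian manifold and let $\alpha$ be a smooth real differential $1$-form on $M$. For any $\alpha_\tau=\frac{d^M\tau}{i\tau}$ with $\tau\in C^\infty(M,\mathbb{S}^1)$, the magnetic Hodge Laplacians $\Delta^\alpha$ and $\Delta^{\alpha+\alpha_\tau}$ on complex $p$-forms are unitarily equivalent, meaning that $$\bar\tau\,\Delta^\alpha\,\tau=\Delta^{\alpha+\alpha_\tau}$$ (i.e. $\bar\tau\,\Delta^\alpha(\tau\omega)=\Delta^{\alpha+\alpha_\tau}\omega$ for all $\omega\in\Omega^p(M,\mathbb{C})$). In particular, $\Delta^\alpha$ and $\Delta^{\alpha+\alpha_\tau}$ have the same spectrum if $M$ is a closed oriented Riemannian manifold.
   Context: $\mathbb{S}^1\subset\mathbb{C}$ is the unit circle; for $\tau\in C^\infty(M,\mathbb{S}^1)$ the form $\alpha_\tau=\frac{d^M\tau}{i\tau}$ is a real closed $1$-form. For a real $1$-form $\alpha$ with dual vector field $\alpha^\sharp$: $d^\alpha=d^M+i\alpha\wedge$, $\delta^\alpha=\delta^M-i\alpha^\sharp\lrcorner$ (with $\delta^M$ the formal adjoint of the exterior derivative $d^M$), and $\Delta^\alpha=d^\alpha\delta^\alpha+\delta^\alpha d^\alpha$ on complex-valued smooth $p$-forms $\Omega^p(M,\mathbb{C})$. *)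

theory Defs
  imports "HOL-Analysis.Analysis"
begin

section \<open>Smooth maps on open subsets of Euclidean space\<close>

primrec Ck_on :: "nat \<Rightarrow> (real^'n::finite) set \<Rightarrow> (real^'n \<Rightarrow> 'b::real_normed_vector) \<Rightarrow> bool" where
  "Ck_on 0 S f \<longleftrightarrow> continuous_on S f"
| "Ck_on (Suc k) S f \<longleftrightarrow> (\<forall>y\<in>S. f differentiable (at y)) \<and>
     (\<forall>v. Ck_on k S (\<lambda>y. frechet_derivative f (at y) v))"

text \<open>Only used for open \<^term>\<open>S\<close>.\<close>

definition smooth_on :: "(real^'n::finite) set \<Rightarrow> (real^'n \<Rightarrow> 'b::real_normed_vector) \<Rightarrow> bool" where
  "smooth_on S f \<longleftrightarrow> (\<forall>k. Ck_on k S f)"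


section \<open>Oriented smooth manifolds\<close>

text \<open>The manifold is a (Hausdorff, second countable) type \<^typ>\<open>'m\<close>, its dimension is
  \<open>CARD('n)\<close>. A chart is a pair of a domain and a coordinate map. The transition maps of an
  oriented atlas have positive Jacobian determinant.\<close>

type_synonym ('m, 'n) chart = "'m set \<times> ('m \<Rightarrow> real^'n)"

definition chart_inv :: "('m, 'n::finite) chart \<Rightarrow> real^'n \<Rightarrow> 'm" where
  "chart_inv c = inv_into (fst c) (snd c)"

definition chart_range :: "('m, 'n::finite) chart \<Rightarrow> (real^'n) set" where
  "chart_range c = snd c ` fst c"

definition is_chart :: "('m::topological_space, 'n::finite) chart \<Rightarrow> bool" where
  "is_chart c \<longleftrightarrow> open (fst c) \<and> open (chart_range c) \<and>
     homeomorphism (fst c) (chart_range c) (snd c) (chart_inv c)"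

definition oriented_atlas :: "('m::topological_space, 'n::finite) chart set \<Rightarrow> bool" where
  "oriented_atlas A \<longleftrightarrow>
     (\<forall>c\<in>A. is_chart c) \<and> (\<Union>c\<in>A. fst c) = UNIV \<and>
     (\<forall>c\<in>A. \<forall>c'\<in>A.
        smooth_on (snd c ` (fst c \<inter> fst c')) (snd c' \<circ> chart_inv c) \<and>
        (\<forall>y\<in>snd c ` (fst c \<inter> fst c').
           det (matrix (frechet_derivative (snd c' \<circ> chart_inv c) (at y))) > 0))"

text \<open>Each point \<open>x\<close> gets a reference chart, and the tangent space at \<open>x\<close> is \<^typ>\<open>real^'n\<close>, a tangent
  vector being given by its components in that reference chart. No continuity of this choice in
  \<open>x\<close> is meant; smoothness and measurability are always tested on components in a fixed chart
  \<open>c\<close>. The map \<open>to_ref A c x\<close> converts components in the chart \<open>c\<close> into components in the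
  reference chart at \<open>x\<close>. Thus sections of tensor bundles are functions on \<^typ>\<open>'m\<close>.\<close>

definition ref_chart :: "('m, 'n::finite) chart set \<Rightarrow> 'm \<Rightarrow> ('m, 'n) chart" where
  "ref_chart A x = (SOME c. c \<in> A \<and> x \<in> fst c)"

definition to_ref :: "('m, 'n::finite) chart set \<Rightarrow> ('m, 'n) chart \<Rightarrow> 'm \<Rightarrow> real^'n \<Rightarrow> real^'n" where
  "to_ref A c x = frechet_derivative (snd (ref_chart A x) \<circ> chart_inv c) (at (snd c x))"

definition smooth_fun ::
  "('m, 'n::finite) chart set \<Rightarrow> ('m \<Rightarrow> 'b::real_normed_vector) \<Rightarrow> bool" where
  "smooth_fun A f \<longleftrightarrow> (\<forall>c\<in>A. smooth_on (chart_range c) (f \<circ> chart_inv c))"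


section \<open>Differential forms\<close>

text \<open>A \<open>p\<close>-linear form takes the list of its arguments and is \<open>0\<close> on lists of length other
  than \<open>p\<close>.\<close>

definition alt_form :: "nat \<Rightarrow> ((real^'n::finite) list \<Rightarrow> complex) \<Rightarrow> bool" where
  "alt_form p f \<longleftrightarrow>
     (\<forall>vs. length vs \<noteq> p \<longrightarrow> f vs = 0) \<and>
     (\<forall>us ws. length us + Suc (length ws) = p \<longrightarrow> linear (\<lambda>v. f (us @ v # ws))) \<and>
     (\<forall>vs i j. i < j \<and> j < length vs \<and> vs ! i = vs ! j \<longrightarrow> f vs = 0)"

type_synonym ('m, 'n) form_field = "'m \<Rightarrow> (real^'n) list \<Rightarrow> complex"

definition loc_form ::
  "('m, 'n::finite) chart set \<Rightarrow> ('m, 'n) chart \<Rightarrow> ('m, 'n) form_field \<Rightarrow>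
   real^'n \<Rightarrow> (real^'n) list \<Rightarrow> complex" where
  "loc_form A c \<omega> y vs = \<omega> (chart_inv c y) (map (to_ref A c (chart_inv c y)) vs)"

definition Omega :: "('m, 'n::finite) chart set \<Rightarrow> nat \<Rightarrow> ('m, 'n) form_field set" where
  "Omega A p = {\<omega>. (\<forall>x. alt_form p (\<omega> x)) \<and>
     (\<forall>c\<in>A. \<forall>vs. smooth_on (chart_range c) (\<lambda>y. loc_form A c \<omega> y vs))}"

definition Omega_c ::
  "('m::topological_space, 'n::finite) chart set \<Rightarrow> nat \<Rightarrow> ('m, 'n) form_field set" where
  "Omega_c A p = {\<omega>\<in>Omega A p. compact (closure {x. \<omega> x \<noteq> (\<lambda>_. 0)})}"

definition real_one_form ::
  "('m, 'n::finite) chart set \<Rightarrow> ('m \<Rightarrow> real^'n \<Rightarrow> real) \<Rightarrow> bool" where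
  "real_one_form A \<alpha> \<longleftrightarrow> (\<forall>x. linear (\<alpha> x)) \<and>
     (\<forall>c\<in>A. \<forall>v. smooth_on (chart_range c)
        (\<lambda>y. \<alpha> (chart_inv c y) (to_ref A c (chart_inv c y) v)))"

definition scale_form :: "('m \<Rightarrow> complex) \<Rightarrow> ('m, 'n::finite) form_field \<Rightarrow> ('m, 'n) form_field" where
  "scale_form f \<omega> = (\<lambda>x vs. f x * \<omega> x vs)"

definition fun_form :: "('m \<Rightarrow> complex) \<Rightarrow> ('m, 'n::finite) form_field" where
  "fun_form f = (\<lambda>x vs. if vs = [] then f x else 0)"

definition remove_nth :: "nat \<Rightarrow> 'a list \<Rightarrow> 'a list" where
  "remove_nth i vs = take i vs @ drop (Suc i) vs"

text \<open>\<open>(\<alpha> \<and> \<omega>)(v\<^sub>0,\<dots>,v\<^sub>p) = \<Sum>\<^sub>i (-1)\<^sup>i \<alpha>(v\<^sub>i) \<omega>(\<dots>,v\<^sub>i omitted,\<dots>)\<close>, and the exterior derivative is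
  given by the same formula with \<open>\<alpha>(v\<^sub>i)\<close> replaced by the derivative in direction \<open>v\<^sub>i\<close> of the
  components, computed at \<open>x\<close> in the reference chart at \<open>x\<close>.\<close>

definition wedge_one ::
  "('m \<Rightarrow> real^'n::finite \<Rightarrow> real) \<Rightarrow> ('m, 'n) form_field \<Rightarrow> ('m, 'n) form_field" where
  "wedge_one \<alpha> \<omega> = (\<lambda>x vs.
     \<Sum>i<length vs. (-1) ^ i * of_real (\<alpha> x (vs ! i)) * \<omega> x (remove_nth i vs))"

definition ext_d ::
  "('m, 'n::finite) chart set \<Rightarrow> ('m, 'n) form_field \<Rightarrow> ('m, 'n) form_field" where
  "ext_d A \<omega> = (\<lambda>x vs.
     \<Sum>i<length vs. (-1) ^ i *
       frechet_derivative (\<lambda>y. loc_form A (ref_chart A x) \<omega> y (remove_nth i vs))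
         (at (snd (ref_chart A x) x)) (vs ! i))"

definition contract ::
  "('m \<Rightarrow> real^'n::finite) \<Rightarrow> ('m, 'n) form_field \<Rightarrow> ('m, 'n) form_field" where
  "contract X \<omega> = (\<lambda>x vs. \<omega> x (X x # vs))"

text \<open>\<open>\<alpha>\<^sub>\<tau> = d\<tau> / (i\<tau>)\<close>. This is real-valued when \<open>\<bar>\<tau>\<bar> = 1\<close>; \<^const>\<open>Re\<close> only adjusts the type.\<close>

definition alpha_tau ::
  "('m, 'n::finite) chart set \<Rightarrow> ('m \<Rightarrow> complex) \<Rightarrow> 'm \<Rightarrow> real^'n \<Rightarrow> real" where
  "alpha_tau A \<tau> = (\<lambda>x v. Re (ext_d A (fun_form \<tau>) x [v] / (\<i> * \<tau> x)))"


section \<open>Riemannian structure\<close>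

type_synonym ('m, 'n) metric = "'m \<Rightarrow> real^'n \<Rightarrow> real^'n \<Rightarrow> real"

definition loc_metric ::
  "('m, 'n::finite) chart set \<Rightarrow> ('m, 'n) chart \<Rightarrow> ('m, 'n) metric \<Rightarrow>
   real^'n \<Rightarrow> real^'n \<Rightarrow> real^'n \<Rightarrow> real" where
  "loc_metric A c g y u v =
     g (chart_inv c y) (to_ref A c (chart_inv c y) u) (to_ref A c (chart_inv c y) v)"

definition riemannian_metric ::
  "('m, 'n::finite) chart set \<Rightarrow> ('m, 'n) metric \<Rightarrow> bool" where
  "riemannian_metric A g \<longleftrightarrow>
     (\<forall>x. bilinear (g x) \<and> (\<forall>u v. g x u v = g x v u) \<and> (\<forall>v. v \<noteq> 0 \<longrightarrow> g x v v > 0)) \<and>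
     (\<forall>c\<in>A. \<forall>u v. smooth_on (chart_range c) (\<lambda>y. loc_metric A c g y u v))"

definition gram :: "(real^'n::finite \<Rightarrow> real^'n \<Rightarrow> real) \<Rightarrow> real^'n^'n" where
  "gram b = (\<chi> i j. b (axis i 1) (axis j 1))"

definition sharp ::
  "('m, 'n::finite) metric \<Rightarrow> ('m \<Rightarrow> real^'n \<Rightarrow> real) \<Rightarrow> 'm \<Rightarrow> real^'n" where
  "sharp g \<alpha> x = (THE X. \<forall>v. g x X v = \<alpha> x v)"

text \<open>The Riemannian measure: in each chart it has density \<open>sqrt (det (g\<^sub>i\<^sub>j))\<close>.\<close>

definition riem_vol ::
  "('m::topological_space, 'n::finite) chart set \<Rightarrow> ('m, 'n) metric \<Rightarrow> 'm measure" where
  "riem_vol A g = (THE \<mu>. sets \<mu> = sets borel \<and>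
     (\<forall>c\<in>A. \<forall>S\<in>sets borel. S \<subseteq> fst c \<longrightarrow>
        emeasure \<mu> S =
          (\<integral>\<^sup>+y\<in>snd c ` S. ennreal (sqrt (det (gram (loc_metric A c g y)))) \<partial>lborel)))"

text \<open>The Hermitian product on \<open>p\<close>-forms at \<open>x\<close>, complex linear in the first argument, in terms of
  \<open>g\<^sup>i\<^sup>j\<close>. The sum runs over all multi-indices, not just the increasing ones, hence the factor
  \<open>1/p!\<close>.\<close>

definition form_inner ::
  "('m, 'n::finite) metric \<Rightarrow> nat \<Rightarrow> ('m, 'n) form_field \<Rightarrow> ('m, 'n) form_field \<Rightarrow> 'm \<Rightarrow> complex" where
  "form_inner g p \<omega> \<eta> x = (1 / fact p) *
     (\<Sum>I | length I = p. \<Sum>J | length J = p.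
        of_real (\<Prod>a<p. matrix_inv (gram (g x)) $ (I ! a) $ (J ! a)) *
        \<omega> x (map (\<lambda>i. axis i 1) I) * cnj (\<eta> x (map (\<lambda>j. axis j 1) J)))"

definition L2_inner ::
  "('m::topological_space, 'n::finite) chart set \<Rightarrow> ('m, 'n) metric \<Rightarrow> nat \<Rightarrow>
   ('m, 'n) form_field \<Rightarrow> ('m, 'n) form_field \<Rightarrow> complex" where
  "L2_inner A g p \<omega> \<eta> = (\<integral>x. form_inner g p \<omega> \<eta> x \<partial>riem_vol A g)"

text \<open>The formal adjoint of \<^const>\<open>ext_d\<close>, applied to a \<open>p\<close>-form.\<close>

definition codiff ::
  "('m::topological_space, 'n::finite) chart set \<Rightarrow> ('m, 'n) metric \<Rightarrow> nat \<Rightarrow>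
   ('m, 'n) form_field \<Rightarrow> ('m, 'n) form_field" where
  "codiff A g p \<omega> = (if p = 0 then (\<lambda>x vs. 0) else
     (THE \<eta>. \<eta> \<in> Omega A (p - 1) \<and>
        (\<forall>\<phi>\<in>Omega_c A (p - 1). L2_inner A g p (ext_d A \<phi>) \<omega> = L2_inner A g (p - 1) \<phi> \<eta>)))"


section \<open>The magnetic Hodge Laplacian\<close>

definition mag_d ::
  "('m, 'n::finite) chart set \<Rightarrow> ('m \<Rightarrow> real^'n \<Rightarrow> real) \<Rightarrow>
   ('m, 'n) form_field \<Rightarrow> ('m, 'n) form_field" where
  "mag_d A \<alpha> \<omega> = (\<lambda>x vs. ext_d A \<omega> x vs + \<i> * wedge_one \<alpha> \<omega> x vs)"

definition mag_codiff ::
  "('m::topological_space, 'n::finite) chart set \<Rightarrow> ('m, 'n) metric \<Rightarrow>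
   ('m \<Rightarrow> real^'n \<Rightarrow> real) \<Rightarrow> nat \<Rightarrow> ('m, 'n) form_field \<Rightarrow> ('m, 'n) form_field" where
  "mag_codiff A g \<alpha> p \<omega> = (\<lambda>x vs. codiff A g p \<omega> x vs - \<i> * contract (sharp g \<alpha>) \<omega> x vs)"

definition mag_laplacian ::
  "('m::topological_space, 'n::finite) chart set \<Rightarrow> ('m, 'n) metric \<Rightarrow>
   ('m \<Rightarrow> real^'n \<Rightarrow> real) \<Rightarrow> nat \<Rightarrow> ('m, 'n) form_field \<Rightarrow> ('m, 'n) form_field" where
  "mag_laplacian A g \<alpha> p \<omega> = (\<lambda>x vs.
     mag_d A \<alpha> (mag_codiff A g \<alpha> p \<omega>) x vs + mag_codiff A g \<alpha> (Suc p) (mag_d A \<alpha> \<omega>) x vs)"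


section \<open>Spectrum\<close>

text \<open>For an operator \<open>T\<close> on smooth \<open>p\<close>-forms of a closed manifold: the spectrum of its closure
  as an unbounded operator in the Hilbert space of square integrable \<open>p\<close>-forms. Elements of this
  Hilbert space are represented by forms, two of which are identified if their difference has
  norm \<open>0\<close>.\<close>

definition L2_forms ::
  "('m::topological_space, 'n::finite) chart set \<Rightarrow> ('m, 'n) metric \<Rightarrow> nat \<Rightarrow>
   ('m, 'n) form_field set" where
  "L2_forms A g p = {\<omega>. (\<forall>x. alt_form p (\<omega> x)) \<and>
     (\<forall>c\<in>A. \<forall>vs. (\<lambda>y. loc_form A c \<omega> y vs) \<in> borel_measurable (restrict_space borel (chart_range c))) \<and>
     integrable (riem_vol A g) (form_inner g p \<omega> \<omega>)}"

definition L2_norm_form ::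
  "('m::topological_space, 'n::finite) chart set \<Rightarrow> ('m, 'n) metric \<Rightarrow> nat \<Rightarrow>
   ('m, 'n) form_field \<Rightarrow> real" where
  "L2_norm_form A g p \<omega> = sqrt (Re (L2_inner A g p \<omega> \<omega>))"

definition closure_graph ::
  "('m::topological_space, 'n::finite) chart set \<Rightarrow> ('m, 'n) metric \<Rightarrow> nat \<Rightarrow>
   (('m, 'n) form_field \<Rightarrow> ('m, 'n) form_field) \<Rightarrow> (('m, 'n) form_field \<times> ('m, 'n) form_field) set" where
  "closure_graph A g p T = {(u, f). u \<in> L2_forms A g p \<and> f \<in> L2_forms A g p \<and>
     (\<exists>s. (\<forall>k::nat. s k \<in> Omega A p) \<and>
        (\<lambda>k. L2_norm_form A g p (\<lambda>x vs. s k x vs - u x vs)) \<longlonglongrightarrow> 0 \<and>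
        (\<lambda>k. L2_norm_form A g p (\<lambda>x vs. T (s k) x vs - f x vs)) \<longlonglongrightarrow> 0)}"

text \<open>\<open>z\<close> is in the resolvent set if \<open>u \<mapsto> T u - z u\<close> is a bijection from the domain of the closure
  onto the Hilbert space, with bounded inverse.\<close>

definition resolvent_set ::
  "('m::topological_space, 'n::finite) chart set \<Rightarrow> ('m, 'n) metric \<Rightarrow> nat \<Rightarrow>
   (('m, 'n) form_field \<Rightarrow> ('m, 'n) form_field) \<Rightarrow> complex set" where
  "resolvent_set A g p T = {z. \<exists>C. \<forall>f\<in>L2_forms A g p. \<exists>u.
     (u, \<lambda>x vs. f x vs + z * u x vs) \<in> closure_graph A g p T \<and>
     (\<forall>u'. (u', \<lambda>x vs. f x vs + z * u' x vs) \<in> closure_graph A g p T \<longrightarrow>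
        L2_norm_form A g p (\<lambda>x vs. u' x vs - u x vs) = 0) \<and>
     L2_norm_form A g p u \<le> C * L2_norm_form A g p f}"

definition op_spectrum ::
  "('m::topological_space, 'n::finite) chart set \<Rightarrow> ('m, 'n) metric \<Rightarrow> nat \<Rightarrow>
   (('m, 'n) form_field \<Rightarrow> ('m, 'n) form_field) \<Rightarrow> complex set" where
  "op_spectrum A g p T = - resolvent_set A g p T"

text \<open>The dimension of the eigenspace of \<open>z\<close>, i.e. the supremum of the sizes of linearly
  independent families of eigenvectors; it is \<open>0\<close> if \<open>z\<close> is not an eigenvalue.\<close>

definition eigen_mult ::
  "('m::topological_space, 'n::finite) chart set \<Rightarrow> ('m, 'n) metric \<Rightarrow> nat \<Rightarrow>
   (('m, 'n) form_field \<Rightarrow> ('m, 'n) form_field) \<Rightarrow> complex \<Rightarrow> enat" where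
  "eigen_mult A g p T z = Sup {enat k | k. \<exists>u :: nat \<Rightarrow> ('m, 'n) form_field.
     (\<forall>i<k. (u i, \<lambda>x vs. z * u i x vs) \<in> closure_graph A g p T) \<and>
     (\<forall>a :: nat \<Rightarrow> complex.
        L2_norm_form A g p (\<lambda>x vs. \<Sum>i<k. a i * u i x vs) = 0 \<longrightarrow> (\<forall>i<k. a i = 0))}"

end

theory Submission
  imports Defs
begin

text \<open>
  Multiplication by \<open>\<tau>\<close> is a pointwise unitary operator on forms, and \<open>d\<tau> = i \<tau> \<alpha>\<^sub>\<tau>\<close>. The Leibniz rule
  therefore gives \<open>d(\<tau>\<omega>) = \<tau> (d + i \<alpha>\<^sub>\<tau>\<and>) \<omega>\<close>, and the product rule for the divergence gives
  \<open>\<delta>(\<tau>\<omega>) = \<tau> (\<delta> - i \<alpha>\<^sub>\<tau>\<^sup>\<sharp> \<lrcorner>) \<omega>\<close>. Hence \<open>d\<^sup>\<alpha>\<close> and \<open>\<delta>\<^sup>\<alpha>\<close>, and with them \<open>\<Delta>\<^sup>\<alpha>\<close>, turn into the operators of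
  \<open>\<alpha> + \<alpha>\<^sub>\<tau>\<close> when \<open>\<tau>\<close> is pulled out (\<open>mag_d_scale_form\<close>, \<open>mag_codiff_scale_form\<close>,
  \<open>mag_laplacian_scale_form\<close>). Since multiplication by \<open>\<tau>\<close> preserves smooth forms and the
  \<open>L\<^sup>2\<close> norm, it carries the closed graph, the resolvent set and the eigenspaces of one operator to
  those of the other.

  The substance lies in the codifferential, which is characterised as the formal adjoint of \<open>d\<close>; to
  compute with it one has to show that a formal adjoint exists and is unique
  (\<open>codiff_eq_codiff_form\<close>). In a chart with Gram matrix \<open>G\<close> and volume density
  \<open>s = sqrt (det G)\<close> it is \<open>(\<delta>\<omega>)\<^sub>J = - (1/s) \<Sum>\<^sub>k \<partial>\<^sub>k (s \<omega>\<^sup>k\<^sub>J)\<close>, the indices \<open>J\<close> being raised before the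
  differentiation and lowered after it. Integration by parts shows that this is adjoint to \<open>d\<close> on
  forms supported in the chart (\<open>adjoint_in_chart\<close>). Test forms separate points
  (\<open>test_forms_separate\<close>), so the expressions from two charts agree where both are defined
  (\<open>codiff_form_chart\<close>) and fit together to a global form. A compactly supported form is a finite sum
  of forms supported in charts, whence the global adjoint relation (\<open>codiff_form_adjoint\<close>), and
  uniqueness is once more the separation by test forms.

  This rests on three facts about the geometric data. The exterior derivative, given by its
  expression in one chart at each point, has the same expression in every chart
  (\<open>loc_form_ext_d\<close>): the second derivatives of the coordinate change are symmetric and cancel in the
  alternating sum. The measure described by its densities in the charts exists and is unique
  (\<open>riem_vol_exists_unique\<close>): the chart measures agree on overlaps by the change of variables formula,
  and countably many charts suffice. The pointwise inner product of forms can be computed in every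
  chart (\<open>form_inner_chart\<close>), because raising all indices of one factor replaces the double sum over
  multi-indices by a single sum whose behaviour under a change of basis is seen slot by slot.
\<close>


section \<open>Calculus of smooth maps\<close>

abbreviation dirderiv :: "('a::real_normed_vector \<Rightarrow> 'b::real_normed_vector) \<Rightarrow> 'a \<Rightarrow> 'a \<Rightarrow> 'b" where
  "dirderiv f y v \<equiv> frechet_derivative f (at y) v"

lemma dirderiv_eq: "(f has_derivative f') (at y) \<Longrightarrow> dirderiv f y v = f' v"
  by (metis frechet_derivative_at)

lemma frechet_derivative_cong_open:
  assumes "open S" "y \<in> S" "\<And>x. x \<in> S \<Longrightarrow> f x = g x"
  shows "frechet_derivative f (at y) = frechet_derivative g (at y)"
proof -
  have "(f has_derivative f') (at y) \<longleftrightarrow> (g has_derivative f') (at y)" for f'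
    using has_derivative_transform_within_open[OF _ assms(1,2)] assms(3) by metis
  then show ?thesis unfolding frechet_derivative_def by simp
qed

lemma differentiable_cong_open:
  assumes "open S" "y \<in> S" "\<And>x. x \<in> S \<Longrightarrow> f x = g x" "f differentiable (at y)"
  shows "g differentiable (at y)"
  using assms has_derivative_transform_within_open unfolding differentiable_def by metis

lemma Ck_on_cong:
  assumes "open S" "\<And>x. x \<in> S \<Longrightarrow> f x = g x" "Ck_on k S f"
  shows "Ck_on k S g"
  using assms(2,3)
proof (induction k arbitrary: f g)
  case 0 then show ?case by (simp cong: continuous_on_cong)
next
  case (Suc k)
  have "g differentiable (at y)" if "y \<in> S" for y
    by (rule differentiable_cong_open[OF assms(1) that Suc.prems(1)]) (use Suc.prems(2) that in auto)
  moreover have D: "dirderiv f y v = dirderiv g y v" if "y \<in> S" for y v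
    by (simp only: frechet_derivative_cong_open[OF assms(1) that Suc.prems(1)])
  moreover have "Ck_on k S (\<lambda>y. dirderiv f y v)" for v using Suc.prems(2) by simp
  then have "Ck_on k S (\<lambda>y. dirderiv g y v)" for v
    using Suc.IH[of "\<lambda>y. dirderiv f y v" "\<lambda>y. dirderiv g y v", OF D] by blast
  ultimately show ?case by simp
qed

lemma Ck_on_subset: "Ck_on k S f \<Longrightarrow> S' \<subseteq> S \<Longrightarrow> Ck_on k S' f"
  by (induction k arbitrary: f) (auto intro: continuous_on_subset)

lemma Ck_on_SucD: "Ck_on (Suc k) S f \<Longrightarrow> Ck_on k S f"
proof (induction k arbitrary: f)
  case 0 then show ?case
    by (auto intro!: continuous_at_imp_continuous_on differentiable_imp_continuous_within)
next
  case (Suc k) then show ?case by (metis Ck_on.simps(2))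
qed

lemma Ck_on_SucI:
  assumes "open S" "\<And>y. y \<in> S \<Longrightarrow> (f has_derivative f' y) (at y)"
    and "\<And>v. Ck_on k S (\<lambda>y. f' y v)"
  shows "Ck_on (Suc k) S f"
proof -
  have "Ck_on k S (\<lambda>y. dirderiv f y v)" for v
    by (rule Ck_on_cong[OF assms(1) _ assms(3)[of v]]) (use assms(2) dirderiv_eq in metis)
  then show ?thesis using assms(2) by (auto simp: differentiable_def)
qed

lemma Ck_on_Suc_has_derivative:
  "Ck_on (Suc k) S f \<Longrightarrow> y \<in> S \<Longrightarrow> (f has_derivative frechet_derivative f (at y)) (at y)"
  by (simp add: frechet_derivative_works)

lemma Ck_on_local:
  assumes "\<And>y. y \<in> S \<Longrightarrow> \<exists>U. open U \<and> y \<in> U \<and> Ck_on k U f"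
  shows "Ck_on k S f"
  using assms
proof (induction k arbitrary: f)
  case 0 then show ?case
    by (metis Ck_on.simps(1) continuous_on_eq_continuous_at continuous_at_imp_continuous_on)
next
  case (Suc k)
  have "f differentiable (at y)" if "y \<in> S" for y using Suc.prems[OF that] by auto
  moreover have "Ck_on k S (\<lambda>y. dirderiv f y v)" for v
    by (rule Suc.IH) (metis Suc.prems Ck_on.simps(2))
  ultimately show ?case by simp
qed

lemma Ck_on_const: "Ck_on k S (\<lambda>_. c)"
  by (induction k arbitrary: c) auto

lemma Ck_on_linear:
  assumes "bounded_linear L" "open S" "Ck_on k S f"
  shows "Ck_on k S (\<lambda>y. L (f y))"
  using assms(3)
proof (induction k arbitrary: f)
  case 0 then show ?case using assms(1) by (simp add: bounded_linear.continuous_on)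
next
  case (Suc k)
  show ?case
    by (rule Ck_on_SucI[OF assms(2) bounded_linear.has_derivative[OF assms(1)
            Ck_on_Suc_has_derivative[OF Suc.prems]] Suc.IH]) (use Suc.prems in auto)
qed

lemma Ck_on_add:
  assumes "open S" "Ck_on k S f" "Ck_on k S g"
  shows "Ck_on k S (\<lambda>y. f y + g y)"
  using assms(2,3)
proof (induction k arbitrary: f g)
  case 0 then show ?case by (auto intro: continuous_on_add)
next
  case (Suc k)
  show ?case
    by (rule Ck_on_SucI[OF assms(1) has_derivative_add[OF Ck_on_Suc_has_derivative[OF Suc.prems(1)]
            Ck_on_Suc_has_derivative[OF Suc.prems(2)]] Suc.IH]) (use Suc.prems in auto)
qed

lemma Ck_on_sum:
  assumes "open S" "\<And>i. i \<in> I \<Longrightarrow> Ck_on k S (f i)"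
  shows "Ck_on k S (\<lambda>y. \<Sum>i\<in>I. f i y)"
  using assms(2)
  by (induction I rule: infinite_finite_induct) (auto intro: Ck_on_const Ck_on_add[OF assms(1)])

lemma Ck_on_bilinear:
  assumes "bounded_bilinear b" "open S" "Ck_on k S f" "Ck_on k S g"
  shows "Ck_on k S (\<lambda>y. b (f y) (g y))"
  using assms(3,4)
proof (induction k arbitrary: f g)
  case 0 then show ?case using bounded_bilinear.continuous_on[OF assms(1)] by simp
next
  case (Suc k)
  have "Ck_on k S (\<lambda>y. b (f y) (dirderiv g y v) + b (dirderiv f y v) (g y))" for v
    by (intro Ck_on_add Suc.IH assms(2)) (use Suc.prems Ck_on_SucD in auto)
  then show ?case
    by (intro Ck_on_SucI[OF assms(2) bounded_bilinear.FDERIV[OF assms(1)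
            Ck_on_Suc_has_derivative[OF Suc.prems(1)] Ck_on_Suc_has_derivative[OF Suc.prems(2)]]]) auto
qed

lemma vec_expand: "(\<Sum>i\<in>UNIV. (v $ i) *\<^sub>R axis i 1) = (v :: real^'n::finite)"
  using basis_expansion[of v] by (simp add: scalar_mult_eq_scaleR)

lemma linear_expand:
  "linear (L :: real^'n::finite \<Rightarrow> 'b::real_normed_vector) \<Longrightarrow> L v = (\<Sum>i\<in>UNIV. (v $ i) *\<^sub>R L (axis i 1))"
  by (metis (no_types, lifting) linear_sum linear_scale sum.cong vec_expand)

lemma Ck_on_compose:
  fixes g :: "real^'n::finite \<Rightarrow> real^'m::finite"
  assumes "open S" "g ` S \<subseteq> U" "Ck_on k U f" "Ck_on k S g"
  shows "Ck_on k S (\<lambda>y. f (g y))"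
  using assms(3,4)
proof (induction k arbitrary: f)
  case 0 then show ?case using assms(2) by (auto intro: continuous_on_compose2)
next
  case (Suc k)
  have d: "((\<lambda>y. f (g y)) has_derivative (\<lambda>v. dirderiv f (g y) (dirderiv g y v))) (at y)"
    if "y \<in> S" for y
    using has_derivative_compose[of g "frechet_derivative g (at y)" y UNIV f
        "frechet_derivative f (at (g y))"] Ck_on_Suc_has_derivative[OF Suc.prems(2) that]
      Ck_on_Suc_has_derivative[OF Suc.prems(1)] that assms(2) by auto
  have e: "dirderiv f (g y) (dirderiv g y v) =
      (\<Sum>i\<in>UNIV. (dirderiv g y v $ i) *\<^sub>R dirderiv f (g y) (axis i 1))" if "y \<in> S" for y v
    by (rule linear_expand) (use Suc.prems that assms(2) linear_frechet_derivative in auto)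
  have "Ck_on k S (\<lambda>y. (dirderiv g y v $ i) *\<^sub>R dirderiv f (g y) (axis i 1))" for i v
    using Suc.prems Ck_on_SucD[OF Suc.prems(2)] assms(1)
    by (intro Ck_on_bilinear[OF bounded_bilinear_scaleR] Ck_on_linear[OF bounded_linear_vec_nth]
        Suc.IH) auto
  then have "Ck_on k S (\<lambda>y. \<Sum>i\<in>UNIV. (dirderiv g y v $ i) *\<^sub>R dirderiv f (g y) (axis i 1))" for v
    by (intro Ck_on_sum assms(1))
  then have "Ck_on k S (\<lambda>y. dirderiv f (g y) (dirderiv g y v))" for v
    using Ck_on_cong[OF assms(1), of "\<lambda>y. \<Sum>i\<in>UNIV. (dirderiv g y v $ i) *\<^sub>R dirderiv f (g y) (axis i 1)"] e
    by auto
  with d show ?case by (intro Ck_on_SucI[OF assms(1), of "\<lambda>y. f (g y)" "\<lambda>y v. dirderiv f (g y) (dirderiv g y v)"])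
qed

text \<open>A set of functions on the line that is closed under differentiation consists of smooth functions.
  In this form the chain rule covers powers and the building blocks of bump functions alike.\<close>

lemma Ck_on_scalar_compose:
  fixes H :: "(real \<Rightarrow> real) set"
  assumes H: "\<And>h. h \<in> H \<Longrightarrow> \<exists>h'\<in>H. \<forall>t\<in>P. (h has_real_derivative h' t) (at t)"
    and "open S" "f ` S \<subseteq> P" "Ck_on k S f" "h \<in> H"
  shows "Ck_on k S (\<lambda>y. h (f y))"
  using assms(4,5)
proof (induction k arbitrary: h)
  case 0
  have "continuous_on P h"
    using H[OF 0(2)] by (metis DERIV_continuous continuous_at_imp_continuous_on)
  then show ?case using 0 assms(3) by (auto intro: continuous_on_compose2)
next
  case (Suc k)
  obtain h' where h': "h' \<in> H" "\<And>t. t \<in> P \<Longrightarrow> (h has_real_derivative h' t) (at t)"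
    using H[OF Suc.prems(2)] by blast
  have "((\<lambda>y. h (f y)) has_derivative (\<lambda>v. dirderiv f y v * h' (f y))) (at y)" if "y \<in> S" for y
  proof -
    have "f y \<in> P" using that assms(3) by blast
    then have "(h has_derivative (*) (h' (f y))) (at (f y))"
      using h'(2) by (simp only: has_field_derivative_def)
    moreover have "(*) (h' (f y)) = (\<lambda>x. x * h' (f y))" by (rule ext) (rule mult.commute)
    ultimately have "(h has_derivative (\<lambda>x. x * h' (f y))) (at (f y))" by (simp only:)
    then show ?thesis
      by (rule has_derivative_compose[OF Ck_on_Suc_has_derivative[OF Suc.prems(1) that]])
  qed
  moreover have "Ck_on k S (\<lambda>y. dirderiv f y v * h' (f y))" for v
    using Suc.prems Suc.IH[OF Ck_on_SucD[OF Suc.prems(1)] h'(1)]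
    by (intro Ck_on_bilinear[OF bounded_bilinear_mult assms(2)]) auto
  ultimately show ?case by (rule Ck_on_SucI[OF assms(2)])
qed

lemma smooth_on_cong: "open S \<Longrightarrow> smooth_on S f \<Longrightarrow> (\<And>x. x \<in> S \<Longrightarrow> f x = g x) \<Longrightarrow> smooth_on S g"
  unfolding smooth_on_def using Ck_on_cong by metis

lemma smooth_on_subset: "smooth_on S f \<Longrightarrow> S' \<subseteq> S \<Longrightarrow> smooth_on S' f"
  unfolding smooth_on_def using Ck_on_subset by blast

lemma smooth_on_local:
  "(\<And>y. y \<in> S \<Longrightarrow> \<exists>U. open U \<and> y \<in> U \<and> smooth_on U f) \<Longrightarrow> smooth_on S f"
  unfolding smooth_on_def using Ck_on_local by metis

lemma smooth_on_const: "smooth_on S (\<lambda>_. c)"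
  unfolding smooth_on_def using Ck_on_const by blast

lemma smooth_on_linear: "bounded_linear L \<Longrightarrow> open S \<Longrightarrow> smooth_on S f \<Longrightarrow> smooth_on S (\<lambda>y. L (f y))"
  unfolding smooth_on_def using Ck_on_linear by blast

lemma smooth_on_add:
  "open S \<Longrightarrow> smooth_on S f \<Longrightarrow> smooth_on S g \<Longrightarrow> smooth_on S (\<lambda>y. f y + g y)"
  unfolding smooth_on_def using Ck_on_add by blast

lemma smooth_on_sum:
  "open S \<Longrightarrow> (\<And>i. i \<in> I \<Longrightarrow> smooth_on S (f i)) \<Longrightarrow> smooth_on S (\<lambda>y. \<Sum>i\<in>I. f i y)"
  unfolding smooth_on_def using Ck_on_sum by metis

lemma smooth_on_mult:
  fixes f g :: "real^'n::finite \<Rightarrow> 'b::real_normed_algebra"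
  shows "open S \<Longrightarrow> smooth_on S f \<Longrightarrow> smooth_on S g \<Longrightarrow> smooth_on S (\<lambda>y. f y * g y)"
  unfolding smooth_on_def using Ck_on_bilinear[OF bounded_bilinear_mult] by blast

lemma smooth_on_scaleR:
  "open S \<Longrightarrow> smooth_on S f \<Longrightarrow> smooth_on S g \<Longrightarrow> smooth_on S (\<lambda>y. f y *\<^sub>R g y)"
  unfolding smooth_on_def using Ck_on_bilinear[OF bounded_bilinear_scaleR] by blast

lemma smooth_on_compose:
  fixes g :: "real^'n::finite \<Rightarrow> real^'m::finite"
  shows "open S \<Longrightarrow> g ` S \<subseteq> U \<Longrightarrow> smooth_on U f \<Longrightarrow> smooth_on S g \<Longrightarrow> smooth_on S (\<lambda>y. f (g y))"
  unfolding smooth_on_def using Ck_on_compose by blast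

lemma smooth_on_dirderiv: "smooth_on S f \<Longrightarrow> smooth_on S (\<lambda>y. dirderiv f y v)"
  unfolding smooth_on_def by (metis Ck_on.simps(2))

lemma smooth_on_has_derivative:
  "smooth_on S f \<Longrightarrow> y \<in> S \<Longrightarrow> (f has_derivative frechet_derivative f (at y)) (at y)"
  unfolding smooth_on_def using Ck_on_Suc_has_derivative by blast

lemma smooth_on_continuous: "smooth_on S f \<Longrightarrow> continuous_on S f"
  unfolding smooth_on_def by (metis Ck_on.simps(1))

lemma smooth_on_linear_map: "bounded_linear L \<Longrightarrow> smooth_on S L"
  unfolding smooth_on_def
proof
  fix k assume L: "bounded_linear L"
  show "Ck_on k S L"
  proof (cases k)
    case 0 then show ?thesis using L linear_continuous_on by auto
  next
    case (Suc j)
    have "dirderiv L y = L" for y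
      using dirderiv_eq[OF bounded_linear_imp_has_derivative[OF L]] by blast
    then show ?thesis
      using Suc L Ck_on_const by (auto simp: bounded_linear_imp_differentiable)
  qed
qed

lemma smooth_on_components:
  fixes f :: "real^'n::finite \<Rightarrow> real^'m::finite"
  assumes "open S" "\<And>i. smooth_on S (\<lambda>y. f y $ i)"
  shows "smooth_on S f"
proof -
  have "smooth_on S (\<lambda>y. \<Sum>i\<in>UNIV. (f y $ i) *\<^sub>R axis i (1::real))"
    by (intro smooth_on_sum smooth_on_scaleR smooth_on_const assms)
  then show ?thesis by (simp add: vec_expand)
qed

lemma smooth_on_nth: "open S \<Longrightarrow> smooth_on S f \<Longrightarrow> smooth_on S (\<lambda>y. f y $ i)"
  by (rule smooth_on_linear[OF bounded_linear_vec_nth])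

lemma smooth_on_of_real:
  "open S \<Longrightarrow> smooth_on S f \<Longrightarrow> smooth_on S (\<lambda>y. of_real (f y) :: 'b::real_normed_algebra_1)"
  by (rule smooth_on_linear[OF bounded_linear_of_real])

lemma smooth_on_cnj: "open S \<Longrightarrow> smooth_on S f \<Longrightarrow> smooth_on S (\<lambda>y. cnj (f y))"
  by (rule smooth_on_linear[OF bounded_linear_cnj])

lemma smooth_on_minus: "open S \<Longrightarrow> smooth_on S f \<Longrightarrow> smooth_on S (\<lambda>y. - f y)"
  by (rule smooth_on_linear[OF bounded_linear_minus[OF bounded_linear_ident]])

lemma smooth_on_diff:
  "open S \<Longrightarrow> smooth_on S f \<Longrightarrow> smooth_on S g \<Longrightarrow> smooth_on S (\<lambda>y. f y - g y)"
  using smooth_on_add[of S f "\<lambda>y. - g y"] smooth_on_minus by auto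

lemma smooth_on_prod:
  fixes f :: "'i \<Rightarrow> real^'n::finite \<Rightarrow> 'b::{real_normed_algebra,comm_ring_1}"
  assumes "open S" "\<And>i. i \<in> I \<Longrightarrow> smooth_on S (f i)"
  shows "smooth_on S (\<lambda>y. \<Prod>i\<in>I. f i y)"
  using assms(2)
  by (induction I rule: infinite_finite_induct) (auto intro: smooth_on_const smooth_on_mult[OF assms(1)])

lemma smooth_on_powr:
  fixes f :: "real^'n::finite \<Rightarrow> real"
  assumes "open S" "smooth_on S f" "\<And>y. y \<in> S \<Longrightarrow> f y > 0"
  shows "smooth_on S (\<lambda>y. f y powr r)"
  unfolding smooth_on_def
proof
  fix k
  define H :: "(real \<Rightarrow> real) set" where "H = {\<lambda>t. c * t powr r |c r. True}"
  have "\<exists>h'\<in>H. \<forall>t\<in>{0<..}. (h has_real_derivative h' t) (at t)" if "h \<in> H" for h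
  proof -
    from that[unfolded H_def mem_Collect_eq] obtain c r where h: "h = (\<lambda>t. c * t powr r)"
      by (elim exE conjE)
    have "\<forall>t\<in>{0<..}. (h has_real_derivative (c * r) * t powr (r - 1)) (at t)"
      unfolding h by (auto intro!: derivative_eq_intros has_real_derivative_powr)
    moreover have "(\<lambda>t. (c * r) * t powr (r - 1)) \<in> H"
      unfolding H_def mem_Collect_eq by (rule exI, rule exI, rule conjI[OF refl TrueI])
    ultimately show ?thesis by (rule bexI)
  qed
  moreover have "(\<lambda>t::real. t powr r) \<in> H"
    unfolding H_def mem_Collect_eq by (rule exI[of _ 1], rule exI[of _ r]) simp
  ultimately show "Ck_on k S (\<lambda>y. f y powr r)"
    using assms by (intro Ck_on_scalar_compose[of H "{0<..}" S f k "\<lambda>t. t powr r"])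
      (auto simp: smooth_on_def)
qed

lemma smooth_on_sqrt:
  fixes f :: "real^'n::finite \<Rightarrow> real"
  assumes "open S" "smooth_on S f" "\<And>y. y \<in> S \<Longrightarrow> f y > 0"
  shows "smooth_on S (\<lambda>y. sqrt (f y))"
  by (rule smooth_on_cong[OF assms(1) smooth_on_powr[OF assms, of "1/2"]])
    (auto simp: powr_half_sqrt less_imp_le[OF assms(3)])

lemma smooth_on_inverse:
  assumes "open S" "smooth_on S f" "\<And>y. y \<in> S \<Longrightarrow> f y \<noteq> (0::real)"
  shows "smooth_on S (\<lambda>y. inverse (f y))"
proof -
  \<comment> \<open>The base of a real power must be positive, so \<open>1/f\<close> is written as \<open>f / f\<^sup>2\<close>.\<close>
  have sq: "f y * f y > 0" if "y \<in> S" for y using assms(3)[OF that] by (simp add: zero_less_mult_iff) linarith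
  have "smooth_on S (\<lambda>y. f y * (f y * f y) powr (-1))"
    by (intro smooth_on_mult smooth_on_powr assms(1,2) sq)
  then show ?thesis
  proof (rule smooth_on_cong[OF assms(1)])
    fix y assume "y \<in> S"
    then show "f y * (f y * f y) powr (-1) = inverse (f y)"
      using sq[of y] assms(3)[of y] by (simp add: powr_minus_divide field_simps)
  qed
qed

text \<open>The mean value theorem, applied twice to the second difference
  \<open>f(x+hv+hw) - f(x+hv) - f(x+hw) + f(x)\<close>, exhibits this quantity divided by \<open>h\<^sup>2\<close> as a value
  of the mixed second derivative near \<open>x\<close>.\<close>

lemma second_difference_mean_value:
  fixes f :: "real^'n::finite \<Rightarrow> real"
  assumes h: "h > 0"
    and f: "\<And>s t. 0 \<le> s \<Longrightarrow> s \<le> h \<Longrightarrow> 0 \<le> t \<Longrightarrow> t \<le> h \<Longrightarrow>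
        (f has_derivative f' (x + s *\<^sub>R v + t *\<^sub>R w)) (at (x + s *\<^sub>R v + t *\<^sub>R w))"
    and f': "\<And>s t. 0 \<le> s \<Longrightarrow> s \<le> h \<Longrightarrow> 0 \<le> t \<Longrightarrow> t \<le> h \<Longrightarrow>
        ((\<lambda>y. f' y v) has_derivative f'' (x + s *\<^sub>R v + t *\<^sub>R w)) (at (x + s *\<^sub>R v + t *\<^sub>R w))"
  shows "\<exists>s\<in>{0..h}. \<exists>t\<in>{0..h}. f (x + h *\<^sub>R v + h *\<^sub>R w) - f (x + h *\<^sub>R v) - f (x + h *\<^sub>R w) + f x
      = h * h * f'' (x + s *\<^sub>R v + t *\<^sub>R w) w"
proof -
  define g where "g s = f (x + s *\<^sub>R v + h *\<^sub>R w) - f (x + s *\<^sub>R v)" for s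
  have dg: "(g has_real_derivative (f' (x + s *\<^sub>R v + h *\<^sub>R w) v - f' (x + s *\<^sub>R v) v)) (at s)"
    if "0 \<le> s" "s \<le> h" for s
  proof -
    have l: "linear (f' (x + s *\<^sub>R v + h *\<^sub>R w))" "linear (f' (x + s *\<^sub>R v))"
      using f[OF that, of h] f[OF that, of 0] h by (auto simp: has_derivative_linear)
    have "((\<lambda>s. f (x + s *\<^sub>R v + h *\<^sub>R w)) has_derivative (\<lambda>a. f' (x + s *\<^sub>R v + h *\<^sub>R w) (a *\<^sub>R v))) (at s)"
      by (rule has_derivative_compose[of "\<lambda>s. x + s *\<^sub>R v + h *\<^sub>R w" "\<lambda>a. a *\<^sub>R v"])
        (auto intro!: derivative_eq_intros f[OF that] less_imp_le[OF h])
    moreover have "((\<lambda>s. f (x + s *\<^sub>R v)) has_derivative (\<lambda>a. f' (x + s *\<^sub>R v) (a *\<^sub>R v))) (at s)"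
      by (rule has_derivative_compose[of "\<lambda>s. x + s *\<^sub>R v" "\<lambda>a. a *\<^sub>R v"])
        (use f[OF that, of 0] h in \<open>auto intro!: derivative_eq_intros\<close>)
    ultimately show ?thesis unfolding g_def has_field_derivative_def
      by (rule has_derivative_eq_rhs[OF has_derivative_diff])
        (rule ext, simp only: linear_scale[OF l(1)] linear_scale[OF l(2)], simp add: left_diff_distrib right_diff_distrib mult.commute)
  qed
  obtain s where s: "0 < s" "s < h"
    and gs: "g h - g 0 = (h - 0) * (f' (x + s *\<^sub>R v + h *\<^sub>R w) v - f' (x + s *\<^sub>R v) v)"
    using MVT2[OF h, of g "\<lambda>s. f' (x + s *\<^sub>R v + h *\<^sub>R w) v - f' (x + s *\<^sub>R v) v"] dg by blast
  define k where "k t = f' (x + s *\<^sub>R v + t *\<^sub>R w) v" for t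
  have dk: "(k has_real_derivative (f'' (x + s *\<^sub>R v + t *\<^sub>R w) w)) (at t)" if "0 \<le> t" "t \<le> h" for t
  proof -
    note ff = f'[OF less_imp_le[OF s(1)] less_imp_le[OF s(2)] that]
    have "((\<lambda>t. f' (x + s *\<^sub>R v + t *\<^sub>R w) v) has_derivative (\<lambda>a. f'' (x + s *\<^sub>R v + t *\<^sub>R w) (a *\<^sub>R w))) (at t)"
      by (rule has_derivative_compose[of "\<lambda>t. x + s *\<^sub>R v + t *\<^sub>R w" "\<lambda>a. a *\<^sub>R w" t UNIV "\<lambda>y. f' y v"])
        (auto intro!: derivative_eq_intros ff)
    then show ?thesis unfolding k_def has_field_derivative_def
      by (rule has_derivative_eq_rhs) (auto simp: linear_scale[OF has_derivative_linear[OF ff]])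
  qed
  obtain t where t: "0 < t" "t < h" and kt: "k h - k 0 = (h - 0) * f'' (x + s *\<^sub>R v + t *\<^sub>R w) w"
    using MVT2[OF h, of k "\<lambda>t. f'' (x + s *\<^sub>R v + t *\<^sub>R w) w"] dk by blast
  have "g h - g 0 = h * (k h - k 0)" using gs by (simp add: k_def)
  then have "g h - g 0 = h * h * f'' (x + s *\<^sub>R v + t *\<^sub>R w) w" using kt by simp
  then show ?thesis using s t unfolding g_def by (intro bexI[of _ s] bexI[of _ t]) auto
qed

lemma symmetric_second_derivative_real:
  fixes f :: "real^'n::finite \<Rightarrow> real"
  assumes "open S" "smooth_on S f" "x \<in> S"
  shows "dirderiv (\<lambda>y. dirderiv f y v) x w = dirderiv (\<lambda>y. dirderiv f y w) x v"
proof -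
  let ?A = "\<lambda>y. dirderiv (\<lambda>y. dirderiv f y v) y w" and ?B = "\<lambda>y. dirderiv (\<lambda>y. dirderiv f y w) y v"
  obtain r where r: "r > 0" "ball x r \<subseteq> S" using assms(1,3) openE by blast
  have D: "(f has_derivative frechet_derivative f (at y)) (at y)"
    "((\<lambda>y. dirderiv f y u) has_derivative frechet_derivative (\<lambda>y. dirderiv f y u) (at y)) (at y)"
    if "y \<in> ball x r" for y u
    using smooth_on_has_derivative[OF assms(2)] smooth_on_has_derivative[OF smooth_on_dirderiv[OF assms(2)]]
      that r by auto
  define c where "c = norm v + norm w + 1"
  have c: "c > 0" unfolding c_def by (simp add: add_nonneg_pos)
  have inball: "x + s *\<^sub>R v + t *\<^sub>R w \<in> ball x d" if "0 \<le> s" "s \<le> h" "0 \<le> t" "t \<le> h" "h * c < d" "0 < h"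
    for s t h d
  proof -
    have "norm (s *\<^sub>R v + t *\<^sub>R w) \<le> norm (s *\<^sub>R v) + norm (t *\<^sub>R w)" by (rule norm_triangle_ineq)
    also have "\<dots> \<le> h * norm v + h * norm w"
      using that mult_right_mono[of s h "norm v"] mult_right_mono[of t h "norm w"] by simp
    also have "\<dots> < d" using that(5,6) unfolding c_def by (simp add: algebra_simps)
    finally show ?thesis by (simp add: dist_norm norm_minus_commute algebra_simps)
  qed
  show ?thesis
  proof (rule ccontr)
    assume ne: "?A x \<noteq> ?B x"
    \<comment> \<open>Both mixed derivatives are within \<open>e\<close> of their values at \<open>x\<close> near \<open>x\<close>, but they share a value there.\<close>
    define e where "e = \<bar>?A x - ?B x\<bar> / 2"
    have e: "e > 0" using ne by (simp add: e_def)
    have "continuous_on S ?A" "continuous_on S ?B"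
      by (intro smooth_on_continuous smooth_on_dirderiv assms(2))+
    then have "isCont ?A x" "isCont ?B x"
      using assms(1,3) by (auto simp: continuous_on_eq_continuous_at)
    then obtain d1 d2 where d: "d1 > 0" "\<And>y. dist x y < d1 \<Longrightarrow> dist (?A y) (?A x) < e"
        "d2 > 0" "\<And>y. dist x y < d2 \<Longrightarrow> dist (?B y) (?B x) < e"
      using e unfolding continuous_at_eps_delta by (metis dist_commute)
    define d where "d = min r (min d1 d2)"
    define h where "h = d / (2 * c)"
    have hd: "h > 0" "h * c < d" using c d(1,3) r(1) by (auto simp: h_def d_def field_simps)
    have inr: "x + s *\<^sub>R v + t *\<^sub>R w \<in> ball x r" "x + t *\<^sub>R w + s *\<^sub>R v \<in> ball x r"
      if "0 \<le> s" "s \<le> h" "0 \<le> t" "t \<le> h" for s t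
      using inball[OF that hd(2,1)] by (auto simp: d_def add_ac)
    obtain s t where 1: "s \<in> {0..h}" "t \<in> {0..h}"
      "f (x + h *\<^sub>R v + h *\<^sub>R w) - f (x + h *\<^sub>R v) - f (x + h *\<^sub>R w) + f x = h * h * ?A (x + s *\<^sub>R v + t *\<^sub>R w)"
      using second_difference_mean_value[OF hd(1), of f "\<lambda>y. frechet_derivative f (at y)" x v w
          "\<lambda>y. frechet_derivative (\<lambda>y. dirderiv f y v) (at y)", OF D(1)[OF inr(1)] D(2)[OF inr(1)]]
      by blast
    obtain s' t' where 2: "s' \<in> {0..h}" "t' \<in> {0..h}"
      "f (x + h *\<^sub>R w + h *\<^sub>R v) - f (x + h *\<^sub>R w) - f (x + h *\<^sub>R v) + f x = h * h * ?B (x + s' *\<^sub>R w + t' *\<^sub>R v)"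
      using second_difference_mean_value[OF hd(1), of f "\<lambda>y. frechet_derivative f (at y)" x w v
          "\<lambda>y. frechet_derivative (\<lambda>y. dirderiv f y w) (at y)", OF D(1)[OF inr(2)] D(2)[OF inr(2)]]
      by blast
    have "h * h * ?A (x + s *\<^sub>R v + t *\<^sub>R w) = h * h * ?B (x + s' *\<^sub>R w + t' *\<^sub>R v)"
      using 1(3) 2(3) by (simp add: algebra_simps)
    then have "?A (x + s *\<^sub>R v + t *\<^sub>R w) = ?B (x + s' *\<^sub>R w + t' *\<^sub>R v)" using hd(1) by simp
    moreover have "dist (?A (x + s *\<^sub>R v + t *\<^sub>R w)) (?A x) < e"
      using inball[of s h t d] 1 hd by (intro d(2)) (auto simp: d_def)
    moreover have "dist (?B (x + s' *\<^sub>R w + t' *\<^sub>R v)) (?B x) < e"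
      using inball[of t' h s' d] 2 hd by (intro d(4)) (auto simp: d_def add_ac)
    ultimately show False unfolding e_def dist_real_def by (simp add: abs_if split: if_splits)
  qed
qed

lemma symmetric_second_derivative:
  fixes f :: "real^'n::finite \<Rightarrow> real^'m::finite"
  assumes "open S" "smooth_on S f" "x \<in> S"
  shows "dirderiv (\<lambda>y. dirderiv f y v) x w = dirderiv (\<lambda>y. dirderiv f y w) x v"
proof -
  have nth: "dirderiv (\<lambda>y. g y $ i) y v = dirderiv g y v $ i" if "smooth_on S g" "y \<in> S"
    for g :: "real^'n \<Rightarrow> real^'m" and i y v
    by (rule dirderiv_eq[OF bounded_linear.has_derivative[OF bounded_linear_vec_nth
            smooth_on_has_derivative[OF that]]])
  have "dirderiv (\<lambda>y. dirderiv f y v) x w $ i = dirderiv (\<lambda>y. dirderiv f y w) x v $ i" for i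
  proof -
    have *: "dirderiv (\<lambda>y. dirderiv f y v) x w $ i = dirderiv (\<lambda>y. dirderiv (\<lambda>y. f y $ i) y v) x w" for v w
    proof -
      have "dirderiv (\<lambda>y. dirderiv (\<lambda>y. f y $ i) y v) x w = dirderiv (\<lambda>y. dirderiv f y v $ i) x w"
        using frechet_derivative_cong_open[OF assms(1,3), of "\<lambda>y. dirderiv (\<lambda>y. f y $ i) y v"
            "\<lambda>y. dirderiv f y v $ i"] nth[OF assms(2)] by simp
      then show ?thesis using nth[OF smooth_on_dirderiv[OF assms(2)] assms(3)] by simp
    qed
    show ?thesis unfolding *
      by (rule symmetric_second_derivative_real[OF assms(1) smooth_on_nth[OF assms(1,2)] assms(3)])
  qed
  then show ?thesis by (simp add: vec_eq_iff)
qed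


section \<open>Smooth families of multilinear forms\<close>

definition multilin :: "nat \<Rightarrow> ((real^'n::finite) list \<Rightarrow> 'b::real_normed_vector) \<Rightarrow> bool" where
  "multilin p f \<longleftrightarrow> (\<forall>us ws. length us + Suc (length ws) = p \<longrightarrow> linear (\<lambda>v. f (us @ v # ws)))"

lemma alt_form_multilin: "alt_form p f \<Longrightarrow> multilin p f"
  by (simp add: alt_form_def multilin_def)

lemma multilinD:
  "multilin p f \<Longrightarrow> length us + Suc (length ws) = p \<Longrightarrow> linear (\<lambda>v. f (us @ v # ws))"
  by (simp only: multilin_def)

lemma multilin_tail:
  assumes "multilin (Suc p) f"
  shows "multilin p (\<lambda>ws. f (v # ws))"
  unfolding multilin_def
proof (intro allI impI)
  fix us ws :: "(real^'a) list" assume "length us + Suc (length ws) = p"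
  then show "linear (\<lambda>u. f (v # us @ u # ws))"
    using multilinD[OF assms, of "v # us" ws] by simp
qed

lemma multilin_head: "multilin (Suc p) f \<Longrightarrow> length ws = p \<Longrightarrow> linear (\<lambda>v. f (v # ws))"
  using multilinD[of "Suc p" f "[]" ws] by simp

lemma multilin_head_expand:
  assumes "multilin (Suc p) f" "length ws = p"
  shows "f (v # ws) = (\<Sum>k\<in>UNIV. (v $ k) *\<^sub>R f (axis k 1 # ws))"
  using linear_expand[OF multilin_head[OF assms]] .

text \<open>Smoothness of the components suffices for smoothness with varying arguments: expanding the first
  argument in the standard basis reduces the number of varying arguments.\<close>

lemma smooth_on_multilin:
  assumes "open S" "\<And>y. y \<in> S \<Longrightarrow> multilin (length ws) (F y)"
    and "\<And>vs. length vs = length ws \<Longrightarrow> smooth_on S (\<lambda>y. F y vs)"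
    and "\<And>u. u \<in> set ws \<Longrightarrow> smooth_on S (\<lambda>y. B y u :: real^'m::finite)"
  shows "smooth_on S (\<lambda>y. F y (map (B y) ws))"
  using assms(2-4)
proof (induction ws arbitrary: F)
  case Nil then show ?case by simp
next
  case (Cons u us)
  have "smooth_on S (\<lambda>y. F y (axis k 1 # map (B y) us))" for k
    by (rule Cons.IH) (use Cons.prems in \<open>auto intro: multilin_tail\<close>)
  then have "smooth_on S (\<lambda>y. \<Sum>k\<in>UNIV. (B y u $ k) *\<^sub>R F y (axis k 1 # map (B y) us))"
    using Cons.prems(3) by (intro smooth_on_sum smooth_on_scaleR smooth_on_nth assms(1)) auto
  then show ?case
    by (rule smooth_on_cong[OF assms(1)])
      (simp, rule multilin_head_expand[symmetric], use Cons.prems(1) in auto)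
qed

text \<open>The product rule for a multilinear form whose arguments and coefficients both vary.\<close>

lemma has_derivative_multilin:
  fixes F :: "'z::real_normed_vector \<Rightarrow> (real^'m::finite) list \<Rightarrow> 'b::real_normed_vector"
    and T :: "'a::real_normed_vector \<Rightarrow> 'z"
  assumes "open U" "T y \<in> U" "(T has_derivative T') (at y)"
    and "\<And>z. z \<in> U \<Longrightarrow> multilin (length ws) (F z)"
    and "\<And>vs. length vs = length ws \<Longrightarrow> ((\<lambda>z. F z vs) has_derivative G vs) (at (T y))"
    and "\<And>u. u \<in> set ws \<Longrightarrow> ((\<lambda>y. B y u) has_derivative B' u) (at y)"
  shows "((\<lambda>x. F (T x) (map (B x) ws)) has_derivative
    (\<lambda>v. G (map (B y) ws) (T' v) +
      (\<Sum>j<length ws. F (T y) ((map (B y) ws)[j := B' (ws ! j) v])))) (at y)"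
  using assms(4-6)
proof (induction ws arbitrary: F G)
  case Nil
  then show ?case using has_derivative_compose[OF assms(3), of "\<lambda>z. F z []" "G []"] by simp
next
  case (Cons u us)
  let ?L = "map (B y) us"
  have "T \<midarrow>y\<rightarrow> T y" using has_derivative_continuous[OF assms(3)] by (simp add: isCont_def)
  then have ev: "\<forall>\<^sub>F x in at y. T x \<in> U"
    using assms(1,2) by (simp add: tendsto_def)
  have IH: "((\<lambda>x. F (T x) (axis k 1 # map (B x) us)) has_derivative
    (\<lambda>v. G (axis k 1 # ?L) (T' v) +
      (\<Sum>j<length us. F (T y) (axis k 1 # ?L[j := B' (us ! j) v])))) (at y)" for k
    by (rule Cons.IH[where F="\<lambda>z vs. F z (axis k 1 # vs)" and G="\<lambda>vs. G (axis k 1 # vs)"])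
      (use Cons.prems in \<open>auto intro: multilin_tail\<close>)
  have Bu: "((\<lambda>x. B x u $ k) has_derivative (\<lambda>v. B' u v $ k)) (at y)" for k
    using bounded_linear.has_derivative[OF bounded_linear_vec_nth Cons.prems(3)[of u]] by auto
  have ml: "multilin (Suc (length us)) (F z)" if "z \<in> U" for z using Cons.prems(1)[OF that] by simp
  have G: "(\<Sum>k\<in>UNIV. (a $ k) *\<^sub>R G (axis k 1 # vs) t) = G (a # vs) t" if "length vs = length us" for a vs t
  proof -
    have Fk: "((\<lambda>z. F z (axis k 1 # vs)) has_derivative G (axis k 1 # vs)) (at (T y))" for k
      by (rule Cons.prems(2)) (simp add: that)
    have "((\<lambda>z. \<Sum>k\<in>UNIV. (a $ k) *\<^sub>R F z (axis k 1 # vs)) has_derivative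
        (\<lambda>t. \<Sum>k\<in>UNIV. (a $ k) *\<^sub>R G (axis k 1 # vs) t)) (at (T y))"
      by (rule has_derivative_sum) (rule has_derivative_scaleR_right[OF Fk])
    moreover have "((\<lambda>z. \<Sum>k\<in>UNIV. (a $ k) *\<^sub>R F z (axis k 1 # vs)) has_derivative G (a # vs)) (at (T y))"
    proof (rule has_derivative_transform_within_open[OF _ assms(1,2)])
      show "((\<lambda>z. F z (a # vs)) has_derivative G (a # vs)) (at (T y))"
        by (rule Cons.prems(2)) (simp add: that)
      show "F z (a # vs) = (\<Sum>k\<in>UNIV. (a $ k) *\<^sub>R F z (axis k 1 # vs))" if "z \<in> U" for z
        by (rule multilin_head_expand[OF ml[OF that] \<open>length vs = length us\<close>])
    qed
    ultimately show ?thesis by (rule fun_cong[OF has_derivative_unique])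
  qed
  have "((\<lambda>x. \<Sum>k\<in>UNIV. (B x u $ k) *\<^sub>R F (T x) (axis k 1 # map (B x) us)) has_derivative
    (\<lambda>v. \<Sum>k\<in>UNIV. (B y u $ k) *\<^sub>R (G (axis k 1 # ?L) (T' v) +
      (\<Sum>j<length us. F (T y) (axis k 1 # ?L[j := B' (us ! j) v]))) +
      (B' u v $ k) *\<^sub>R F (T y) (axis k 1 # ?L))) (at y)"
    by (intro has_derivative_sum has_derivative_scaleR Bu IH)
  moreover have "(\<Sum>k\<in>UNIV. (B y u $ k) *\<^sub>R (G (axis k 1 # ?L) (T' v) +
      (\<Sum>j<length us. F (T y) (axis k 1 # ?L[j := B' (us ! j) v]))) +
      (B' u v $ k) *\<^sub>R F (T y) (axis k 1 # ?L)) =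
    G (map (B y) (u # us)) (T' v) +
      (\<Sum>j<length (u # us). F (T y) ((map (B y) (u # us))[j := B' ((u # us) ! j) v]))" for v
  proof -
    have "(\<Sum>k\<in>UNIV. (B y u $ k) *\<^sub>R (\<Sum>j<length us. F (T y) (axis k 1 # ?L[j := B' (us ! j) v]))) =
        (\<Sum>j<length us. F (T y) (B y u # ?L[j := B' (us ! j) v]))"
      unfolding scaleR_sum_right
      by (subst sum.swap) (intro sum.cong refl multilin_head_expand[OF ml[OF assms(2)], symmetric], simp)
    moreover have "(\<Sum>k\<in>UNIV. (B' u v $ k) *\<^sub>R F (T y) (axis k 1 # ?L)) = F (T y) (B' u v # ?L)"
      by (rule multilin_head_expand[OF ml[OF assms(2)], symmetric]) simp
    ultimately show ?thesis
      using G[of ?L "B y u" "T' v"]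
      by (simp add: scaleR_add_right sum.distrib sum.lessThan_Suc_shift del: sum.lessThan_Suc)
  qed
  ultimately have "((\<lambda>x. \<Sum>k\<in>UNIV. (B x u $ k) *\<^sub>R F (T x) (axis k 1 # map (B x) us)) has_derivative
    (\<lambda>v. G (map (B y) (u # us)) (T' v) +
      (\<Sum>j<length (u # us). F (T y) ((map (B y) (u # us))[j := B' ((u # us) ! j) v])))) (at y)"
    by (simp only:)
  then show ?case
    by (rule has_derivative_transform_eventually)
      (use ev in \<open>auto elim!: eventually_mono simp: multilin_head_expand[OF ml, symmetric] assms(2)\<close>)
qed

section \<open>Alternating forms on lists of vectors\<close>

lemma length_remove_nth: "i < length vs \<Longrightarrow> length (remove_nth i vs) = length vs - 1"
  by (simp add: remove_nth_def)

lemma nth_remove_nth: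
  "i < length vs \<Longrightarrow> k < length vs - 1 \<Longrightarrow> remove_nth i vs ! k = (if k < i then vs ! k else vs ! Suc k)"
  by (auto simp: remove_nth_def nth_append min_def)

lemma map_remove_nth: "map f (remove_nth i vs) = remove_nth i (map f vs)"
  by (simp add: remove_nth_def take_map drop_map)

lemma remove_nth_append1: "i < length us \<Longrightarrow> remove_nth i (us @ zs) = remove_nth i us @ zs"
  by (simp add: remove_nth_def)

lemma remove_nth_append2: "remove_nth (length us + i) (us @ zs) = us @ remove_nth i zs"
  by (simp add: remove_nth_def)

lemma remove_nth_Cons_0: "remove_nth 0 (x # xs) = xs"
  by (simp add: remove_nth_def)

lemma remove_nth_Cons_Suc: "remove_nth (Suc i) (x # xs) = x # remove_nth i xs"
  by (simp add: remove_nth_def)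

lemma remove_nth_remove_nth:
  "j < i \<Longrightarrow> i < length vs \<Longrightarrow> remove_nth j (remove_nth i vs) = remove_nth (i - 1) (remove_nth j vs)"
  by (rule nth_equalityI) (auto simp: length_remove_nth nth_remove_nth)

text \<open>For the alternating property it is enough to look at two equal entries, with the list written as a
  concatenation around them; sums over positions in a list are then split at these entries.\<close>

lemma alt_formI:
  assumes "\<And>vs. length vs \<noteq> p \<Longrightarrow> f vs = 0" "multilin p f"
    "\<And>us v ms ws. length us + length ms + length ws + 2 = p \<Longrightarrow> f (us @ v # ms @ v # ws) = 0"
  shows "alt_form p f"
  unfolding alt_form_def
proof (intro conjI allI impI)
  fix vs :: "(real^'a) list" and i j assume ij: "i < j \<and> j < length vs \<and> vs ! i = vs ! j"
  let ?ms = "take (j - Suc i) (drop (Suc i) vs)"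
  have "vs = take j vs @ vs ! j # drop (Suc j) vs" using ij by (simp add: id_take_nth_drop)
  also have "take j vs = take i vs @ vs ! i # ?ms"
    using ij id_take_nth_drop[of i "take j vs"] by (simp add: drop_take min_def)
  finally have e: "vs = take i vs @ vs ! i # ?ms @ vs ! i # drop (Suc j) vs" using ij by simp
  show "f vs = 0"
  proof (cases "length vs = p")
    case True
    show ?thesis
      by (subst e, rule assms(3)) (use ij True in auto)
  qed (rule assms(1))
qed (use assms in \<open>auto simp: multilin_def\<close>)

lemma alt_form_length: "alt_form p f \<Longrightarrow> length vs \<noteq> p \<Longrightarrow> f vs = 0"
  by (simp add: alt_form_def)

lemma alt_form_repeat:
  assumes "alt_form p f"
  shows "f (us @ v # ms @ v # ws) = 0"
proof -
  have "length us < length us + Suc (length ms)" "length us + Suc (length ms) < length (us @ v # ms @ v # ws)"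
    "(us @ v # ms @ v # ws) ! length us = (us @ v # ms @ v # ws) ! (length us + Suc (length ms))"
    by (auto simp: nth_append)
  then show ?thesis using assms unfolding alt_form_def by blast
qed

lemma alt_form_swap:
  assumes "alt_form p f"
  shows "f (us @ a # b # ws) = - f (us @ b # a # ws)"
proof (cases "length us + length ws + 2 = p")
  case True
  have l1: "linear (\<lambda>v. f (us @ v # c # ws))" for c
    by (rule multilinD[OF alt_form_multilin[OF assms]]) (use True in simp)
  have l2: "linear (\<lambda>v. f (us @ c # v # ws))" for c
    using multilinD[OF alt_form_multilin[OF assms], of "us @ [c]" ws] True by simp
  have z: "f (us @ c # c # ws) = 0" for c using alt_form_repeat[OF assms, of us c "[]" ws] by simp
  have "f (us @ (a + b) # (a + b) # ws) = f (us @ a # b # ws) + f (us @ b # a # ws)"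
    by (simp only: linear_add[OF l1] linear_add[OF l2]) (simp add: z)
  then have "f (us @ a # b # ws) + f (us @ b # a # ws) = 0"
    by (rule trans[OF sym z])
  then show ?thesis by (simp add: eq_neg_iff_add_eq_0)
next
  case False
  then show ?thesis by (simp add: alt_form_length[OF assms])
qed

lemma alt_form_move_front:
  "alt_form p f \<Longrightarrow> f (us @ s # ws) = (-1) ^ length us * f (s # us @ ws)"
proof (induction us arbitrary: ws rule: rev_induct)
  case (snoc u us)
  have "f ((us @ [u]) @ s # ws) = - f (us @ s # u # ws)"
    using alt_form_swap[OF snoc.prems, of us u s ws] by simp
  then show ?case using snoc.IH[OF snoc.prems, of "u # ws"] by simp
qed simp

lemma alt_form_nth_front:
  "alt_form p f \<Longrightarrow> i < length vs \<Longrightarrow> f vs = (-1) ^ i * f (vs ! i # remove_nth i vs)"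
  using alt_form_move_front[of p f "take i vs" "vs ! i" "drop (Suc i) vs"]
  by (simp add: id_take_nth_drop[symmetric] remove_nth_def)

lemma alt_form_compose:
  assumes "alt_form p f" "linear b"
  shows "alt_form p (\<lambda>vs. f (map b vs))"
proof (rule alt_formI)
  show "multilin p (\<lambda>vs. f (map b vs))"
    unfolding multilin_def
  proof (intro allI impI)
    fix us ws :: "(real^'b) list" assume "length us + Suc (length ws) = p"
    then have "linear (\<lambda>v. f (map b us @ v # map b ws))"
      by (intro multilinD[OF alt_form_multilin[OF assms(1)]]) simp
    then show "linear (\<lambda>v. f (map b (us @ v # ws)))"
      using linear_compose[OF assms(2)] by (simp add: o_def)
  qed
qed (auto simp: alt_form_length[OF assms(1)] alt_form_repeat[OF assms(1)])

lemma alt_form_cnj: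
  assumes "alt_form p f" shows "alt_form p (\<lambda>vs. cnj (f vs))"
  using assms unfolding alt_form_def
  by (auto intro: linear_compose[OF _ bounded_linear.linear[OF bounded_linear_cnj], unfolded o_def])

lemma linear_mult_left: "linear f \<Longrightarrow> linear (\<lambda>v. (c::complex) * f v)"
  using linear_compose[OF _ bounded_linear.linear[OF bounded_linear_mult_right]] by (simp add: o_def)

lemma alt_form_scale: "alt_form p f \<Longrightarrow> alt_form p (\<lambda>vs. c * f vs)"
  unfolding alt_form_def by (auto intro: linear_mult_left)

lemma alt_form_add: "alt_form p f \<Longrightarrow> alt_form p g \<Longrightarrow> alt_form p (\<lambda>vs. f vs + g vs)"
  unfolding alt_form_def by (auto intro: linear_compose_add)

lemma alt_form_sum: "(\<And>i. i \<in> I \<Longrightarrow> alt_form p (f i)) \<Longrightarrow> alt_form p (\<lambda>vs. \<Sum>i\<in>I. f i vs)"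
  unfolding alt_form_def by (auto intro!: linear_compose_sum sum.neutral)

lemma alt_form_zero: "alt_form p (\<lambda>_. 0)"
  by (simp add: alt_form_def linear_iff)

lemma alt_form_tail: 
  assumes "alt_form (Suc p) f" shows "alt_form p (\<lambda>vs. f (v # vs))"
proof (rule alt_formI)
  show "multilin p (\<lambda>vs. f (v # vs))" by (rule multilin_tail[OF alt_form_multilin[OF assms]])
  show "f (v # us @ u # ms @ u # ws) = 0" for us u ms ws
    using alt_form_repeat[OF assms, of "v # us"] by simp
qed (simp add: alt_form_length[OF assms])

text \<open>Both the exterior derivative and the wedge product with a \<open>1\<close>-form are alternating sums
  of this shape.\<close>

definition altsum :: "('v \<Rightarrow> 'v list \<Rightarrow> complex) \<Rightarrow> 'v list \<Rightarrow> complex" where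
  "altsum B vs = (\<Sum>i<length vs. (-1) ^ i * B (vs ! i) (remove_nth i vs))"

lemma altsum_add: "altsum (\<lambda>v ws. B v ws + C v ws) vs = altsum B vs + altsum C vs"
  by (simp add: altsum_def sum.distrib distrib_left)

lemma altsum_mult: "altsum (\<lambda>v ws. c * B v ws) vs = c * altsum B vs"
  by (simp add: altsum_def sum_distrib_left mult.left_commute)

lemma altsum_map: "altsum B (map f vs) = altsum (\<lambda>v ws. B (f v) (map f ws)) vs"
  by (simp add: altsum_def map_remove_nth)

lemma altsum_cong:
  "(\<And>i. i < length vs \<Longrightarrow> B (vs ! i) (remove_nth i vs) = C (vs ! i) (remove_nth i vs)) \<Longrightarrow>
    altsum B vs = altsum C vs"
  by (simp add: altsum_def)

lemma sum_lessThan_add_Suc: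
  "(\<Sum>i<a + Suc b. f i) = (\<Sum>i<a. f i) + f a + (\<Sum>i<b. f (a + Suc i) :: 'c::comm_monoid_add)"
proof (induction b)
  case 0 then show ?case by simp
next
  case (Suc b) then show ?case by (simp add: add_ac)
qed

text \<open>If two arguments agree, all summands that omit neither of them vanish, and the two that remain
  differ by moving one argument past those in between, so they cancel.\<close>

lemma alt_form_altsum:
  assumes B: "\<And>v. alt_form p (B v)" and lin: "\<And>ws. linear (\<lambda>v. B v ws)"
  shows "alt_form (Suc p) (altsum B)"
proof (rule alt_formI)
  show "altsum B vs = 0" if "length vs \<noteq> Suc p" for vs
    unfolding altsum_def
  proof (intro sum.neutral ballI)
    fix i assume "i \<in> {..<length vs}"
    then have "length (remove_nth i vs) \<noteq> p" using that by (auto simp: length_remove_nth)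
    then show "(-1) ^ i * B (vs ! i) (remove_nth i vs) = 0" by (simp add: alt_form_length[OF B])
  qed
  show "multilin (Suc p) (altsum B)"
    unfolding multilin_def
  proof (intro allI impI)
    fix us ws :: "(real^'a) list" assume len: "length us + Suc (length ws) = Suc p"
    have e: "altsum B (us @ v # ws) =
        (\<Sum>i<length us. (-1) ^ i * B (us ! i) (remove_nth i us @ v # ws)) +
        (-1) ^ length us * B v (us @ ws) +
        (\<Sum>i<length ws. (-1) ^ (length us + Suc i) * B (ws ! i) (us @ v # remove_nth i ws))" for v
      unfolding altsum_def length_append length_Cons sum_lessThan_add_Suc
        using remove_nth_append2[of us 0 "v # ws"] remove_nth_append2[of us "Suc _" "v # ws"]
        by (simp add: nth_append remove_nth_append1 remove_nth_Cons_0 remove_nth_Cons_Suc)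
    have 1: "linear (\<lambda>v. (-1) ^ i * B (us ! i) (remove_nth i us @ v # ws))" if "i < length us" for i
      by (rule linear_mult_left, rule multilinD[OF alt_form_multilin[OF B]])
        (use that len in \<open>simp add: length_remove_nth\<close>)
    have 2: "linear (\<lambda>v. (-1) ^ length us * B v (us @ ws))" by (rule linear_mult_left[OF lin])
    have 3: "linear (\<lambda>v. (-1) ^ (length us + Suc i) * B (ws ! i) (us @ v # remove_nth i ws))"
      if "i < length ws" for i
      by (rule linear_mult_left, rule multilinD[OF alt_form_multilin[OF B]])
        (use that len in \<open>simp add: length_remove_nth\<close>)
    show "linear (\<lambda>v. altsum B (us @ v # ws))"
      unfolding e by (intro linear_compose_add linear_compose_sum ballI) (use 1 2 3 in auto)
  qed
next
  fix us v ms ws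
  have e: "altsum B (us @ v # ms @ v # ws) =
      (\<Sum>i<length us. (-1) ^ i * B (us ! i) (remove_nth i us @ v # ms @ v # ws)) +
      (-1) ^ length us * B v (us @ ms @ v # ws) +
      ((\<Sum>i<length ms. (-1) ^ (length us + Suc i) * B (ms ! i) (us @ v # remove_nth i ms @ v # ws)) +
      (-1) ^ (length us + Suc (length ms)) * B v (us @ v # ms @ ws) +
      (\<Sum>i<length ws. (-1) ^ (length us + Suc (length ms + Suc i)) * B (ws ! i) (us @ v # ms @ v # remove_nth i ws)))"
    unfolding altsum_def length_append length_Cons sum_lessThan_add_Suc
    using remove_nth_append2[of us 0 "v # ms @ v # ws"] remove_nth_append2[of us "Suc _" "v # ms @ v # ws"]
      remove_nth_append2[of ms 0 "v # ws"] remove_nth_append2[of ms "Suc _" "v # ws"]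
      remove_nth_append2[of "us @ v # ms" "Suc _" "v # ws"]
    by (simp add: nth_append remove_nth_append1 remove_nth_Cons_0 remove_nth_Cons_Suc add.assoc)
  have "B u (xs @ v # ys @ v # zs) = 0" for u xs ys zs by (rule alt_form_repeat[OF B])
  moreover have "B (ws ! i) (us @ v # ms @ v # remove_nth i ws) = 0" for i
    by (rule alt_form_repeat[OF B])
  moreover have "B v (us @ ms @ v # ws) = (-1) ^ (length us + length ms) * B v (v # us @ ms @ ws)"
    using alt_form_move_front[OF B, of v "us @ ms" v ws] by simp
  moreover have "B v (us @ v # ms @ ws) = (-1) ^ length us * B v (v # us @ ms @ ws)"
    using alt_form_move_front[OF B, of v us v "ms @ ws"] by simp
  ultimately show "altsum B (us @ v # ms @ v # ws) = 0"
    unfolding e by (simp add: power_add)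
qed

text \<open>The reason why second derivatives of coordinate changes drop out of the exterior
  derivative: exchanging the two omitted arguments flips the sign of a summand.\<close>

lemma altsum_altsum_symmetric:
  assumes "\<And>v w zs. H v w zs = H w v zs"
  shows "altsum (\<lambda>v ws. altsum (H v) ws) vs = 0"
proof -
  let ?n = "length vs"
  let ?P = "{..<?n} \<times> {..<?n - 1}"
  let ?t = "\<lambda>(i, j). (-1) ^ (i + j) * H (vs ! i) (remove_nth i vs ! j) (remove_nth j (remove_nth i vs))"
  \<comment> \<open>Omitting first \<open>i\<close> and then \<open>j\<close> omits the same two entries as the pair \<open>?swap (i, j)\<close>, in the other order.\<close>
  let ?swap = "\<lambda>(i, j). if j < i then (j, i - 1) else (Suc j, i)"
  have flip: "?t (?swap x) = - ?t x" if "x \<in> ?P" for x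
  proof -
    obtain i j where x: "x = (i, j)" "i < ?n" "j < ?n - 1" using \<open>x \<in> ?P\<close> by auto
    show ?thesis
    proof (cases "j < i")
      case True
      then obtain k where k: "i = Suc k" "j \<le> k" by (cases i) auto
      have "remove_nth i vs ! j = vs ! j" "remove_nth j vs ! k = vs ! i"
        using x k by (auto simp: nth_remove_nth)
      moreover have "remove_nth j (remove_nth i vs) = remove_nth k (remove_nth j vs)"
        using remove_nth_remove_nth[OF True x(2)] k by simp
      ultimately show ?thesis using k x assms[of "vs ! i"] by (simp add: add.commute)
    next
      case False
      have "remove_nth i vs ! j = vs ! Suc j" "remove_nth (Suc j) vs ! i = vs ! i"
        using x False by (auto simp: nth_remove_nth)
      moreover have "remove_nth i (remove_nth (Suc j) vs) = remove_nth j (remove_nth i vs)"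
        using remove_nth_remove_nth[of i "Suc j" vs] x False by simp
      ultimately show ?thesis using x False assms[of "vs ! i"] by (simp add: add.commute)
    qed
  qed
  have "altsum (\<lambda>v ws. altsum (H v) ws) vs =
      (\<Sum>i<?n. \<Sum>j<?n - 1. (-1) ^ (i + j) * H (vs ! i) (remove_nth i vs ! j) (remove_nth j (remove_nth i vs)))"
    unfolding altsum_def
    by (intro sum.cong refl) (simp add: length_remove_nth sum_distrib_left power_add mult.assoc)
  also have "\<dots> = sum ?t ?P" by (simp add: sum.cartesian_product)
  finally have S: "altsum (\<lambda>v ws. altsum (H v) ws) vs = sum ?t ?P" .
  have "sum ?t ?P = (\<Sum>x\<in>?P. ?t (?swap x))"
    by (rule sum.reindex_bij_witness[of _ ?swap ?swap]) (auto split: if_splits)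
  also have "\<dots> = (\<Sum>x\<in>?P. - ?t x)" by (intro sum.cong refl flip)
  also have "\<dots> = - sum ?t ?P" by (rule sum_negf)
  finally show ?thesis unfolding S by simp
qed


section \<open>Sums over multi-indices\<close>

abbreviation ax :: "'n::finite list \<Rightarrow> (real^'n) list" where
  "ax I \<equiv> map (\<lambda>i. axis i 1) I"

lemma finite_multi_index: "finite {I :: 'n::finite list. length I = p}"
  using finite_lists_length_eq[of "UNIV :: 'n set" p] by simp

lemma sum_multi_index_Suc:
  "(\<Sum>I | length (I :: 'n::finite list) = Suc p. f I) =
    (\<Sum>k\<in>UNIV. \<Sum>I | length I = p. (f (k # I) :: 'c::comm_monoid_add))"
  unfolding sum.cartesian_product
  by (rule sum.reindex_bij_witness[of _ "\<lambda>(k, I). k # I" "\<lambda>I. (hd I, tl I)"])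
    (auto simp: length_Suc_conv)

lemma sum_multi_index_nth:
  assumes "i \<le> p"
  shows "(\<Sum>I | length (I :: 'n::finite list) = Suc p. h (I ! i) (remove_nth i I)) =
    (\<Sum>k\<in>UNIV. \<Sum>I | length I = p. (h k I :: 'c::comm_monoid_add))"
  unfolding sum.cartesian_product
  by (rule sum.reindex_bij_witness[of _ "\<lambda>(k, I). take i I @ k # drop i I" "\<lambda>I. (I ! i, remove_nth i I)"])
    (use assms in \<open>auto simp: remove_nth_def nth_append id_take_nth_drop[symmetric] min_def\<close>)

text \<open>Against an alternating form all terms of an alternating sum contribute equally.\<close>

lemma sum_altsum_alt_form:
  assumes "alt_form (Suc p) \<psi>"
  shows "(\<Sum>I | length I = Suc p. altsum B (ax I) * \<psi> (ax I)) =
    of_nat (Suc p) * (\<Sum>k\<in>UNIV. \<Sum>I | length I = p. B (axis k 1) (ax I) * \<psi> (axis k 1 # ax I))"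
proof -
  let ?h = "\<lambda>k I. B (axis k 1) (ax I) * \<psi> (axis k 1 # ax I)"
  have "altsum B (ax I) * \<psi> (ax I) = (\<Sum>i\<le>p. ?h (I ! i) (remove_nth i I))"
    if "length I = Suc p" for I :: "'a list"
  proof -
    have "(-1) ^ i * B (ax I ! i) (remove_nth i (ax I)) * \<psi> (ax I) = ?h (I ! i) (remove_nth i I)"
      if "i \<le> p" for i
    proof -
      have "\<psi> (ax I) = (-1) ^ i * \<psi> (axis (I ! i) 1 # ax (remove_nth i I))"
        using alt_form_nth_front[OF assms, of i "ax I"] that \<open>length I = Suc p\<close>
        by (simp add: map_remove_nth)
      then show ?thesis using that \<open>length I = Suc p\<close> by (simp add: map_remove_nth)
    qed
    then show ?thesis unfolding altsum_def
      by (simp add: that sum_distrib_right lessThan_Suc_atMost del: sum.lessThan_Suc)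
  qed
  then have "(\<Sum>I | length I = Suc p. altsum B (ax I) * \<psi> (ax I)) =
      (\<Sum>I | length I = Suc p. \<Sum>i\<le>p. ?h (I ! i) (remove_nth i I))" by simp
  also have "\<dots> = (\<Sum>i\<le>p. \<Sum>I | length I = Suc p. ?h (I ! i) (remove_nth i I))" by (rule sum.swap)
  also have "\<dots> = (\<Sum>i\<le>p. \<Sum>k\<in>UNIV. \<Sum>I | length I = p. ?h k I)"
    by (intro sum.cong refl sum_multi_index_nth) simp
  finally show ?thesis by simp
qed

lemma matrix_axis: "(M :: real^'n::finite^'m::finite) *v axis i 1 = (\<chi> k. M $ k $ i)"
  by (simp add: matrix_vector_mult_def axis_def vec_eq_iff if_distrib sum.delta' cong: if_cong)

lemma multilin_matrix_expand:
  fixes M :: "real^'n::finite^'m::finite" and f :: "(real^'m) list \<Rightarrow> complex"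
  shows "multilin p f \<Longrightarrow> length I = p \<Longrightarrow>
    f (map ((*v) M) (ax I)) = (\<Sum>J | length J = p. of_real (\<Prod>a<p. M $ (J ! a) $ (I ! a)) * f (ax J))"
proof (induction p arbitrary: f I)
  case 0 then show ?case by simp
next
  case (Suc p)
  obtain i I' where I: "I = i # I'" "length I' = p" using Suc.prems(2) by (cases I) auto
  have "f (map ((*v) M) (ax I)) = (\<Sum>k\<in>UNIV. (M $ k $ i) *\<^sub>R f (axis k 1 # map ((*v) M) (ax I')))"
    using multilin_head_expand[OF Suc.prems(1), of "map ((*v) M) (ax I')" "M *v axis i 1"] I
    by (simp add: matrix_axis)
  also have "\<dots> = (\<Sum>k\<in>UNIV. (M $ k $ i) *\<^sub>R
      (\<Sum>J | length J = p. of_real (\<Prod>a<p. M $ (J ! a) $ (I' ! a)) * f (axis k 1 # ax J)))"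
    using Suc.IH[OF multilin_tail[OF Suc.prems(1)] I(2)] by simp
  also have "\<dots> = (\<Sum>J | length J = Suc p. of_real (\<Prod>a<Suc p. M $ (J ! a) $ (I ! a)) * f (ax J))"
    unfolding sum_multi_index_Suc scaleR_sum_right
    by (simp add: I prod.lessThan_Suc_shift scaleR_conv_of_real mult.assoc del: prod.lessThan_Suc)
  finally show ?case .
qed

text \<open>A matrix applied to all arguments of one factor can be moved to the other factor as its transpose.
  For one slot this is the definition of the transpose; the slots are treated one after another.\<close>

lemma sum_multi_index_change_basis:
  fixes B :: "real^'n::finite^'m::finite" and C :: "real^'n^'k::finite"
    and f :: "(real^'m) list \<Rightarrow> complex"
  shows "multilin p f \<Longrightarrow> multilin p h \<Longrightarrow>
    (\<Sum>I | length I = p. f (map ((*v) B) (ax I)) * h (map ((*v) C) (ax I))) =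
    (\<Sum>I | length I = p. f (ax I) * h (map ((*v) (C ** transpose B)) (ax I)))"
proof (induction p arbitrary: f h)
  case 0 then show ?case by simp
next
  case (Suc p)
  let ?D = "C ** transpose B"
  have one: "(\<Sum>i\<in>UNIV. f' (B *v axis i 1) * h' (C *v axis i 1)) = (\<Sum>k\<in>UNIV. f' (axis k 1) * h' (?D *v axis k 1))"
    if "linear f'" "linear h'" for f' :: "real^'m \<Rightarrow> complex" and h'
  proof -
    have "(\<Sum>i\<in>UNIV. f' (B *v axis i 1) * h' (C *v axis i 1)) =
        (\<Sum>i\<in>UNIV. \<Sum>k\<in>UNIV. (B $ k $ i) *\<^sub>R (f' (axis k 1) * h' (C *v axis i 1)))"
      by (subst linear_expand[OF that(1)]) (simp add: matrix_axis sum_distrib_right)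
    also have "\<dots> = (\<Sum>k\<in>UNIV. \<Sum>i\<in>UNIV. (B $ k $ i) *\<^sub>R (f' (axis k 1) * h' (C *v axis i 1)))"
      by (rule sum.swap)
    also have "\<dots> = (\<Sum>k\<in>UNIV. f' (axis k 1) * h' (?D *v axis k 1))"
    proof (intro sum.cong refl)
      fix k
      have l: "linear (\<lambda>v. h' (C *v v))"
        using linear_compose[OF matrix_vector_mul_linear that(2)] by (simp add: o_def)
      have "h' (?D *v axis k 1) = h' (C *v (transpose B *v axis k 1))"
        by (simp only: matrix_vector_mul_assoc)
      also have "\<dots> = (\<Sum>i\<in>UNIV. (B $ k $ i) *\<^sub>R h' (C *v axis i 1))"
        by (subst linear_expand[OF l]) (simp add: matrix_axis transpose_def)
      finally show "(\<Sum>i\<in>UNIV. (B $ k $ i) *\<^sub>R (f' (axis k 1) * h' (C *v axis i 1))) =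
          f' (axis k 1) * h' (?D *v axis k 1)"
        by (simp add: sum_distrib_left)
    qed
    finally show ?thesis .
  qed
  have "(\<Sum>I | length I = Suc p. f (map ((*v) B) (ax I)) * h (map ((*v) C) (ax I))) =
      (\<Sum>i\<in>UNIV. \<Sum>I | length I = p. f (B *v axis i 1 # ax I) * h (C *v axis i 1 # map ((*v) ?D) (ax I)))"
    unfolding sum_multi_index_Suc
    using Suc.IH[OF multilin_tail[OF Suc.prems(1)] multilin_tail[OF Suc.prems(2)]] by simp
  also have "\<dots> = (\<Sum>I | length I = p. \<Sum>i\<in>UNIV. f (B *v axis i 1 # ax I) * h (C *v axis i 1 # map ((*v) ?D) (ax I)))"
    by (rule sum.swap)
  also have "\<dots> = (\<Sum>I | length I = p. \<Sum>k\<in>UNIV. f (axis k 1 # ax I) * h (?D *v axis k 1 # map ((*v) ?D) (ax I)))"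
    by (intro sum.cong refl one multilin_head[OF Suc.prems(1)] multilin_head[OF Suc.prems(2)]) auto
  also have "\<dots> = (\<Sum>I | length I = Suc p. f (ax I) * h (map ((*v) ?D) (ax I)))"
    unfolding sum_multi_index_Suc by (subst sum.swap) simp
  finally show ?case .
qed

section \<open>Charts and coordinate changes\<close>

abbreviation transition :: "('m, 'n::finite) chart \<Rightarrow> ('m, 'n) chart \<Rightarrow> real^'n \<Rightarrow> real^'n" where
  "transition c c' \<equiv> snd c' \<circ> chart_inv c"

abbreviation jac :: "('m, 'n::finite) chart \<Rightarrow> ('m, 'n) chart \<Rightarrow> real^'n \<Rightarrow> real^'n \<Rightarrow> real^'n" where
  "jac c c' y \<equiv> frechet_derivative (transition c c') (at y)"

locale oriented_manifold =
  fixes A :: "('m::{t2_space, second_countable_topology}, 'n::finite) chart set"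
  assumes atlas: "oriented_atlas A"
begin

lemma open_chart_dom: "c \<in> A \<Longrightarrow> open (fst c)"
  and open_chart_range: "c \<in> A \<Longrightarrow> open (chart_range c)"
  and chart_homeo: "c \<in> A \<Longrightarrow> homeomorphism (fst c) (chart_range c) (snd c) (chart_inv c)"
  using atlas unfolding oriented_atlas_def is_chart_def by blast+

lemma chart_inv_left: "c \<in> A \<Longrightarrow> x \<in> fst c \<Longrightarrow> chart_inv c (snd c x) = x"
  and chart_inv_right: "c \<in> A \<Longrightarrow> y \<in> chart_range c \<Longrightarrow> snd c (chart_inv c y) = y"
  and chart_inv_dom: "c \<in> A \<Longrightarrow> y \<in> chart_range c \<Longrightarrow> chart_inv c y \<in> fst c"
  and continuous_on_chart: "c \<in> A \<Longrightarrow> continuous_on (fst c) (snd c)"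
  and continuous_on_chart_inv: "c \<in> A \<Longrightarrow> continuous_on (chart_range c) (chart_inv c)"
  using chart_homeo[of c] unfolding homeomorphism_def by auto

lemma chart_in_range: "x \<in> fst c \<Longrightarrow> snd c x \<in> chart_range c"
  by (simp add: chart_range_def)

lemma image_chart_eq:
  assumes "c \<in> A"
  shows "snd c ` (W \<inter> fst c) = {y \<in> chart_range c. chart_inv c y \<in> W}"
  using chart_inv_left[OF assms] chart_inv_right[OF assms] chart_inv_dom[OF assms]
  by (force simp: chart_range_def)

lemma open_image_chart:
  assumes "c \<in> A" "open W"
  shows "open (snd c ` (W \<inter> fst c))"
proof -
  have "open (chart_inv c -` W \<inter> chart_range c)"
    using continuous_on_open_vimage[OF open_chart_range[OF assms(1)]]
      continuous_on_chart_inv[OF assms(1)] assms(2) by blast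
  moreover have "chart_inv c -` W \<inter> chart_range c = {y \<in> chart_range c. chart_inv c y \<in> W}"
    by auto
  ultimately show ?thesis using image_chart_eq[OF assms(1)] by simp
qed

definition overlap :: "('m, 'n) chart \<Rightarrow> ('m, 'n) chart \<Rightarrow> (real^'n) set" where
  "overlap c c' = {y \<in> chart_range c. chart_inv c y \<in> fst c'}"

lemma overlap_eq: "c \<in> A \<Longrightarrow> overlap c c' = snd c ` (fst c \<inter> fst c')"
  using image_chart_eq[of c "fst c'"] unfolding overlap_def by (simp add: Int_commute)

lemma open_overlap: "c \<in> A \<Longrightarrow> c' \<in> A \<Longrightarrow> open (overlap c c')"
  using open_image_chart[of c "fst c'"] open_chart_dom[of c'] overlap_eq[of c c']
  by (simp add: Int_commute)

lemma smooth_on_transition: "c \<in> A \<Longrightarrow> c' \<in> A \<Longrightarrow> smooth_on (overlap c c') (transition c c')"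
  using atlas unfolding oriented_atlas_def by (simp add: overlap_eq)

lemma transition_derivative:
  "c \<in> A \<Longrightarrow> c' \<in> A \<Longrightarrow> y \<in> overlap c c' \<Longrightarrow> (transition c c' has_derivative jac c c' y) (at y)"
  by (rule smooth_on_has_derivative[OF smooth_on_transition])

lemma linear_jac: "c \<in> A \<Longrightarrow> c' \<in> A \<Longrightarrow> y \<in> overlap c c' \<Longrightarrow> linear (jac c c' y)"
  by (rule has_derivative_linear[OF transition_derivative])

lemma smooth_on_jac: "c \<in> A \<Longrightarrow> c' \<in> A \<Longrightarrow> smooth_on (overlap c c') (\<lambda>y. jac c c' y v)"
  by (rule smooth_on_dirderiv[OF smooth_on_transition])

lemma transition_in_overlap:
  "c \<in> A \<Longrightarrow> c' \<in> A \<Longrightarrow> y \<in> overlap c c' \<Longrightarrow> transition c c' y \<in> overlap c' c"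
  by (simp add: overlap_def chart_in_range chart_inv_left chart_inv_dom)

lemma chart_inv_transition:
  "c' \<in> A \<Longrightarrow> y \<in> overlap c c' \<Longrightarrow> chart_inv c' (transition c c' y) = chart_inv c y"
  by (simp add: overlap_def chart_inv_left)

lemma transition_transition:
  "c \<in> A \<Longrightarrow> c' \<in> A \<Longrightarrow> y \<in> overlap c c' \<Longrightarrow> transition c' c (transition c c' y) = y"
  by (simp add: overlap_def chart_inv_left chart_inv_right)

lemma jac_self:
  assumes "c \<in> A" "y \<in> chart_range c"
  shows "jac c c y v = v"
proof -
  have "frechet_derivative (transition c c) (at y) = frechet_derivative (\<lambda>x. x) (at y)"
    by (rule frechet_derivative_cong_open[OF open_chart_range[OF assms(1)] assms(2)])
      (simp add: chart_inv_right assms(1))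
  then show ?thesis by simp
qed

lemma jac_cocycle:
  assumes "c \<in> A" "c' \<in> A" "c'' \<in> A" "y \<in> overlap c c'" "y \<in> overlap c c''"
  shows "jac c' c'' (transition c c' y) (jac c c' y v) = jac c c'' y v"
proof -
  have in': "transition c c' y \<in> overlap c' c''"
    using assms by (auto simp: overlap_def chart_in_range chart_inv_left)
  have D: "((\<lambda>y. transition c' c'' (transition c c' y)) has_derivative
      (\<lambda>v. jac c' c'' (transition c c' y) (jac c c' y v))) (at y)"
    by (rule has_derivative_compose[OF transition_derivative[OF assms(1,2,4)]
        transition_derivative[OF assms(2,3) in']])
  have "frechet_derivative (\<lambda>y. transition c' c'' (transition c c' y)) (at y) = jac c c'' y"
    by (rule frechet_derivative_cong_open[OF open_overlap[OF assms(1,2)] assms(4)])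
      (use assms in \<open>auto simp: overlap_def chart_inv_left\<close>)
  then show ?thesis using dirderiv_eq[OF D, of v] by (simp only:)
qed

lemma ref_chart: "ref_chart A x \<in> A" "x \<in> fst (ref_chart A x)"
proof -
  have "\<exists>c. c \<in> A \<and> x \<in> fst c" using atlas unfolding oriented_atlas_def by blast
  from someI_ex[OF this] show "ref_chart A x \<in> A" "x \<in> fst (ref_chart A x)"
    unfolding ref_chart_def by auto
qed

abbreviation ref_coord :: "'m \<Rightarrow> real^'n" where
  "ref_coord x \<equiv> snd (ref_chart A x) x"

definition from_ref :: "('m, 'n) chart \<Rightarrow> 'm \<Rightarrow> real^'n \<Rightarrow> real^'n" where
  "from_ref c x = jac (ref_chart A x) c (ref_coord x)"

lemma to_ref_jac: "to_ref A c x = jac c (ref_chart A x) (snd c x)"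
  by (simp add: to_ref_def)

lemma in_overlap: "c \<in> A \<Longrightarrow> x \<in> fst c \<Longrightarrow> x \<in> fst c' \<Longrightarrow> snd c x \<in> overlap c c'"
  by (simp add: overlap_def chart_in_range chart_inv_left)

lemma linear_to_ref: "c \<in> A \<Longrightarrow> x \<in> fst c \<Longrightarrow> linear (to_ref A c x)"
  unfolding to_ref_jac by (intro linear_jac ref_chart in_overlap)

lemma linear_from_ref: "c \<in> A \<Longrightarrow> x \<in> fst c \<Longrightarrow> linear (from_ref c x)"
  unfolding from_ref_def by (intro linear_jac ref_chart in_overlap)

lemma to_ref_ref: "to_ref A (ref_chart A x) x = (\<lambda>v. v)"
  unfolding to_ref_jac using jac_self[OF ref_chart(1) chart_in_range[OF ref_chart(2)]] by blast

lemma to_ref_jac_cocycle: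
  assumes "c \<in> A" "c' \<in> A" "x \<in> fst c" "x \<in> fst c'"
  shows "to_ref A c' x (jac c c' (snd c x) v) = to_ref A c x v"
  using jac_cocycle[OF assms(1,2) ref_chart(1)[of x] in_overlap[OF assms(1,3,4)]
      in_overlap[OF assms(1,3) ref_chart(2)], of v] assms
  by (simp add: to_ref_jac chart_inv_left)

lemma to_ref_from_ref: "c \<in> A \<Longrightarrow> x \<in> fst c \<Longrightarrow> to_ref A c x (from_ref c x v) = v"
  using to_ref_jac_cocycle[of "ref_chart A x" c x v] ref_chart[of x]
  by (simp add: from_ref_def to_ref_ref)

lemma from_ref_to_ref:
  assumes "c \<in> A" "x \<in> fst c"
  shows "from_ref c x (to_ref A c x v) = v"
  using jac_cocycle[OF assms(1) ref_chart(1) assms(1) in_overlap[OF assms(1,2) ref_chart(2)]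
      in_overlap[OF assms(1,2,2)], of v] jac_self[OF assms(1) chart_in_range[OF assms(2)]] assms
  by (simp add: from_ref_def to_ref_jac chart_inv_left)


section \<open>Differential forms in charts\<close>

lemma loc_form_transition:
  assumes "c \<in> A" "c' \<in> A" "y \<in> overlap c c'"
  shows "loc_form A c \<omega> y vs = loc_form A c' \<omega> (transition c c' y) (map (jac c c' y) vs)"
proof -
  have x: "chart_inv c y \<in> fst c" "chart_inv c y \<in> fst c'" "snd c (chart_inv c y) = y"
    using assms by (auto simp: overlap_def chart_inv_dom chart_inv_right)
  have "to_ref A c' (chart_inv c y) (jac c c' y v) = to_ref A c (chart_inv c y) v" for v
    using to_ref_jac_cocycle[OF assms(1,2) x(1,2), of v] x(3) by simp
  then show ?thesis
    unfolding loc_form_def chart_inv_transition[OF assms(2,3)] by (simp add: o_def)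
qed

lemma loc_form_ref: "loc_form A (ref_chart A x) \<omega> (ref_coord x) vs = \<omega> x vs"
  unfolding loc_form_def by (simp add: chart_inv_left ref_chart to_ref_ref)

lemma form_eq_loc_form:
  "c \<in> A \<Longrightarrow> x \<in> fst c \<Longrightarrow> \<omega> x vs = loc_form A c \<omega> (snd c x) (map (from_ref c x) vs)"
  unfolding loc_form_def by (simp add: chart_inv_left to_ref_from_ref o_def)

lemma alt_form_loc_form:
  assumes "c \<in> A" "y \<in> chart_range c" "alt_form p (\<omega> (chart_inv c y))"
  shows "alt_form p (loc_form A c \<omega> y)"
  using alt_form_compose[OF assms(3) linear_to_ref[OF assms(1) chart_inv_dom[OF assms(1,2)]]]
  unfolding loc_form_def[abs_def] .

lemma Omega_alt: "\<omega> \<in> Omega A p \<Longrightarrow> alt_form p (\<omega> x)"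
  and Omega_smooth: "\<omega> \<in> Omega A p \<Longrightarrow> c \<in> A \<Longrightarrow> smooth_on (chart_range c) (\<lambda>y. loc_form A c \<omega> y vs)"
  by (simp_all add: Omega_def)

lemma Omega_alt_loc:
  "\<omega> \<in> Omega A p \<Longrightarrow> c \<in> A \<Longrightarrow> y \<in> chart_range c \<Longrightarrow> alt_form p (loc_form A c \<omega> y)"
  by (rule alt_form_loc_form[OF _ _ Omega_alt])

text \<open>The components in another chart arise from the given ones by composition with the coordinate change
  and by inserting its Jacobian into the arguments, and both operations preserve smoothness.\<close>

lemma Omega_local:
  assumes alt: "\<And>x. alt_form p (\<omega> x)"
    and loc: "\<And>x. \<exists>c\<in>A. \<exists>U. open U \<and> x \<in> U \<and> U \<subseteq> fst c \<and>
      (\<forall>vs. smooth_on (snd c ` U) (\<lambda>y. loc_form A c \<omega> y vs))"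
  shows "\<omega> \<in> Omega A p"
  unfolding Omega_def
proof (intro CollectI conjI ballI allI alt)
  fix c' vs assume c': "c' \<in> A"
  show "smooth_on (chart_range c') (\<lambda>y. loc_form A c' \<omega> y vs)"
  proof (cases "length vs = p")
    case False
    then show ?thesis
      using alt_form_length[OF alt] by (simp add: loc_form_def smooth_on_const)
  next
    case True
    show ?thesis
    proof (rule smooth_on_local)
      fix y assume y: "y \<in> chart_range c'"
      obtain c U where c: "c \<in> A" "open U" "chart_inv c' y \<in> U" "U \<subseteq> fst c"
        "\<And>vs. smooth_on (snd c ` U) (\<lambda>y. loc_form A c \<omega> y vs)"
        using loc[of "chart_inv c' y"] by blast
      let ?V = "snd c' ` (U \<inter> fst c')"
      have V: "open ?V" by (rule open_image_chart[OF c' c(2)])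
      have yV: "y \<in> ?V" unfolding image_chart_eq[OF c'] using y c(3) by simp
      have sub: "?V \<subseteq> overlap c' c" unfolding image_chart_eq[OF c'] overlap_def using c(4) by auto
      have tV: "transition c' c ` ?V \<subseteq> snd c ` U"
        unfolding image_chart_eq[OF c'] by auto
      have "smooth_on ?V (\<lambda>z. loc_form A c \<omega> (transition c' c z) (map (jac c' c z) vs))"
      proof (rule smooth_on_multilin[OF V])
        fix z assume "z \<in> ?V"
        then have "transition c' c z \<in> chart_range c"
          using sub transition_in_overlap[OF c' c(1)] by (auto simp: overlap_def)
        then show "multilin (length vs) (loc_form A c \<omega> (transition c' c z))"
          unfolding True by (intro alt_form_multilin alt_form_loc_form[OF c(1)] alt)
      next
        fix us :: "(real^'n) list"
        show "smooth_on ?V (\<lambda>z. loc_form A c \<omega> (transition c' c z) us)"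
          by (rule smooth_on_compose[OF V tV c(5)])
            (rule smooth_on_subset[OF smooth_on_transition[OF c' c(1)] sub])
      next
        fix u show "smooth_on ?V (\<lambda>z. jac c' c z u)"
          by (rule smooth_on_subset[OF smooth_on_jac[OF c' c(1)] sub])
      qed
      then have "smooth_on ?V (\<lambda>y. loc_form A c' \<omega> y vs)"
        by (rule smooth_on_cong[OF V]) (use sub loc_form_transition[OF c' c(1)] in auto)
      then show "\<exists>U. open U \<and> y \<in> U \<and> smooth_on U (\<lambda>y. loc_form A c' \<omega> y vs)"
        using V yV by blast
    qed
  qed
qed

lemma Omega_scale_const: "\<omega> \<in> Omega A p \<Longrightarrow> (\<lambda>x vs. a * \<omega> x vs) \<in> Omega A p"
  unfolding Omega_def
  by (auto simp: loc_form_def intro: alt_form_scale smooth_on_mult[OF open_chart_range smooth_on_const])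

lemma Omega_add: "\<omega> \<in> Omega A p \<Longrightarrow> \<eta> \<in> Omega A p \<Longrightarrow> (\<lambda>x vs. \<omega> x vs + \<eta> x vs) \<in> Omega A p"
  unfolding Omega_def
  by (auto simp: loc_form_def intro: alt_form_add smooth_on_add[OF open_chart_range])

lemma Omega_zero: "(\<lambda>x vs. 0) \<in> Omega A p"
  by (simp add: Omega_def loc_form_def alt_form_zero smooth_on_const)

lemma Omega_scale_form:
  assumes "smooth_fun A f" "\<omega> \<in> Omega A p"
  shows "scale_form f \<omega> \<in> Omega A p"
  using assms unfolding Omega_def smooth_fun_def
  by (auto simp: loc_form_def scale_form_def intro!: alt_form_scale smooth_on_mult[OF open_chart_range] )
    (simp add: o_def)

text \<open>Differentiation in a parameter is linear, so it preserves every linear identity between components.\<close>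

lemma alt_form_dirderiv:
  fixes F :: "real^'n \<Rightarrow> (real^'n) list \<Rightarrow> complex"
  assumes "open S" "y \<in> S" "\<And>z. z \<in> S \<Longrightarrow> alt_form p (F z)" "\<And>ws. smooth_on S (\<lambda>z. F z ws)"
  shows "alt_form p (\<lambda>ws. dirderiv (\<lambda>z. F z ws) y v)"
proof (rule alt_formI)
  have zero: "dirderiv (\<lambda>z. F z ws) y v = 0" if "\<And>z. z \<in> S \<Longrightarrow> F z ws = 0" for ws
    using frechet_derivative_cong_open[OF assms(1,2), of "\<lambda>z. F z ws" "\<lambda>_. 0"] that by simp
  show "dirderiv (\<lambda>z. F z vs) y v = 0" if "length vs \<noteq> p" for vs
    by (rule zero) (rule alt_form_length[OF assms(3) that])
  show "dirderiv (\<lambda>z. F z (us @ u # ms @ u # ws)) y v = 0" for us u ms ws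
    by (rule zero) (rule alt_form_repeat[OF assms(3)])
  have D: "((\<lambda>z. F z ws) has_derivative frechet_derivative (\<lambda>z. F z ws) (at y)) (at y)" for ws
    by (rule smooth_on_has_derivative[OF assms(4,2)])
  show "multilin p (\<lambda>ws. dirderiv (\<lambda>z. F z ws) y v)"
    unfolding multilin_def
  proof (intro allI impI linearI)
    fix us ws :: "(real^'n) list" assume len: "length us + Suc (length ws) = p"
    have lin: "linear (\<lambda>v. F z (us @ v # ws))" if "z \<in> S" for z
      by (rule multilinD[OF alt_form_multilin[OF assms(3)[OF that]] len])
    fix a b
    have "frechet_derivative (\<lambda>z. F z (us @ (a + b) # ws)) (at y) =
        frechet_derivative (\<lambda>z. F z (us @ a # ws) + F z (us @ b # ws)) (at y)"
      by (rule frechet_derivative_cong_open[OF assms(1,2)]) (rule linear_add[OF lin])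
    then show "dirderiv (\<lambda>z. F z (us @ (a + b) # ws)) y v =
        dirderiv (\<lambda>z. F z (us @ a # ws)) y v + dirderiv (\<lambda>z. F z (us @ b # ws)) y v"
      using dirderiv_eq[OF has_derivative_add[OF D D], of "us @ a # ws" "us @ b # ws" v] by simp
    fix r
    have "frechet_derivative (\<lambda>z. F z (us @ (r *\<^sub>R b) # ws)) (at y) =
        frechet_derivative (\<lambda>z. r *\<^sub>R F z (us @ b # ws)) (at y)"
      by (rule frechet_derivative_cong_open[OF assms(1,2)]) (rule linear_scale[OF lin])
    then show "dirderiv (\<lambda>z. F z (us @ (r *\<^sub>R b) # ws)) y v = r *\<^sub>R dirderiv (\<lambda>z. F z (us @ b # ws)) y v"
      using dirderiv_eq[OF has_derivative_scaleR_right[OF D, of r], of "us @ b # ws" v] by simp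
  qed
qed


subsection \<open>The exterior derivative\<close>

lemma ext_d_altsum:
  "ext_d A \<omega> x vs = altsum (\<lambda>v ws. dirderiv (\<lambda>y. loc_form A (ref_chart A x) \<omega> y ws) (ref_coord x) v) vs"
  by (simp add: ext_d_def altsum_def)

text \<open>Differentiating the transformation rule of the components gives, besides the expected term,
  terms with the second derivative of the coordinate change; being symmetric in two omitted
  arguments, these cancel.\<close>

lemma loc_form_ext_d:
  assumes \<omega>: "\<omega> \<in> Omega A p" and c: "c \<in> A" and y: "y \<in> chart_range c"
  shows "loc_form A c (ext_d A \<omega>) y vs = altsum (\<lambda>v ws. dirderiv (\<lambda>z. loc_form A c \<omega> z ws) y v) vs"
proof -
  define x where "x = chart_inv c y"
  define r where "r = ref_chart A x"
  define T where "T = transition c r"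
  define F where "F = loc_form A r \<omega>"
  define J where "J = jac c r"
  define J' where "J' u = frechet_derivative (\<lambda>z. J z u) (at y)" for u
  have r: "r \<in> A" "x \<in> fst r" using ref_chart by (auto simp: r_def)
  have xc: "x \<in> fst c" "snd c x = y" using chart_inv_dom[OF c y] chart_inv_right[OF c y] by (auto simp: x_def)
  have yo: "y \<in> overlap c r" using in_overlap[OF c xc(1) r(2)] xc(2) by simp
  have Ty: "T y = ref_coord x" by (simp add: T_def r_def x_def)
  have TyR: "T y \<in> chart_range r" using transition_in_overlap[OF c r(1) yo] by (simp add: T_def overlap_def)
  have "to_ref A c x = J y" by (simp add: to_ref_jac J_def r_def xc)
  then have lhs: "loc_form A c (ext_d A \<omega>) y vs =
      altsum (\<lambda>v ws. dirderiv (\<lambda>z. F z (map (J y) ws)) (T y) (J y v)) vs"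
    unfolding loc_form_def x_def[symmetric] ext_d_altsum altsum_map F_def r_def[symmetric] Ty by simp
  show ?thesis
  proof (cases "length vs = Suc p")
    case False
    then have "ext_d A \<omega> x vs' = 0" if "length vs' = length vs" for vs'
      unfolding ext_d_altsum altsum_def
    proof (intro sum.neutral ballI)
      fix i assume "i \<in> {..<length vs'}"
      then have l: "length (remove_nth i vs') \<noteq> p" using that False by (auto simp: length_remove_nth)
      have "loc_form A (ref_chart A x) \<omega> y (remove_nth i vs') = 0" for y
        unfolding loc_form_def by (rule alt_form_length[OF Omega_alt[OF \<omega>]]) (simp add: l)
      then show "(-1) ^ i * dirderiv (\<lambda>y. loc_form A (ref_chart A x) \<omega> y (remove_nth i vs'))
          (ref_coord x) (vs' ! i) = 0" by simp
    qed
    moreover have "altsum (\<lambda>v ws. dirderiv (\<lambda>z. loc_form A c \<omega> z ws) y v) vs = 0"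
      unfolding altsum_def
    proof (intro sum.neutral ballI)
      fix i assume "i \<in> {..<length vs}"
      then have l: "length (remove_nth i vs) \<noteq> p" using False by (auto simp: length_remove_nth)
      have "loc_form A c \<omega> y (remove_nth i vs) = 0" for y
        unfolding loc_form_def by (rule alt_form_length[OF Omega_alt[OF \<omega>]]) (simp add: l)
      then show "(-1) ^ i * dirderiv (\<lambda>y. loc_form A c \<omega> y (remove_nth i vs)) y (vs ! i) = 0" by simp
    qed
    ultimately show ?thesis by (simp add: loc_form_def x_def)
  next
    case True
    let ?H = "\<lambda>v w zs. F (T y) (J' w v # map (J y) zs)"
    have sym: "J' w v = J' v w" for v w
      unfolding J'_def J_def
      by (rule symmetric_second_derivative[OF open_overlap[OF c r(1)] smooth_on_transition[OF c r(1)] yo])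
    have "dirderiv (\<lambda>z. loc_form A c \<omega> z ws) y v =
        dirderiv (\<lambda>z. F z (map (J y) ws)) (T y) (J y v) + altsum (?H v) ws" if len: "length ws = p" for v ws
    proof -
      have "frechet_derivative (\<lambda>z. loc_form A c \<omega> z ws) (at y) =
          frechet_derivative (\<lambda>z. F (T z) (map (J z) ws)) (at y)"
        by (rule frechet_derivative_cong_open[OF open_overlap[OF c r(1)] yo])
          (simp only: F_def T_def J_def loc_form_transition[OF c r(1)])
      moreover have "((\<lambda>z. F (T z) (map (J z) ws)) has_derivative
          (\<lambda>v. dirderiv (\<lambda>z. F z (map (J y) ws)) (T y) (J y v) +
            (\<Sum>j<length ws. F (T y) ((map (J y) ws)[j := J' (ws ! j) v])))) (at y)"
      proof (rule has_derivative_multilin[where T=T and U="chart_range r" and F=F and B=J and B'=J'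
            and T'="J y" and G="\<lambda>vs. frechet_derivative (\<lambda>z. F z vs) (at (T y))"])
        show "open (chart_range r)" "T y \<in> chart_range r" by (rule open_chart_range[OF r(1)], rule TyR)
        show "(T has_derivative J y) (at y)"
          unfolding T_def J_def by (rule transition_derivative[OF c r(1) yo])
        show "multilin (length ws) (F z)" if "z \<in> chart_range r" for z
          unfolding F_def len by (rule alt_form_multilin[OF Omega_alt_loc[OF \<omega> r(1) that]])
        show "((\<lambda>z. F z us) has_derivative frechet_derivative (\<lambda>z. F z us) (at (T y))) (at (T y))" for us
          unfolding F_def by (rule smooth_on_has_derivative[OF Omega_smooth[OF \<omega> r(1)] TyR])
        show "((\<lambda>z. J z u) has_derivative J' u) (at y)" for u
          unfolding J'_def J_def by (rule smooth_on_has_derivative[OF smooth_on_jac[OF c r(1)] yo])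
      qed
      moreover have "(\<Sum>j<length ws. F (T y) ((map (J y) ws)[j := J' (ws ! j) v])) = altsum (?H v) ws"
        unfolding altsum_def
      proof (intro sum.cong refl)
        fix j assume j: "j \<in> {..<length ws}"
        have "F (T y) ((map (J y) ws)[j := J' (ws ! j) v]) =
            F (T y) (take j (map (J y) ws) @ J' (ws ! j) v # drop (Suc j) (map (J y) ws))"
          using j by (simp add: upd_conv_take_nth_drop)
        also have "\<dots> = (-1) ^ j * F (T y) (J' (ws ! j) v # map (J y) (remove_nth j ws))"
          using alt_form_move_front[OF Omega_alt_loc[OF \<omega> r(1) TyR], of "take j (map (J y) ws)"
              "J' (ws ! j) v" "drop (Suc j) (map (J y) ws)"] j
          unfolding F_def map_remove_nth by (simp add: remove_nth_def)
        finally show "F (T y) ((map (J y) ws)[j := J' (ws ! j) v]) =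
            (-1) ^ j * ?H v (ws ! j) (remove_nth j ws)" .
      qed
      ultimately show ?thesis by (simp add: dirderiv_eq)
    qed
    then have "altsum (\<lambda>v ws. dirderiv (\<lambda>z. loc_form A c \<omega> z ws) y v) vs =
        altsum (\<lambda>v ws. dirderiv (\<lambda>z. F z (map (J y) ws)) (T y) (J y v) + altsum (?H v) ws) vs"
      using True by (intro altsum_cong) (simp add: length_remove_nth)
    also have "\<dots> = altsum (\<lambda>v ws. dirderiv (\<lambda>z. F z (map (J y) ws)) (T y) (J y v)) vs"
      unfolding altsum_add using altsum_altsum_symmetric[of ?H vs] sym by simp
    finally show ?thesis using lhs by simp
  qed
qed

lemma Omega_ext_d:
  assumes "\<omega> \<in> Omega A p"
  shows "ext_d A \<omega> \<in> Omega A (Suc p)"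
  unfolding Omega_def
proof (intro CollectI conjI ballI allI)
  fix x
  show "alt_form (Suc p) (ext_d A \<omega> x)"
    unfolding ext_d_altsum[abs_def]
  proof (rule alt_form_altsum)
    let ?R = "chart_range (ref_chart A x)"
    have x: "ref_coord x \<in> ?R" by (rule chart_in_range[OF ref_chart(2)])
    show "alt_form p (\<lambda>ws. dirderiv (\<lambda>y. loc_form A (ref_chart A x) \<omega> y ws) (ref_coord x) v)" for v
      by (rule alt_form_dirderiv[OF open_chart_range[OF ref_chart(1)] x
            Omega_alt_loc[OF assms ref_chart(1)] Omega_smooth[OF assms ref_chart(1)]])
    show "linear (frechet_derivative (\<lambda>y. loc_form A (ref_chart A x) \<omega> y ws) (at (ref_coord x)))" for ws
      by (rule has_derivative_linear[OF smooth_on_has_derivative[OF Omega_smooth[OF assms ref_chart(1)] x]])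
  qed
next
  fix c vs assume c: "c \<in> A"
  have "smooth_on (chart_range c) (\<lambda>y. altsum (\<lambda>v ws. dirderiv (\<lambda>z. loc_form A c \<omega> z ws) y v) vs)"
    unfolding altsum_def
    by (intro smooth_on_sum smooth_on_mult smooth_on_const smooth_on_dirderiv
        Omega_smooth[OF assms c] open_chart_range[OF c])
  then show "smooth_on (chart_range c) (\<lambda>y. loc_form A c (ext_d A \<omega>) y vs)"
    by (rule smooth_on_cong[OF open_chart_range[OF c]]) (simp add: loc_form_ext_d[OF assms c])
qed

lemma ext_d_add:
  assumes "\<omega> \<in> Omega A p" "\<eta> \<in> Omega A p"
  shows "ext_d A (\<lambda>x vs. \<omega> x vs + \<eta> x vs) = (\<lambda>x vs. ext_d A \<omega> x vs + ext_d A \<eta> x vs)"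
proof (intro ext)
  fix x vs
  note D = smooth_on_has_derivative[OF Omega_smooth[OF _ ref_chart(1)] chart_in_range[OF ref_chart(2)]]
  have "dirderiv (\<lambda>y. loc_form A (ref_chart A x) (\<lambda>x vs. \<omega> x vs + \<eta> x vs) y ws) (ref_coord x) v =
      dirderiv (\<lambda>y. loc_form A (ref_chart A x) \<omega> y ws) (ref_coord x) v +
      dirderiv (\<lambda>y. loc_form A (ref_chart A x) \<eta> y ws) (ref_coord x) v" for v ws
    using dirderiv_eq[OF has_derivative_add[OF D[OF assms(1)] D[OF assms(2)]]]
    by (simp add: loc_form_def)
  then show "ext_d A (\<lambda>x vs. \<omega> x vs + \<eta> x vs) x vs = ext_d A \<omega> x vs + ext_d A \<eta> x vs"
    by (simp add: ext_d_altsum altsum_add)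
qed

lemma ext_d_local:
  assumes "open U" "x \<in> U" "\<And>z. z \<in> U \<Longrightarrow> \<omega> z = \<eta> z"
  shows "ext_d A \<omega> x = ext_d A \<eta> x"
proof
  fix vs
  let ?r = "ref_chart A x"
  have "frechet_derivative (\<lambda>y. loc_form A ?r \<omega> y ws) (at (ref_coord x)) =
      frechet_derivative (\<lambda>y. loc_form A ?r \<eta> y ws) (at (ref_coord x))" for ws
  proof (rule frechet_derivative_cong_open[OF open_image_chart[OF ref_chart(1) assms(1)]])
    show "ref_coord x \<in> snd ?r ` (U \<inter> fst ?r)" using assms(2) ref_chart by auto
    show "loc_form A ?r \<omega> y ws = loc_form A ?r \<eta> y ws" if "y \<in> snd ?r ` (U \<inter> fst ?r)" for y
      using that assms(3) unfolding image_chart_eq[OF ref_chart(1)] loc_form_def by simp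
  qed
  then show "ext_d A \<omega> x vs = ext_d A \<eta> x vs" by (simp add: ext_d_altsum)
qed

end

section \<open>Gram matrices\<close>

definition inner_form :: "(real^'n::finite \<Rightarrow> real^'n \<Rightarrow> real) \<Rightarrow> bool" where
  "inner_form b \<longleftrightarrow> bilinear b \<and> (\<forall>u v. b u v = b v u) \<and> (\<forall>v. v \<noteq> 0 \<longrightarrow> b v v > 0)"

lemma matrix_of_linear: "linear f \<Longrightarrow> matrix (f :: real^'n::finite \<Rightarrow> real^'m::finite) *v v = f v"
  by (simp add: matrix_works linear_def scalar_mult_eq_scaleR)

lemma gram_apply:
  assumes "bilinear b"
  shows "u \<bullet> (gram b *v v) = b u v"
proof -
  have l: "linear (\<lambda>u. b u v)" "linear (b u)" for u v using assms by (simp_all add: bilinear_def)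
  have "b u v = (\<Sum>i\<in>UNIV. (u $ i) *\<^sub>R b (axis i 1) v)" by (rule linear_expand[OF l(1)])
  also have "\<dots> = (\<Sum>i\<in>UNIV. u $ i * (\<Sum>j\<in>UNIV. v $ j * b (axis i 1) (axis j 1)))"
    using linear_expand[OF l(2), of _ v] by simp
  also have "\<dots> = u \<bullet> (gram b *v v)"
    by (simp add: inner_vec_def matrix_vector_mult_def gram_def mult.commute)
  finally show ?thesis by simp
qed

text \<open>On the segment from the identity to \<open>P\<close> all matrices are positive definite, hence invertible, so the
  determinant keeps its sign.\<close>

lemma det_pos_definite:
  fixes P :: "real^'n::finite^'n"
  assumes "\<And>v. v \<noteq> 0 \<Longrightarrow> v \<bullet> (P *v v) > 0"
  shows "det P > 0"
proof -
  let ?M = "\<lambda>t. (1 - t) *\<^sub>R mat 1 + t *\<^sub>R P"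
  have nz: "det (?M t) \<noteq> 0" if "0 \<le> t" "t \<le> 1" for t
  proof
    assume "det (?M t) = 0"
    then have "\<not> inj ((*v) (?M t))" by (simp add: det_nz_iff_inj[symmetric])
    then obtain v where v: "v \<noteq> 0" "?M t *v v = 0"
      by (metis linear_injective_0 matrix_vector_mul_linear)
    have "v \<bullet> (?M t *v v) = (1 - t) * (v \<bullet> v) + t * (v \<bullet> (P *v v))"
      by (simp add: matrix_vector_mult_add_rdistrib inner_add_right scaleR_matrix_vector_assoc[symmetric])
    moreover have "(1 - t) * (v \<bullet> v) + t * (v \<bullet> (P *v v)) > 0"
    proof (cases "t = 0")
      case False
      then show ?thesis using that assms[OF v(1)]
        by (intro add_nonneg_pos mult_nonneg_nonneg mult_pos_pos) auto
    qed (use v(1) in simp)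
    ultimately show False using v(2) by simp
  qed
  have "continuous_on {0..1} (\<lambda>t. det (?M t))"
    unfolding det_def by (intro continuous_intros)
  then have conn: "connected ((\<lambda>t. det (?M t)) ` {0..1})" by (intro connected_continuous_image) auto
  have 1: "1 \<in> (\<lambda>t. det (?M t)) ` {0..1}" by (rule image_eqI[of _ _ 0]) auto
  have P: "det P \<in> (\<lambda>t. det (?M t)) ` {0..1}" by (rule image_eqI[of _ _ 1]) auto
  show ?thesis
  proof (rule ccontr)
    assume "\<not> det P > 0"
    then have "0 \<in> (\<lambda>t. det (?M t)) ` {0..1}"
      using connectedD_interval[OF conn P 1, of 0] by simp
    then show False using nz by force
  qed
qed

lemma inner_form_det: "inner_form b \<Longrightarrow> det (gram b) > 0"
  by (rule det_pos_definite) (simp add: gram_apply inner_form_def)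

lemma inner_form_inverse:
  assumes "inner_form b"
  shows "gram b ** matrix_inv (gram b) = mat 1" "matrix_inv (gram b) ** gram b = mat 1"
proof -
  have "invertible (gram b)" using inner_form_det[OF assms] by (simp add: invertible_det_nz)
  then have "\<exists>M. gram b ** M = mat 1 \<and> M ** gram b = mat 1" by (simp add: invertible_def)
  from someI_ex[OF this] show "gram b ** matrix_inv (gram b) = mat 1" "matrix_inv (gram b) ** gram b = mat 1"
    by (simp_all add: matrix_inv_def)
qed

lemma transpose_gram: "inner_form b \<Longrightarrow> transpose (gram b) = gram b"
  by (simp add: inner_form_def gram_def transpose_def vec_eq_iff)

lemma transpose_inverse_gram:
  assumes "inner_form b"
  shows "transpose (matrix_inv (gram b)) = matrix_inv (gram b)"
proof -
  let ?G = "gram b" and ?N = "matrix_inv (gram b)"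
  have "transpose (?G ** ?N) = mat 1" using inner_form_inverse[OF assms] by (simp add: transpose_mat)
  then have "transpose ?N ** ?G = mat 1" by (simp add: matrix_transpose_mul transpose_gram[OF assms])
  then have "transpose ?N ** (?G ** ?N) = ?N" by (simp add: matrix_mul_assoc)
  then show ?thesis using inner_form_inverse[OF assms] by simp
qed

lemma gram_apply_inverse:
  "inner_form b \<Longrightarrow> gram b *v (matrix_inv (gram b) *v v) = v"
  "inner_form b \<Longrightarrow> matrix_inv (gram b) *v (gram b *v v) = v"
  by (simp_all only: matrix_vector_mul_assoc inner_form_inverse matrix_vector_mul_lid)

lemma bilinear_compose:
  assumes "bilinear b" "linear f"
  shows "bilinear (\<lambda>u v. b (f u) (f v))"
  unfolding bilinear_def
proof (intro conjI allI)
  fix u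
  have "linear (b (f u))" "linear (\<lambda>x. b x (f u))" using assms(1) by (simp_all add: bilinear_def)
  from this[THEN linear_compose[OF assms(2)]]
  show "linear (\<lambda>v. b (f u) (f v))" "linear (\<lambda>v. b (f v) (f u))" by (simp_all add: o_def)
qed

lemma gram_compose:
  assumes "bilinear b" "linear f"
  shows "gram (\<lambda>u v. b (f u) (f v)) = transpose (matrix f) ** gram b ** matrix f"
proof -
  have "bilinear (\<lambda>u v. b (f u) (f v))" by (rule bilinear_compose[OF assms])
  then have 1: "u \<bullet> (gram (\<lambda>u v. b (f u) (f v)) *v v) = b (f u) (f v)" for u v by (rule gram_apply)
  have 2: "u \<bullet> ((transpose (matrix f) ** gram b ** matrix f) *v v) = b (f u) (f v)" for u v
  proof -
    have "u \<bullet> ((transpose (matrix f) ** gram b ** matrix f) *v v) =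
        (matrix f *v u) \<bullet> (gram b *v (matrix f *v v))"
      by (simp only: matrix_vector_mul_assoc[symmetric] dot_lmul_matrix[symmetric] vector_transpose_matrix)
    then show ?thesis by (simp only: matrix_of_linear[OF assms(2)] gram_apply[OF assms(1)])
  qed
  have "u \<bullet> (gram (\<lambda>u v. b (f u) (f v)) *v v) = u \<bullet> ((transpose (matrix f) ** gram b ** matrix f) *v v)"
    for u v by (simp only: 1 2)
  then have "gram (\<lambda>u v. b (f u) (f v)) *v v = (transpose (matrix f) ** gram b ** matrix f) *v v" for v
    by (metis vector_eq_ldot)
  then show ?thesis by (simp add: matrix_eq)
qed

lemma inner_form_compose:
  assumes "inner_form b" "linear f" "inj f"
  shows "inner_form (\<lambda>u v. b (f u) (f v))"
  using assms bilinear_compose[OF _ assms(2)] linear_injective_0[OF assms(2)]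
  unfolding inner_form_def by blast

lemma smooth_on_det:
  assumes "open S" "\<And>i j. smooth_on S (\<lambda>y. M y $ i $ j)"
  shows "smooth_on S (\<lambda>y. det (M y :: real^'n::finite^'n))"
  unfolding det_def by (intro smooth_on_sum smooth_on_mult smooth_on_const smooth_on_prod assms)

lemma smooth_on_matrix_vector_mult:
  fixes M :: "real^'k::finite \<Rightarrow> real^'n::finite^'n" and h :: "real^'k \<Rightarrow> real^'n"
  assumes "open S" "\<And>i j. smooth_on S (\<lambda>y. M y $ i $ j)" "\<And>i. smooth_on S (\<lambda>y. h y $ i)"
  shows "smooth_on S (\<lambda>y. M y *v h y)"
proof (rule smooth_on_components[OF assms(1)])
  show "smooth_on S (\<lambda>y. (M y *v h y) $ i)" for i
    unfolding matrix_vector_mult_def by (simp, intro smooth_on_sum smooth_on_mult assms)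
qed

text \<open>Cramer's rule expresses the inverse by determinants.\<close>

lemma smooth_on_inverse_gram:
  fixes b :: "real^'k::finite \<Rightarrow> real^'n::finite \<Rightarrow> real^'n \<Rightarrow> real"
  assumes "open S" "\<And>y. y \<in> S \<Longrightarrow> inner_form (b y)" "\<And>u v. smooth_on S (\<lambda>y. b y u v)"
  shows "smooth_on S (\<lambda>y. matrix_inv (gram (b y)) *v v)"
proof (rule smooth_on_components[OF assms(1)])
  fix k
  let ?C = "\<lambda>y. \<chi> i j. if j = k then v $ i else gram (b y) $ i $ j"
  have G: "smooth_on S (\<lambda>y. gram (b y) $ i $ j)" for i j
    using assms(3) by (simp add: gram_def)
  have C: "smooth_on S (\<lambda>y. ?C y $ i $ j)" for i j
    by (cases "j = k") (simp_all add: G smooth_on_const)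
  have "det (gram (b y)) \<noteq> 0" if "y \<in> S" for y
    using inner_form_det[OF assms(2)[OF that]] by simp
  then have "smooth_on S (\<lambda>y. det (?C y) * inverse (det (gram (b y))))"
    by (intro smooth_on_mult[OF assms(1) smooth_on_det[OF assms(1) C]]
        smooth_on_inverse[OF assms(1) smooth_on_det[OF assms(1) G]])
  then show "smooth_on S (\<lambda>y. (matrix_inv (gram (b y)) *v v) $ k)"
  proof (rule smooth_on_cong[OF assms(1)])
    fix y assume y: "y \<in> S"
    have "det (gram (b y)) \<noteq> 0" using inner_form_det[OF assms(2)[OF y]] by simp
    from cramer[OF this, of "matrix_inv (gram (b y)) *v v" v] gram_apply_inverse[OF assms(2)[OF y], of v]
    have "matrix_inv (gram (b y)) *v v =
        (\<chi> k. det (\<chi> i j. if j = k then v $ i else gram (b y) $ i $ j) / det (gram (b y)))" by simp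
    then show "det (?C y) * inverse (det (gram (b y))) = (matrix_inv (gram (b y)) *v v) $ k"
      by (simp add: divide_inverse)
  qed
qed


section \<open>The metric in charts\<close>

locale riemannian_manifold = oriented_manifold A
  for A :: "('m::{t2_space, second_countable_topology}, 'n::finite) chart set" +
  fixes g :: "('m, 'n) metric"
  assumes metric: "riemannian_metric A g"
begin

text \<open>In coordinates these are \<open>g\<^sub>i\<^sub>j\<close>, \<open>g\<^sup>i\<^sup>j\<close> and \<open>sqrt (det (g\<^sub>i\<^sub>j))\<close>.\<close>

definition loc_gram :: "('m, 'n) chart \<Rightarrow> real^'n \<Rightarrow> real^'n^'n" where
  "loc_gram c y = gram (loc_metric A c g y)"

definition loc_cogram :: "('m, 'n) chart \<Rightarrow> real^'n \<Rightarrow> real^'n^'n" where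
  "loc_cogram c y = matrix_inv (loc_gram c y)"

definition vol_density :: "('m, 'n) chart \<Rightarrow> real^'n \<Rightarrow> real" where
  "vol_density c y = sqrt (det (loc_gram c y))"

lemma metric_inner_form: "inner_form (g x)"
  using metric by (simp add: riemannian_metric_def inner_form_def)

lemma loc_metric_inner_form:
  assumes "c \<in> A" "y \<in> chart_range c"
  shows "inner_form (loc_metric A c g y)"
proof -
  have x: "chart_inv c y \<in> fst c" by (rule chart_inv_dom[OF assms])
  have "inj (to_ref A c (chart_inv c y))"
    by (rule inj_on_inverseI) (rule from_ref_to_ref[OF assms(1) x])
  then show ?thesis unfolding loc_metric_def[abs_def]
    by (rule inner_form_compose[OF metric_inner_form linear_to_ref[OF assms(1) x]])
qed

lemma smooth_on_loc_metric: "c \<in> A \<Longrightarrow> smooth_on (chart_range c) (\<lambda>y. loc_metric A c g y u v)"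
  using metric by (simp add: riemannian_metric_def)

lemma loc_gram_inverse:
  "c \<in> A \<Longrightarrow> y \<in> chart_range c \<Longrightarrow> loc_gram c y *v (loc_cogram c y *v v) = v"
  "c \<in> A \<Longrightarrow> y \<in> chart_range c \<Longrightarrow> loc_cogram c y *v (loc_gram c y *v v) = v"
  unfolding loc_gram_def loc_cogram_def by (intro gram_apply_inverse loc_metric_inner_form; assumption)+

lemma vol_density_pos: "c \<in> A \<Longrightarrow> y \<in> chart_range c \<Longrightarrow> vol_density c y > 0"
  using inner_form_det[OF loc_metric_inner_form] by (simp add: vol_density_def loc_gram_def)

lemma smooth_on_vol_density: 
  assumes "c \<in> A" shows "smooth_on (chart_range c) (vol_density c)"
  unfolding vol_density_def[abs_def] loc_gram_def
  by (intro smooth_on_sqrt smooth_on_det open_chart_range[OF assms] inner_form_det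
      loc_metric_inner_form[OF assms]) (simp_all add: gram_def smooth_on_loc_metric[OF assms])

lemma smooth_on_loc_gram:
  assumes "c \<in> A" shows "smooth_on (chart_range c) (\<lambda>y. loc_gram c y *v v)"
proof (rule smooth_on_matrix_vector_mult[OF open_chart_range[OF assms]])
  show "smooth_on (chart_range c) (\<lambda>y. loc_gram c y $ i $ j)" for i j
    unfolding loc_gram_def gram_def using smooth_on_loc_metric[OF assms] by simp
qed (rule smooth_on_const)

lemma smooth_on_loc_cogram:
  assumes "c \<in> A" shows "smooth_on (chart_range c) (\<lambda>y. loc_cogram c y *v v)"
  unfolding loc_cogram_def loc_gram_def
  by (rule smooth_on_inverse_gram[OF open_chart_range[OF assms] loc_metric_inner_form[OF assms]
        smooth_on_loc_metric[OF assms]])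

text \<open>The Gram matrices in two charts are congruent by the Jacobian matrix of the coordinate change.\<close>

lemma vol_density_transition:
  assumes "c \<in> A" "c' \<in> A" "y \<in> overlap c c'"
  shows "vol_density c y = vol_density c' (transition c c' y) * \<bar>det (matrix (jac c c' y))\<bar>"
proof -
  let ?T = "transition c c' y" and ?M = "matrix (jac c c' y)"
  have x: "chart_inv c y \<in> fst c" "chart_inv c y \<in> fst c'" "snd c (chart_inv c y) = y"
    using assms by (auto simp: overlap_def chart_inv_dom chart_inv_right)
  have T: "?T \<in> chart_range c'" using x by (simp add: chart_in_range)
  have "to_ref A c (chart_inv c y) v = to_ref A c' (chart_inv c y) (jac c c' y v)" for v
    using to_ref_jac_cocycle[OF assms(1,2) x(1,2), of v] x(3) by simp
  then have "loc_metric A c g y = (\<lambda>u v. loc_metric A c' g ?T (jac c c' y u) (jac c c' y v))"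
    unfolding loc_metric_def[abs_def] chart_inv_transition[OF assms(2,3)] by simp
  then have "loc_gram c y = transpose ?M ** loc_gram c' ?T ** ?M"
    using loc_metric_inner_form[OF assms(2) T] linear_jac[OF assms]
    by (simp add: loc_gram_def inner_form_def gram_compose)
  then show ?thesis
    by (simp add: vol_density_def det_mul real_sqrt_mult mult.commute mult.left_commute)
qed


section \<open>The pointwise inner product of forms\<close>

text \<open>The sum over the second multi-index expands the form with all indices raised, since the inverse Gram
  matrix is symmetric.\<close>

lemma form_inner_raise:
  assumes "alt_form p (\<eta> x)"
  shows "form_inner g p \<omega> \<eta> x = (1 / fact p) *
    (\<Sum>I | length I = p. \<omega> x (ax I) * cnj (\<eta> x (map ((*v) (matrix_inv (gram (g x)))) (ax I))))"
proof -
  let ?N = "matrix_inv (gram (g x))"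
  have sym: "?N $ i $ j = ?N $ j $ i" for i j
    using arg_cong[OF transpose_inverse_gram[OF metric_inner_form[of x]], of "\<lambda>M. M $ j $ i"]
    by (simp add: transpose_def)
  have "cnj (\<eta> x (map ((*v) ?N) (ax I))) =
      (\<Sum>J | length J = p. of_real (\<Prod>a<p. ?N $ (I ! a) $ (J ! a)) * cnj (\<eta> x (ax J)))"
    if "length I = p" for I
  proof -
    have "cnj (\<eta> x (map ((*v) ?N) (ax I))) =
      (\<Sum>J | length J = p. of_real (\<Prod>a<p. ?N $ (J ! a) $ (I ! a)) * cnj (\<eta> x (ax J)))"
      using multilin_matrix_expand[OF alt_form_multilin[OF alt_form_cnj[OF assms]] that, of ?N] .
    then show ?thesis using sym by simp
  qed
  then show ?thesis
    unfolding form_inner_def by (simp add: sum_distrib_left mult.assoc mult.left_commute)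
qed

text \<open>If \<open>B\<close> is the matrix of the change of basis, the inverse Gram matrices are related by
  \<open>inverse G = B N B\<^sup>T\<close>; moving \<open>B\<close> from one factor to the other produces exactly this matrix.\<close>

lemma form_inner_chart:
  assumes c: "c \<in> A" "x \<in> fst c" and alt: "alt_form p (\<omega> x)" "alt_form p (\<eta> x)"
  shows "form_inner g p \<omega> \<eta> x = (1 / fact p) * (\<Sum>I | length I = p. loc_form A c \<omega> (snd c x) (ax I) *
    cnj (loc_form A c \<eta> (snd c x) (map ((*v) (loc_cogram c (snd c x))) (ax I))))"
proof -
  let ?y = "snd c x" and ?f = "to_ref A c x"
  let ?B = "matrix ?f" and ?G = "gram (g x)" and ?N = "loc_cogram c (snd c x)"
  have y: "?y \<in> chart_range c" by (rule chart_in_range[OF c(2)])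
  have x: "chart_inv c ?y = x" by (rule chart_inv_left[OF c])
  have lin: "linear ?f" by (rule linear_to_ref[OF c])
  have B: "?f = (*v) ?B" using matrix_of_linear[OF lin] by (intro ext) simp
  have "loc_gram c ?y = transpose ?B ** ?G ** ?B"
    unfolding loc_gram_def loc_metric_def[abs_def] x
    using metric_inner_form[of x] lin by (intro gram_compose) (simp_all add: inner_form_def)
  then have "(transpose ?B ** ?G ** ?B) ** ?N = mat 1"
    using inner_form_inverse(1)[OF loc_metric_inner_form[OF c(1) y]]
    by (simp add: loc_cogram_def loc_gram_def)
  then have 1: "transpose ?B ** (?G ** (?B ** ?N)) = mat 1" by (simp add: matrix_mul_assoc)
  then have "(?G ** (?B ** ?N)) ** transpose ?B = mat 1" by (simp add: matrix_left_right_inverse)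
  then have 2: "?G ** (?B ** ?N ** transpose ?B) = mat 1" by (simp add: matrix_mul_assoc)
  have "matrix_inv ?G ** (?G ** (?B ** ?N ** transpose ?B)) = ?B ** ?N ** transpose ?B"
    by (simp add: matrix_mul_assoc inner_form_inverse(2)[OF metric_inner_form])
  then have N: "matrix_inv ?G = ?B ** ?N ** transpose ?B" unfolding 2 by simp
  have loc: "loc_form A c \<zeta> ?y vs = \<zeta> x (map ((*v) ?B) vs)" for \<zeta> :: "('m, 'n) form_field" and vs
    unfolding loc_form_def x using B by simp
  have "(\<Sum>I | length I = p. \<omega> x (map ((*v) ?B) (ax I)) * cnj (\<eta> x (map ((*v) (?B ** ?N)) (ax I)))) =
      (\<Sum>I | length I = p. \<omega> x (ax I) * cnj (\<eta> x (map ((*v) (?B ** ?N ** transpose ?B)) (ax I))))"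
    using sum_multi_index_change_basis[OF alt_form_multilin[OF alt(1)] alt_form_multilin[OF alt_form_cnj[OF alt(2)]],
        of ?B "?B ** ?N"] .
  then show ?thesis
    unfolding form_inner_raise[of p \<eta> x, OF alt(2)] N loc by (simp add: o_def matrix_vector_mul_assoc)
qed

lemma form_inner_scale_left: "form_inner g p (scale_form f \<omega>) \<eta> x = f x * form_inner g p \<omega> \<eta> x"
  by (simp add: form_inner_def scale_form_def sum_distrib_left mult_ac)

lemma form_inner_scale_right: "form_inner g p \<omega> (scale_form f \<eta>) x = cnj (f x) * form_inner g p \<omega> \<eta> x"
  by (simp add: form_inner_def scale_form_def sum_distrib_left mult_ac)

lemma form_inner_add_left:
  "form_inner g p (\<lambda>x vs. \<omega> x vs + \<omega>' x vs) \<eta> x = form_inner g p \<omega> \<eta> x + form_inner g p \<omega>' \<eta> x"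
  by (simp add: form_inner_def distrib_left distrib_right sum.distrib)

lemma form_inner_diff_right:
  "form_inner g p \<omega> (\<lambda>x vs. \<eta> x vs - \<eta>' x vs) x = form_inner g p \<omega> \<eta> x - form_inner g p \<omega> \<eta>' x"
  by (simp add: form_inner_def right_diff_distrib sum_subtractf)

lemma smooth_on_raised:
  assumes "\<omega> \<in> Omega A p" "c \<in> A"
  shows "smooth_on (chart_range c) (\<lambda>y. loc_form A c \<omega> y (map ((*v) (loc_cogram c y)) vs))"
proof (cases "length vs = p")
  case True
  show ?thesis
    by (rule smooth_on_multilin[OF open_chart_range[OF assms(2)]])
      (use True alt_form_multilin[OF Omega_alt_loc[OF assms]] Omega_smooth[OF assms]
        smooth_on_loc_cogram[OF assms(2)] in auto)
next
  case False
  then show ?thesis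
    using alt_form_length[OF Omega_alt[OF assms(1)]] by (simp add: loc_form_def smooth_on_const)
qed


section \<open>Contraction with a dual vector field\<close>

lemma metric_apply: "g x u v = u \<bullet> (gram (g x) *v v)"
  by (rule gram_apply[symmetric]) (use metric_inner_form[of x] in \<open>simp add: inner_form_def\<close>)

lemma sharp_eqI:
  assumes "\<And>v. g x X v = \<alpha> x v"
  shows "sharp g \<alpha> x = X"
  unfolding sharp_def
proof (rule the_equality)
  show "\<forall>v. g x X v = \<alpha> x v" using assms by blast
  fix Y assume Y: "\<forall>v. g x Y v = \<alpha> x v"
  have b: "bilinear (g x)" using metric_inner_form by (simp add: inner_form_def)
  have "g x (Y - X) (Y - X) = 0" using Y assms by (simp add: bilinear_lsub[OF b])
  then show "Y = X" using metric_inner_form[of x] unfolding inner_form_def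
    by (metis eq_iff_diff_eq_0 less_irrefl)
qed

lemma sharp_metric:
  assumes "linear (\<alpha> x)"
  shows "g x (sharp g \<alpha> x) v = \<alpha> x v"
proof -
  let ?a = "\<chi> k. \<alpha> x (axis k 1)"
  let ?X = "matrix_inv (gram (g x)) *v ?a"
  have "g x ?X v = \<alpha> x v" for v
  proof -
    have "g x ?X v = v \<bullet> (gram (g x) *v ?X)"
      using metric_inner_form[of x] metric_apply[of x v ?X] by (simp add: inner_form_def)
    also have "\<dots> = v \<bullet> ?a" by (simp only: gram_apply_inverse[OF metric_inner_form])
    also have "\<dots> = \<alpha> x v" using linear_expand[OF assms, of v] by (simp add: inner_vec_def)
    finally show ?thesis .
  qed
  then show ?thesis using sharp_eqI[of x ?X \<alpha>] by simp
qed

lemma sharp_add: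
  assumes "linear (\<alpha> x)" "linear (\<beta> x)"
  shows "sharp g (\<lambda>x v. \<alpha> x v + \<beta> x v) x = sharp g \<alpha> x + sharp g \<beta> x"
proof (rule sharp_eqI)
  have b: "bilinear (g x)" using metric_inner_form by (simp add: inner_form_def)
  show "g x (sharp g \<alpha> x + sharp g \<beta> x) v = \<alpha> x v + \<beta> x v" for v
    by (simp add: bilinear_ladd[OF b] sharp_metric assms)
qed

text \<open>Raising the index of a covector in the coordinates of a chart; this shows that the dual field of a
  smooth \<open>1\<close>-form is smooth.\<close>

lemma from_ref_sharp:
  assumes "c \<in> A" "x \<in> fst c" "linear (\<alpha> x)"
  shows "from_ref c x (sharp g \<alpha> x) =
    loc_cogram c (snd c x) *v (\<chi> k. \<alpha> x (to_ref A c x (axis k 1)))"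
proof -
  let ?X = "from_ref c x (sharp g \<alpha> x)" and ?y = "snd c x"
  have y: "?y \<in> chart_range c" by (rule chart_in_range[OF assms(2)])
  have i: "inner_form (loc_metric A c g ?y)" by (rule loc_metric_inner_form[OF assms(1) y])
  have "(loc_gram c ?y *v ?X) $ k = \<alpha> x (to_ref A c x (axis k 1))" for k
  proof -
    have "(loc_gram c ?y *v ?X) $ k = axis k 1 \<bullet> (loc_gram c ?y *v ?X)"
      by (simp add: inner_axis')
    also have "\<dots> = loc_metric A c g ?y ?X (axis k 1)"
      using i by (simp add: loc_gram_def inner_form_def gram_apply)
    also have "\<dots> = g x (sharp g \<alpha> x) (to_ref A c x (axis k 1))"
      by (simp add: loc_metric_def chart_inv_left[OF assms(1,2)] to_ref_from_ref[OF assms(1,2)])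
    finally show ?thesis by (simp add: sharp_metric[of \<alpha> x, OF assms(3)])
  qed
  then have "loc_gram c ?y *v ?X = (\<chi> k. \<alpha> x (to_ref A c x (axis k 1)))" by (simp add: vec_eq_iff)
  then show ?thesis using loc_gram_inverse(2)[OF assms(1) y, of ?X] by simp
qed

lemma Omega_contract_sharp:
  assumes \<alpha>: "real_one_form A \<alpha>" and \<omega>: "\<omega> \<in> Omega A (Suc p)"
  shows "contract (sharp g \<alpha>) \<omega> \<in> Omega A p"
  unfolding Omega_def
proof (intro CollectI conjI ballI allI)
  show "alt_form p (contract (sharp g \<alpha>) \<omega> x)" for x
    unfolding contract_def by (rule alt_form_tail[OF Omega_alt[OF \<omega>]])
  fix c vs assume c: "c \<in> A"
  let ?R = "chart_range c"
  let ?a = "\<lambda>y. \<chi> k. \<alpha> (chart_inv c y) (to_ref A c (chart_inv c y) (axis k 1))"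
  have R: "open ?R" by (rule open_chart_range[OF c])
  show "smooth_on ?R (\<lambda>y. loc_form A c (contract (sharp g \<alpha>) \<omega>) y vs)"
  proof (cases "length vs = p")
    case False
    then show ?thesis
      using alt_form_length[OF Omega_alt[OF \<omega>]] by (simp add: loc_form_def contract_def smooth_on_const)
  next
    case True
    have a: "smooth_on ?R (\<lambda>y. ?a y $ k)" for k using \<alpha> c by (simp add: real_one_form_def)
    have "smooth_on ?R (\<lambda>y. (loc_cogram c y *v ?a y))"
    proof (rule smooth_on_matrix_vector_mult[OF R _ a])
      fix i j
      have "smooth_on ?R (\<lambda>y. (loc_cogram c y *v axis j 1) $ i)"
        by (rule smooth_on_nth[OF R smooth_on_loc_cogram[OF c]])
      then show "smooth_on ?R (\<lambda>y. loc_cogram c y $ i $ j)" by (simp add: matrix_axis)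
    qed
    then have "smooth_on ?R (\<lambda>y. \<Sum>k\<in>UNIV. ((loc_cogram c y *v ?a y) $ k) *\<^sub>R loc_form A c \<omega> y (axis k 1 # vs))"
      by (intro smooth_on_sum smooth_on_scaleR smooth_on_nth R Omega_smooth[OF \<omega> c])
    then show ?thesis
    proof (rule smooth_on_cong[OF R])
      fix y assume y: "y \<in> ?R"
      let ?x = "chart_inv c y"
      have x: "?x \<in> fst c" "snd c ?x = y" using chart_inv_dom[OF c y] chart_inv_right[OF c y] by auto
      have lin: "linear (\<alpha> ?x)" using \<alpha> by (simp add: real_one_form_def)
      have "loc_form A c (contract (sharp g \<alpha>) \<omega>) y vs = loc_form A c \<omega> y (from_ref c ?x (sharp g \<alpha> ?x) # vs)"
        unfolding loc_form_def contract_def by (simp add: to_ref_from_ref[OF c x(1)])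
      also have "from_ref c ?x (sharp g \<alpha> ?x) = loc_cogram c y *v ?a y"
        using from_ref_sharp[of c ?x \<alpha>, OF c x(1) lin] x(2) by simp
      also have "loc_form A c \<omega> y (loc_cogram c y *v ?a y # vs) =
          (\<Sum>k\<in>UNIV. ((loc_cogram c y *v ?a y) $ k) *\<^sub>R loc_form A c \<omega> y (axis k 1 # vs))"
        by (rule multilin_head_expand[OF alt_form_multilin[OF Omega_alt_loc[OF \<omega> c y]] True])
      finally show "(\<Sum>k\<in>UNIV. ((loc_cogram c y *v ?a y) $ k) *\<^sub>R loc_form A c \<omega> y (axis k 1 # vs)) =
        loc_form A c (contract (sharp g \<alpha>) \<omega>) y vs" by simp
    qed
  qed
qed

end

section \<open>Change of variables for nonnegative integrals\<close>

text \<open>\<open>has_absolute_integral_change_of_variables\<close> concerns vectors indexed by a well-ordered type. A copy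
  of a finite type is well-ordered by an enumeration, and the corresponding permutation of coordinates
  preserves Lebesgue measure and Jacobian determinants, so the formula carries over to every finite
  index type.\<close>

typedef 'a enumerated = "UNIV :: 'a set" ..

definition enum_rank :: "'a::finite \<Rightarrow> nat" where
  "enum_rank = (SOME f. inj f)"

lemma inj_enum_rank: "inj (enum_rank :: 'a::finite \<Rightarrow> nat)"
proof -
  have "\<exists>f :: 'a \<Rightarrow> nat. inj f" using finite_imp_inj_to_nat_seg[of "UNIV :: 'a set"] by auto
  then show ?thesis unfolding enum_rank_def by (rule someI_ex)
qed

instance enumerated :: (finite) finite
proof
  have "(UNIV :: 'a enumerated set) = Abs_enumerated ` UNIV"
    by (metis Rep_enumerated_inverse surj_def)
  then show "finite (UNIV :: 'a enumerated set)" by (metis finite finite_imageI)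
qed

instantiation enumerated :: (finite) wellorder
begin

definition less_eq_enumerated :: "'a enumerated \<Rightarrow> 'a enumerated \<Rightarrow> bool" where
  "less_eq_enumerated x y \<longleftrightarrow> enum_rank (Rep_enumerated x) \<le> enum_rank (Rep_enumerated y)"

definition less_enumerated :: "'a enumerated \<Rightarrow> 'a enumerated \<Rightarrow> bool" where
  "less_enumerated x y \<longleftrightarrow> enum_rank (Rep_enumerated x) < enum_rank (Rep_enumerated y)"

instance
proof
  fix x y :: "'a enumerated"
  show "x \<le> y \<Longrightarrow> y \<le> x \<Longrightarrow> x = y"
    unfolding less_eq_enumerated_def by (metis antisym injD inj_enum_rank Rep_enumerated_inject)
next
  fix P :: "'a enumerated \<Rightarrow> bool" and a
  assume step: "\<And>x. (\<And>y. y < x \<Longrightarrow> P y) \<Longrightarrow> P x"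
  show "P a"
  proof (induction "enum_rank (Rep_enumerated a)" arbitrary: a rule: less_induct)
    case less
    show ?case by (rule step) (rule less, simp add: less_enumerated_def)
  qed
qed (auto simp: less_eq_enumerated_def less_enumerated_def)

end

lemma bij_Rep_enumerated: "bij Rep_enumerated"
  by (rule bijI') (auto simp: Rep_enumerated_inject intro: Abs_enumerated_inverse[symmetric])

lemma det_reindex:
  fixes M :: "real^'b::finite^'b" and f :: "'a::finite \<Rightarrow> 'b"
  assumes "bij f"
  shows "det (\<chi> i j. M $ f i $ f j) = det M"
proof -
  have inj: "inj f" and surj: "f ` UNIV = UNIV" using assms by (auto simp: bij_def)
  have f: "inv f (f x) = x" "f (inv f y) = y" for x y
    using inj surj by (auto simp: surj_f_inv_f)
  have conj: "map_permutation UNIV f p = f \<circ> p \<circ> inv f" for p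
    unfolding map_permutation_def surj restrict_id_def by (simp add: fun_eq_iff)
  have conj_perm: "f \<circ> p \<circ> inv f permutes UNIV" if "p permutes UNIV" for p
    using map_permutation_permutes[of f UNIV UNIV p] assms that by (simp add: conj)
  have "inv f \<circ> q \<circ> f permutes UNIV" if "q permutes UNIV" for q
  proof -
    have "bij (inv f \<circ> q \<circ> f)"
      using assms that by (intro bij_comp bij_imp_bij_inv) (auto simp: permutes_bij)
    then show ?thesis by (simp add: permutes_univ bij_iff)
  qed
  moreover have "sign (f \<circ> p \<circ> inv f) = sign p" if "p permutes UNIV" for p
    using sign_map_permutation[OF inj that] by (simp add: conj)
  moreover have "(\<Prod>i\<in>UNIV. M $ i $ (f \<circ> p \<circ> inv f) i) = (\<Prod>i\<in>UNIV. M $ f i $ f (p i))" for p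
    using prod.reindex_bij_betw[OF assms, of "\<lambda>i. M $ i $ (f \<circ> p \<circ> inv f) i"] by (simp add: f)
  ultimately show ?thesis
    unfolding det_def
    by (intro sum.reindex_bij_witness[of _ "\<lambda>q. inv f \<circ> q \<circ> f" "\<lambda>p. f \<circ> p \<circ> inv f"])
      (auto simp: fun_eq_iff f conj_perm)
qed

definition enum_coords :: "real^'n::finite \<Rightarrow> real^('n enumerated)" where
  "enum_coords v = (\<chi> i. v $ Rep_enumerated i)"

definition unenum_coords :: "real^('n::finite enumerated) \<Rightarrow> real^'n" where
  "unenum_coords v = (\<chi> i. v $ Abs_enumerated i)"

lemma unenum_enum: "unenum_coords (enum_coords v) = v"
  by (simp add: unenum_coords_def enum_coords_def Abs_enumerated_inverse)

lemma enum_unenum: "enum_coords (unenum_coords v) = v"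
  by (simp add: unenum_coords_def enum_coords_def Rep_enumerated_inverse)

lemma linear_enum: "linear enum_coords" and linear_unenum: "linear unenum_coords"
  by (auto intro!: linearI simp: enum_coords_def unenum_coords_def vec_eq_iff)

lemma measurable_enum [measurable]: "enum_coords \<in> borel_measurable borel"
  and measurable_unenum [measurable]: "unenum_coords \<in> borel_measurable borel"
  using linear_enum linear_unenum
  by (auto intro!: borel_measurable_continuous_onI linear_continuous_on simp: linear_conv_bounded_linear)

lemma distr_enum_coords: "distr lborel borel (enum_coords :: real^'n::finite \<Rightarrow> _) = lborel"
proof (rule lborel_eqI[symmetric])
  fix l u :: "real^('n enumerated)"
  assume le: "\<And>b. b \<in> Basis \<Longrightarrow> l \<bullet> b \<le> u \<bullet> b"
  have in_box: "x \<in> box a b \<longleftrightarrow> (\<forall>i. a $ i < x $ i \<and> x $ i < b $ i)" for x a b :: "real^'k::finite"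
    by (auto simp: mem_box_cart)
  have E: "enum_coords -` box l u = box (unenum_coords l) (unenum_coords u :: real^'n)"
    unfolding set_eq_iff vimage_eq in_box
  proof (intro allI iffI)
    fix x :: "real^'n" and i
    assume h: "\<forall>i. l $ i < enum_coords x $ i \<and> enum_coords x $ i < u $ i"
    then show "unenum_coords l $ i < x $ i \<and> x $ i < unenum_coords u $ i"
      using spec[OF h, of "Abs_enumerated i"] by (simp add: enum_coords_def unenum_coords_def Abs_enumerated_inverse)
  next
    fix x :: "real^'n" and i
    assume h: "\<forall>i. unenum_coords l $ i < x $ i \<and> x $ i < unenum_coords u $ i"
    then show "l $ i < enum_coords x $ i \<and> enum_coords x $ i < u $ i"
      using spec[OF h, of "Rep_enumerated i"] by (simp add: enum_coords_def unenum_coords_def Rep_enumerated_inverse)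
  qed
  have P: "(\<Prod>b\<in>Basis. (w - v) \<bullet> b) = (\<Prod>i\<in>UNIV. (w - v) $ i)" for v w :: "real^'k::finite"
    by (simp add: Basis_vec_def cart_eq_inner_axis prod.UNION_disjoint UNION_singleton_eq_range
        prod.reindex inj_on_def axis_eq_axis)
  have Q: "(\<Prod>i\<in>UNIV. (unenum_coords u - unenum_coords l) $ i) = (\<Prod>i\<in>UNIV. (u - l) $ i)"
    using prod.reindex_bij_betw[OF bij_Rep_enumerated, of "\<lambda>i. (unenum_coords u - unenum_coords l) $ i"]
    by (simp add: unenum_coords_def Rep_enumerated_inverse)
  have "l $ i \<le> u $ i" for i
    using le[of "axis i 1"] by (simp add: inner_axis axis_in_Basis_iff)
  then have "unenum_coords l \<bullet> b \<le> unenum_coords u \<bullet> b" if "b \<in> Basis" for b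
    using that by (auto simp: Basis_vec_def unenum_coords_def inner_axis)
  then have "emeasure (distr lborel borel enum_coords) (box l u) =
      ennreal (\<Prod>b\<in>Basis. (unenum_coords u - unenum_coords l :: real^'n) \<bullet> b)"
    using emeasure_lborel_box[of "unenum_coords l" "unenum_coords u"] by (simp add: emeasure_distr E)
  then show "emeasure (distr lborel borel enum_coords) (box l u) = (\<Prod>b\<in>Basis. (u - l) \<bullet> b)"
    by (simp only: P Q)
qed simp

lemma nn_integral_enum:
  "h \<in> borel_measurable borel \<Longrightarrow> (\<integral>\<^sup>+z. h z \<partial>lborel) = (\<integral>\<^sup>+y. h (enum_coords y) \<partial>lborel)"
  by (subst distr_enum_coords[symmetric], subst nn_integral_distr) auto

text \<open>For nonnegative functions the two notions of integral agree as long as the value is finite; the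
  equality of two nonnegative integrals is then reduced to equality of their finite values.\<close>

lemma has_integral_iff_set_nn_integral:
  fixes h :: "'a::euclidean_space \<Rightarrow> real"
  assumes "(\<lambda>x. indicator S x * h x) \<in> borel_measurable borel" "\<And>x. x \<in> S \<Longrightarrow> 0 \<le> h x" "0 \<le> r"
  shows "(h has_integral r) S \<longleftrightarrow> (\<integral>\<^sup>+x\<in>S. ennreal (h x) \<partial>lborel) = ennreal r"
proof -
  let ?k = "\<lambda>x. indicator S x * h x"
  have eq: "(\<integral>\<^sup>+x\<in>S. ennreal (h x) \<partial>lborel) = integral\<^sup>N lborel (\<lambda>x. ennreal (?k x))"
    by (intro nn_integral_cong) (auto simp: indicator_def)
  have nonneg: "0 \<le> ?k x" for x using assms(2) by (auto simp: indicator_def)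
  have if_eq: "(\<lambda>x. if x \<in> S then h x else 0) = ?k" by (auto simp: indicator_def)
  have m: "?k \<in> lebesgue \<rightarrow>\<^sub>M borel" using assms(1) by (simp add: measurable_completion)
  have "(h has_integral r) S \<longleftrightarrow> (?k has_integral r) UNIV"
    unfolding if_eq[symmetric] by (rule has_integral_restrict_UNIV[symmetric])
  also have "\<dots> \<longleftrightarrow> integral\<^sup>N lborel (\<lambda>x. ennreal (?k x)) = ennreal r"
    using has_integral_iff_nn_integral_lebesgue[of ?k r, OF nonneg] m assms(1,3)
    by (simp add: nn_integral_completion)
  finally show ?thesis by (simp add: eq)
qed

lemma nn_integral_change_of_variables_wellorder:
  fixes f :: "real^'w::{finite,wellorder} \<Rightarrow> real" and T :: "real^'w::_ \<Rightarrow> real^'w::_"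
  assumes S: "S \<in> sets borel"
    and der: "\<And>x. x \<in> S \<Longrightarrow> (T has_derivative T' x) (at x within S)"
    and inj: "inj_on T S"
    and nonneg: "\<And>x. x \<in> T ` S \<Longrightarrow> 0 \<le> f x"
    and m1: "(\<lambda>x. indicator S x * (\<bar>det (matrix (T' x))\<bar> * f (T x))) \<in> borel_measurable borel"
    and m2: "(\<lambda>x. indicator (T ` S) x * f x) \<in> borel_measurable borel"
  shows "(\<integral>\<^sup>+x\<in>S. ennreal (\<bar>det (matrix (T' x))\<bar> * f (T x)) \<partial>lborel) = (\<integral>\<^sup>+x\<in>T ` S. ennreal (f x) \<partial>lborel)"
    (is "?L = ?R")
proof -
  let ?F = "\<lambda>x. \<bar>det (matrix (T' x))\<bar> * f (T x)"
  have nF: "0 \<le> ?F x" if "x \<in> S" for x using nonneg that by simp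
  have S': "S \<in> sets lebesgue" using S by simp
  have "(?F absolutely_integrable_on S \<and> integral S ?F = b) \<longleftrightarrow>
      (f absolutely_integrable_on T ` S \<and> integral (T ` S) f = b)" for b
    using has_absolute_integral_change_of_variables[OF S' der inj, of "\<lambda>x. vec (f x) :: real^1" "vec b"]
    unfolding absolutely_integrable_on_1_iff integral_on_1_eq by (simp add: vec_eq_iff)
  then have eq: "(?F has_integral b) S \<longleftrightarrow> (f has_integral b) (T ` S)" for b
    using absolutely_integrable_on_iff_nonneg[of S ?F, OF nF]
      absolutely_integrable_on_iff_nonneg[of "T ` S" f, OF nonneg]
    by (simp add: has_integral_iff)
  have iff: "?L = ennreal b \<longleftrightarrow> ?R = ennreal b" if "0 \<le> b" for b
    using has_integral_iff_set_nn_integral[OF m1 nF that] has_integral_iff_set_nn_integral[OF m2 nonneg that]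
      eq[of b] by blast
  have fin: "?L = ennreal b \<Longrightarrow> ?R = ennreal b" "?R = ennreal b \<Longrightarrow> ?L = ennreal b" if "0 \<le> b" for b
    using iff[OF that] by blast+
  show ?thesis
  proof (cases "?L" rule: ennreal_cases)
    case (real b)
    show ?thesis unfolding real(2) by (rule fin(1)[OF real, symmetric])
  next
    case top
    show ?thesis
    proof (cases "?R" rule: ennreal_cases)
      case (real b)
      then show ?thesis using fin(2)[OF real] top by simp
    qed (simp add: top)
  qed
qed

theorem nn_integral_change_of_variables:
  fixes f :: "real^'n::finite \<Rightarrow> real" and T :: "real^'n \<Rightarrow> real^'n"
  assumes S: "S \<in> sets borel"
    and der: "\<And>x. x \<in> S \<Longrightarrow> (T has_derivative T' x) (at x within S)"
    and inj: "inj_on T S"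
    and nonneg: "\<And>x. x \<in> T ` S \<Longrightarrow> 0 \<le> f x"
    and m1: "(\<lambda>x. indicator S x * (\<bar>det (matrix (T' x))\<bar> * f (T x))) \<in> borel_measurable borel"
    and m2: "(\<lambda>x. indicator (T ` S) x * f x) \<in> borel_measurable borel"
  shows "(\<integral>\<^sup>+x\<in>S. ennreal (\<bar>det (matrix (T' x))\<bar> * f (T x)) \<partial>lborel) = (\<integral>\<^sup>+x\<in>T ` S. ennreal (f x) \<partial>lborel)"
proof -
  let ?e = "enum_coords :: real^'n \<Rightarrow> real^('n enumerated)" and ?u = "unenum_coords :: _ \<Rightarrow> real^'n"
  define S2 where "S2 = ?u -` S"
  define T2 where "T2 = ?e \<circ> T \<circ> ?u"
  define T2' where "T2' z = ?e \<circ> T' (?u z) \<circ> ?u" for z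
  define f2 where "f2 = f \<circ> ?u"
  have img: "T2 ` S2 = ?u -` (T ` S)"
  proof (intro equalityI subsetI)
    fix z assume "z \<in> ?u -` (T ` S)"
    then obtain x where x: "x \<in> S" "?u z = T x" by auto
    then have "z = T2 (?e x)" by (metis T2_def comp_apply enum_unenum unenum_enum)
    moreover have "?e x \<in> S2" using x by (simp add: S2_def unenum_enum)
    ultimately show "z \<in> T2 ` S2" by blast
  qed (auto simp: S2_def T2_def unenum_enum)
  have ind: "indicator S2 z = (indicator S (?u z) :: real)" "indicator (T2 ` S2) z = (indicator (T ` S) (?u z) :: real)"
    "indicator S2 z = (indicator S (?u z) :: ennreal)" "indicator (T2 ` S2) z = (indicator (T ` S) (?u z) :: ennreal)" for z
    unfolding img by (auto simp: S2_def indicator_def)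
  have T': "linear (T' x)" if "x \<in> S" for x by (rule has_derivative_linear[OF der[OF that]])
  have det: "det (matrix (T2' z)) = det (matrix (T' (?u z)))" if "z \<in> S2" for z
  proof -
    have "?u (axis j 1) = axis (Rep_enumerated j) 1" for j
      by (auto simp: unenum_coords_def axis_def vec_eq_iff Abs_enumerated_inverse Rep_enumerated_inverse)
    then have "matrix (T2' z) = (\<chi> i j. matrix (T' (?u z)) $ Rep_enumerated i $ Rep_enumerated j)"
      by (simp add: matrix_def T2'_def enum_coords_def)
    then show ?thesis by (simp only: det_reindex[OF bij_Rep_enumerated])
  qed
  have S2: "S2 \<in> sets borel"
    using measurable_sets[OF measurable_unenum S] by (simp add: S2_def)
  have der2: "(T2 has_derivative T2' z) (at z within S2)" if "z \<in> S2" for z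
  proof -
    have u: "(?u has_derivative ?u) (at z within S2)"
      using bounded_linear_imp_has_derivative[of ?u] linear_unenum by (simp add: linear_conv_bounded_linear)
    have "(T has_derivative T' (?u z)) (at (?u z) within ?u ` S2)"
      by (rule has_derivative_subset[OF der]) (use that in \<open>auto simp: S2_def\<close>)
    from diff_chain_within[OF u this]
    have "((T \<circ> ?u) has_derivative (T' (?u z) \<circ> ?u)) (at z within S2)" .
    from bounded_linear.has_derivative[OF _ this, of ?e] linear_enum
    show ?thesis by (simp add: T2_def T2'_def o_def linear_conv_bounded_linear)
  qed
  have inj2: "inj_on T2 S2"
  proof (rule inj_onI)
    fix z w assume h: "z \<in> S2" "w \<in> S2" "T2 z = T2 w"
    then have "?u z = ?u w"
      using inj_onD[OF inj, of "?u z" "?u w"] by (metis S2_def T2_def comp_apply unenum_enum vimage_eq)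
    then show "z = w" by (metis enum_unenum)
  qed
  have "(\<lambda>z. indicator S (?u z) * (\<bar>det (matrix (T' (?u z)))\<bar> * f (T (?u z)))) \<in> borel_measurable borel"
    by (rule measurable_compose[OF measurable_unenum m1])
  moreover have "indicator S2 z * (\<bar>det (matrix (T2' z))\<bar> * f2 (T2 z)) =
      indicator S (?u z) * (\<bar>det (matrix (T' (?u z)))\<bar> * f (T (?u z)))" for z
    using det[of z] ind(1)[of z] by (cases "z \<in> S2") (auto simp: f2_def T2_def unenum_enum)
  ultimately have m1': "(\<lambda>z. indicator S2 z * (\<bar>det (matrix (T2' z))\<bar> * f2 (T2 z))) \<in> borel_measurable borel"
    by simp
  have m2': "(\<lambda>z. indicator (T2 ` S2) z * f2 z) \<in> borel_measurable borel"
    using measurable_compose[OF measurable_unenum m2] by (simp add: ind f2_def)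
  have nonneg2: "0 \<le> f2 z" if "z \<in> T2 ` S2" for z using that nonneg unfolding img f2_def by simp
  have "(\<integral>\<^sup>+z\<in>S2. ennreal (\<bar>det (matrix (T2' z))\<bar> * f2 (T2 z)) \<partial>lborel) = (\<integral>\<^sup>+z\<in>T2 ` S2. ennreal (f2 z) \<partial>lborel)"
    by (rule nn_integral_change_of_variables_wellorder[OF S2 der2 inj2 nonneg2 m1' m2'])
  moreover have "(\<integral>\<^sup>+z\<in>S2. ennreal (\<bar>det (matrix (T2' z))\<bar> * f2 (T2 z)) \<partial>lborel) =
      (\<integral>\<^sup>+x\<in>S. ennreal (\<bar>det (matrix (T' x))\<bar> * f (T x)) \<partial>lborel)"
  proof -
    have "(\<integral>\<^sup>+z\<in>S2. ennreal (\<bar>det (matrix (T2' z))\<bar> * f2 (T2 z)) \<partial>lborel) =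
        (\<integral>\<^sup>+z. ennreal (indicator S2 z * (\<bar>det (matrix (T2' z))\<bar> * f2 (T2 z))) \<partial>lborel)"
      by (intro nn_integral_cong) (auto simp: indicator_def)
    also have "\<dots> = (\<integral>\<^sup>+x. ennreal (indicator S2 (?e x) * (\<bar>det (matrix (T2' (?e x)))\<bar> * f2 (T2 (?e x)))) \<partial>lborel)"
      by (rule nn_integral_enum[OF measurable_compose[OF m1' measurable_ennreal]])
    also have "\<dots> = (\<integral>\<^sup>+x\<in>S. ennreal (\<bar>det (matrix (T' x))\<bar> * f (T x)) \<partial>lborel)"
      using det by (intro nn_integral_cong) (auto simp: indicator_def S2_def f2_def T2_def unenum_enum)
    finally show ?thesis .
  qed
  moreover have "(\<integral>\<^sup>+z\<in>T2 ` S2. ennreal (f2 z) \<partial>lborel) = (\<integral>\<^sup>+x\<in>T ` S. ennreal (f x) \<partial>lborel)"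
  proof -
    have "(\<integral>\<^sup>+z\<in>T2 ` S2. ennreal (f2 z) \<partial>lborel) = (\<integral>\<^sup>+z. ennreal (indicator (T2 ` S2) z * f2 z) \<partial>lborel)"
      by (intro nn_integral_cong) (auto simp: indicator_def)
    also have "\<dots> = (\<integral>\<^sup>+x. ennreal (indicator (T2 ` S2) (?e x) * f2 (?e x)) \<partial>lborel)"
      by (rule nn_integral_enum[OF measurable_compose[OF m2' measurable_ennreal]])
    also have "\<dots> = (\<integral>\<^sup>+x\<in>T ` S. ennreal (f x) \<partial>lborel)"
      unfolding img by (intro nn_integral_cong) (auto simp: indicator_def f2_def unenum_enum)
    finally show ?thesis .
  qed
  ultimately show ?thesis by simp
qed

section \<open>The Riemannian measure\<close>

context riemannian_manifold
begin

text \<open>The density and the inverse coordinate map are extended from the chart range to all of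
  \<^typ>\<open>real^'n\<close>. The extended density vanishes outside, so the image measure is concentrated on the
  chart domain.\<close>

definition ext_density :: "('m, 'n) chart \<Rightarrow> real^'n \<Rightarrow> real" where
  "ext_density c y = (if y \<in> chart_range c then vol_density c y else 0)"

definition ext_chart_inv :: "('m, 'n) chart \<Rightarrow> real^'n \<Rightarrow> 'm" where
  "ext_chart_inv c y = (if y \<in> chart_range c then chart_inv c y else undefined)"

definition chart_measure :: "('m, 'n) chart \<Rightarrow> 'm measure" where
  "chart_measure c = distr (density lborel (\<lambda>y. ennreal (ext_density c y))) borel (ext_chart_inv c)"

lemma measurable_ext_density: "c \<in> A \<Longrightarrow> ext_density c \<in> borel_measurable borel"
  unfolding ext_density_def[abs_def]
  by (intro borel_measurable_continuous_on_if continuous_on_const borel_open open_chart_range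
      smooth_on_continuous[OF smooth_on_vol_density])

lemma measurable_ext_chart_inv: "c \<in> A \<Longrightarrow> ext_chart_inv c \<in> borel_measurable borel"
  unfolding ext_chart_inv_def[abs_def]
  by (intro borel_measurable_continuous_on_if continuous_on_const borel_open open_chart_range
      continuous_on_chart_inv)

lemma ext_density_nonneg: "c \<in> A \<Longrightarrow> 0 \<le> ext_density c y"
  using less_imp_le[OF vol_density_pos[of c y]] by (simp add: ext_density_def)

lemma image_chart_preimage:
  "c \<in> A \<Longrightarrow> S \<subseteq> fst c \<Longrightarrow> snd c ` S = {y \<in> chart_range c. chart_inv c y \<in> S}"
  using image_chart_eq[of c S] by (simp add: Int_absorb2)

lemma sets_image_chart:
  assumes "c \<in> A" "S \<in> sets borel" "S \<subseteq> fst c"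
  shows "snd c ` S \<in> sets borel"
proof -
  have "ext_chart_inv c -` S \<in> sets borel"
    using measurable_sets[OF measurable_ext_chart_inv[OF assms(1)] assms(2)] by simp
  moreover have "snd c ` S = chart_range c \<inter> ext_chart_inv c -` S"
    unfolding image_chart_preimage[OF assms(1,3)] by (auto simp: ext_chart_inv_def)
  ultimately show ?thesis using open_chart_range[OF assms(1)] by auto
qed

lemma sets_chart_measure [simp]: "sets (chart_measure c) = sets borel"
  by (simp add: chart_measure_def)

lemma emeasure_chart_measure:
  assumes "c \<in> A" "S \<in> sets borel" "S \<subseteq> fst c"
  shows "emeasure (chart_measure c) S = (\<integral>\<^sup>+y\<in>snd c ` S. ennreal (vol_density c y) \<partial>lborel)"
proof -
  have m: "ext_chart_inv c -` S \<in> sets borel"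
    using measurable_sets[OF measurable_ext_chart_inv[OF assms(1)] assms(2)] by simp
  have "emeasure (chart_measure c) S =
      emeasure (density lborel (\<lambda>y. ennreal (ext_density c y))) (ext_chart_inv c -` S)"
    unfolding chart_measure_def
    using emeasure_distr[of "ext_chart_inv c" "density lborel (\<lambda>y. ennreal (ext_density c y))" borel S]
      measurable_ext_chart_inv[OF assms(1)] assms(2) by simp
  also have "\<dots> = (\<integral>\<^sup>+y\<in>ext_chart_inv c -` S. ennreal (ext_density c y) \<partial>lborel)"
    using measurable_ext_density[OF assms(1)] m by (intro emeasure_density) auto
  also have "\<dots> = (\<integral>\<^sup>+y\<in>snd c ` S. ennreal (vol_density c y) \<partial>lborel)"
    unfolding image_chart_preimage[OF assms(1,3)]
    by (intro nn_integral_cong) (auto simp: ext_density_def ext_chart_inv_def indicator_def)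
  finally show ?thesis .
qed

lemma chart_measure_agree:
  assumes c: "c \<in> A" "c' \<in> A" and S: "S \<in> sets borel" "S \<subseteq> fst c" "S \<subseteq> fst c'"
  shows "emeasure (chart_measure c) S = emeasure (chart_measure c') S"
proof -
  let ?T = "transition c c'" and ?U = "snd c ` S"
  have U: "?U \<in> sets borel" by (rule sets_image_chart[OF c(1) S(1,2)])
  have sub: "?U \<subseteq> overlap c c'" using S c(1) by (auto simp: overlap_eq)
  have inv: "chart_inv c (snd c x) = x" if "x \<in> S" for x using chart_inv_left[OF c(1)] that S by auto
  then have img: "?T ` ?U = snd c' ` S" by (force simp: image_image)
  have inj: "inj_on ?T ?U"
  proof (rule inj_onI)
    fix y z assume "y \<in> ?U" "z \<in> ?U" "?T y = ?T z"
    then show "y = z" using transition_transition[OF c] sub by (metis subsetD)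
  qed
  have der: "(?T has_derivative jac c c' y) (at y within ?U)" if "y \<in> ?U" for y
    using has_derivative_at_withinI[OF transition_derivative[OF c]] sub that by auto
  have eq: "vol_density c y = \<bar>det (matrix (jac c c' y))\<bar> * vol_density c' (?T y)" if "y \<in> ?U" for y
    using vol_density_transition[OF c] sub that by (auto simp: mult.commute)
  have m2: "(\<lambda>y. indicator (?T ` ?U) y * vol_density c' y) \<in> borel_measurable borel"
  proof -
    have "(\<lambda>y. indicator (snd c' ` S) y * ext_density c' y) \<in> borel_measurable borel"
      by (intro borel_measurable_times borel_measurable_indicator measurable_ext_density c
          sets_image_chart S)
    moreover have "snd c' ` S \<subseteq> chart_range c'" using S(3) by (auto simp: chart_range_def)
    ultimately show ?thesis
      unfolding img by (rule_tac iffD1[OF measurable_cong]) (auto simp: indicator_def ext_density_def)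
  qed
  have m1: "(\<lambda>y. indicator ?U y * (\<bar>det (matrix (jac c c' y))\<bar> * vol_density c' (?T y))) \<in> borel_measurable borel"
  proof -
    have "(\<lambda>y. indicator ?U y * ext_density c y) \<in> borel_measurable borel"
      by (intro borel_measurable_times borel_measurable_indicator measurable_ext_density c U)
    moreover have "?U \<subseteq> chart_range c" using S(2) by (auto simp: chart_range_def)
    then have "indicator ?U y * ext_density c y =
        indicator ?U y * (\<bar>det (matrix (jac c c' y))\<bar> * vol_density c' (?T y))" for y
      using eq[of y] by (cases "y \<in> ?U") (auto simp: ext_density_def)
    ultimately show ?thesis by simp
  qed
  have "snd c' ` S \<subseteq> chart_range c'" using S(3) by (auto simp: chart_range_def)
  then have nonneg: "0 \<le> vol_density c' y" if "y \<in> ?T ` ?U" for y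
    using that vol_density_pos[OF c(2), of y] less_imp_le unfolding img by blast
  have "emeasure (chart_measure c) S = (\<integral>\<^sup>+y\<in>?U. ennreal (\<bar>det (matrix (jac c c' y))\<bar> * vol_density c' (?T y)) \<partial>lborel)"
    unfolding emeasure_chart_measure[OF c(1) S(1,2)]
    by (intro nn_integral_cong) (simp add: indicator_def eq)
  also have "\<dots> = (\<integral>\<^sup>+y\<in>?T ` ?U. ennreal (vol_density c' y) \<partial>lborel)"
    by (rule nn_integral_change_of_variables[OF U der inj nonneg m1 m2])
  also have "\<dots> = emeasure (chart_measure c') S"
    unfolding img emeasure_chart_measure[OF c(2) S(1,3)] ..
  finally show ?thesis .
qed

lemma countable_disjoint_chart_cover:
  obtains ch :: "nat \<Rightarrow> ('m, 'n) chart" and B where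
    "\<And>k. ch k \<in> A" "\<And>k. B k \<in> sets borel" "\<And>k. B k \<subseteq> fst (ch k)" "disjoint_family B" "(\<Union>k. B k) = UNIV"
proof -
  obtain F where F: "F \<subseteq> fst ` A" "countable F" "\<Union>F = \<Union>(fst ` A)"
    using Lindelof[of "fst ` A"] open_chart_dom by blast
  have cover: "\<Union>(fst ` A) = UNIV" using atlas by (simp add: oriented_atlas_def)
  then have "F \<noteq> {}" using F(3) by force
  have "from_nat_into F k \<in> fst ` A" for k using from_nat_into[OF \<open>F \<noteq> {}\<close>] F(1) by blast
  then have "\<forall>k. \<exists>c\<in>A. fst c = from_nat_into F k" by (metis imageE)
  then obtain ch where ch: "\<And>k. ch k \<in> A" "\<And>k. fst (ch k) = from_nat_into F k" by metis
  let ?B = "disjointed (\<lambda>k. fst (ch k))"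
  have "(\<Union>k. fst (ch k)) = UNIV"
    using range_from_nat_into[OF \<open>F \<noteq> {}\<close> F(2)] F(3) cover ch(2) by simp
  moreover have "fst (ch k) \<in> sets borel" for k using open_chart_dom[OF ch(1)] by simp
  then have "?B k \<in> sets borel" for k unfolding disjointed_def by (intro sets.Diff sets.finite_UN) auto
  moreover have "?B k \<subseteq> fst (ch k)" for k by (auto simp: disjointed_def)
  ultimately show ?thesis
    using that[of ch ?B] ch(1) disjoint_family_disjointed[of "\<lambda>k. fst (ch k)"]
    by (simp add: UN_disjointed_eq)
qed

text \<open>The chart measures agree on overlaps, so they glue along a countable partition into Borel
  sets that are contained in chart domains.\<close>

lemma riem_vol_exists_unique:
  "\<exists>!\<mu>. sets \<mu> = sets borel \<and>
     (\<forall>c\<in>A. \<forall>S\<in>sets borel. S \<subseteq> fst c \<longrightarrow> emeasure \<mu> S = emeasure (chart_measure c) S)"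
proof -
  obtain ch B where ch: "\<And>k. ch k \<in> A" and B: "\<And>k :: nat. B k \<in> sets borel" "\<And>k. B k \<subseteq> fst (ch k)"
    "disjoint_family B" "(\<Union>k. B k) = (UNIV :: 'm set)"
    using countable_disjoint_chart_cover by blast
  have split: "emeasure M S = (\<Sum>k. emeasure M (S \<inter> B k))" if "sets M = sets borel" "S \<in> sets borel" for M S
  proof -
    have "(\<Sum>k. emeasure M (S \<inter> B k)) = emeasure M (\<Union>k. S \<inter> B k)"
    proof (rule suminf_emeasure)
      show "range (\<lambda>k. S \<inter> B k) \<subseteq> sets M" using that B(1) by auto
      show "disjoint_family (\<lambda>k. S \<inter> B k)" using B(3) unfolding disjoint_family_on_def by blast
    qed
    also have "(\<Union>k. S \<inter> B k) = S" using B(4) by blast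
    finally show ?thesis by simp
  qed
  show ?thesis
  proof (rule ex_ex1I)
    let ?e = "\<lambda>S k. emeasure (chart_measure (ch k)) (S \<inter> B k)"
    let ?m = "\<lambda>S. \<Sum>k. ?e S k"
    let ?M = "measure_of (UNIV :: 'm set) (sets borel) ?m"
    have "countably_additive (sets borel) ?m"
    proof (rule countably_additiveI)
      fix F :: "nat \<Rightarrow> 'm set"
      assume F: "range F \<subseteq> sets borel" "disjoint_family F"
      have "(\<Sum>i. ?m (F i)) = (\<Sum>i. \<integral>\<^sup>+k. ?e (F i) k \<partial>count_space UNIV)"
        by (simp add: nn_integral_count_space_nat)
      also have "\<dots> = (\<integral>\<^sup>+k. (\<Sum>i. ?e (F i) k) \<partial>count_space UNIV)"
        by (rule nn_integral_suminf[symmetric]) simp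
      also have "\<dots> = (\<integral>\<^sup>+k. ?e (\<Union>i. F i) k \<partial>count_space UNIV)"
      proof (intro nn_integral_cong)
        fix k
        have "(\<Sum>i. ?e (F i) k) = emeasure (chart_measure (ch k)) (\<Union>i. F i \<inter> B k)"
        proof (rule suminf_emeasure)
          show "range (\<lambda>i. F i \<inter> B k) \<subseteq> sets (chart_measure (ch k))" using F(1) B(1) by auto
          show "disjoint_family (\<lambda>i. F i \<inter> B k)" using F(2) unfolding disjoint_family_on_def by blast
        qed
        then show "(\<Sum>i. ?e (F i) k) = ?e (\<Union>i. F i) k" by (simp only: Int_UN_distrib2 UN_simps)
      qed
      finally show "(\<Sum>i. ?m (F i)) = ?m (\<Union>i. F i)" by (simp add: nn_integral_count_space_nat)
    qed
    moreover have "sigma_algebra (UNIV :: 'm set) (sets borel)"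
      using sets.sigma_algebra_axioms[of "borel :: 'm measure"] by simp
    ultimately have em: "emeasure ?M S = ?m S" if "S \<in> sets borel" for S
      using that by (intro emeasure_measure_of_sigma) (auto simp: positive_def)
    have sets: "sets ?M = sets borel"
      using sets.sets_measure_of_eq[of "borel :: 'm measure"] by simp
    have "emeasure ?M S = emeasure (chart_measure c) S" if "c \<in> A" "S \<in> sets borel" "S \<subseteq> fst c" for c S
    proof -
      have "?e S k = emeasure (chart_measure c) (S \<inter> B k)" for k
        using that B(1,2)[of k] ch by (intro chart_measure_agree) auto
      then show ?thesis using em[OF that(2)] split[OF sets_chart_measure that(2), of c] by simp
    qed
    then show "\<exists>\<mu>. sets \<mu> = sets borel \<and>
       (\<forall>c\<in>A. \<forall>S\<in>sets borel. S \<subseteq> fst c \<longrightarrow> emeasure \<mu> S = emeasure (chart_measure c) S)"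
      using sets by blast
  next
    fix \<mu> \<nu> :: "'m measure"
    assume \<mu>: "sets \<mu> = sets borel \<and>
       (\<forall>c\<in>A. \<forall>S\<in>sets borel. S \<subseteq> fst c \<longrightarrow> emeasure \<mu> S = emeasure (chart_measure c) S)"
      and \<nu>: "sets \<nu> = sets borel \<and>
       (\<forall>c\<in>A. \<forall>S\<in>sets borel. S \<subseteq> fst c \<longrightarrow> emeasure \<nu> S = emeasure (chart_measure c) S)"
    show "\<mu> = \<nu>"
    proof (rule measure_eqI)
      fix S assume "S \<in> sets \<mu>"
      then have S: "S \<in> sets borel" using \<mu> by simp
      have "emeasure \<mu> (S \<inter> B k) = emeasure \<nu> (S \<inter> B k)" for k
      proof -
        have "S \<inter> B k \<in> sets borel" "S \<inter> B k \<subseteq> fst (ch k)" using S B by auto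
        then show ?thesis using \<mu> \<nu> ch[of k] by metis
      qed
      then show "emeasure \<mu> S = emeasure \<nu> S"
        using split[of \<mu>] split[of \<nu>] \<mu> \<nu> S by simp
    qed (use \<mu> \<nu> in simp)
  qed
qed

lemma riem_vol_chart_measure:
  "sets (riem_vol A g) = sets borel"
  "c \<in> A \<Longrightarrow> S \<in> sets borel \<Longrightarrow> S \<subseteq> fst c \<Longrightarrow> emeasure (riem_vol A g) S = emeasure (chart_measure c) S"
proof -
  let ?P = "\<lambda>\<mu>. sets \<mu> = sets borel \<and>
     (\<forall>c\<in>A. \<forall>S\<in>sets borel. S \<subseteq> fst c \<longrightarrow> emeasure \<mu> S = emeasure (chart_measure c) S)"
  have "emeasure (chart_measure c) S =
      (\<integral>\<^sup>+y\<in>snd c ` S. ennreal (sqrt (det (gram (loc_metric A c g y)))) \<partial>lborel)"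
    if "c \<in> A" "S \<in> sets borel" "S \<subseteq> fst c" for c S
    using emeasure_chart_measure[OF that] by (simp only: vol_density_def loc_gram_def)
  then have "riem_vol A g = (THE \<mu>. ?P \<mu>)"
    unfolding riem_vol_def by (intro arg_cong[of _ _ The] ext) auto
  then have "?P (riem_vol A g)" using theI'[OF riem_vol_exists_unique] by simp
  then show "sets (riem_vol A g) = sets borel"
    "c \<in> A \<Longrightarrow> S \<in> sets borel \<Longrightarrow> S \<subseteq> fst c \<Longrightarrow> emeasure (riem_vol A g) S = emeasure (chart_measure c) S"
    by blast+
qed

text \<open>As an equation between measures, this makes the whole theory of integrals under densities and image
  measures applicable to the Riemannian measure.\<close>

lemma density_riem_vol_chart:
  assumes "c \<in> A"
  shows "density (riem_vol A g) (indicator (fst c)) = density (chart_measure c) (indicator (fst c))"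
proof (rule measure_eqI)
  have D: "fst c \<in> sets borel" using open_chart_dom[OF assms] by simp
  fix S assume "S \<in> sets (density (riem_vol A g) (indicator (fst c)))"
  then have S: "S \<in> sets borel" by (simp add: riem_vol_chart_measure(1))
  have "emeasure (density M (indicator (fst c))) S = emeasure M (S \<inter> fst c)" if "sets M = sets borel" for M
  proof -
    have "emeasure (density M (indicator (fst c))) S = (\<integral>\<^sup>+x. indicator (fst c) x * indicator S x \<partial>M)"
      using D S that by (intro emeasure_density) auto
    also have "\<dots> = (\<integral>\<^sup>+x. indicator (S \<inter> fst c) x \<partial>M)"
      by (intro nn_integral_cong) (auto simp: indicator_def)
    also have "\<dots> = emeasure M (S \<inter> fst c)" using D S that by (intro nn_integral_indicator) auto
    finally show ?thesis .
  qed
  then show "emeasure (density (riem_vol A g) (indicator (fst c))) S =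
      emeasure (density (chart_measure c) (indicator (fst c))) S"
    using riem_vol_chart_measure(2)[OF assms, of "S \<inter> fst c"] riem_vol_chart_measure(1) D S by simp
qed (simp add: riem_vol_chart_measure(1))

definition pull_integrand :: "('m, 'n) chart \<Rightarrow> ('m \<Rightarrow> 'b::real_normed_vector) \<Rightarrow> real^'n \<Rightarrow> 'b" where
  "pull_integrand c f y = (if y \<in> chart_range c then vol_density c y *\<^sub>R f (chart_inv c y) else 0)"

text \<open>The function is continuous on the whole manifold, being \<open>0\<close> on the open complement of \<open>K\<close>, so it
  is measurable; its pullback is continuous on the compact image of \<open>K\<close>, so it is integrable.\<close>

lemma integral_riem_vol_chart:
  fixes f :: "'m \<Rightarrow> 'b::{banach, second_countable_topology}"
  assumes c: "c \<in> A" and K: "compact K" "K \<subseteq> W" and W: "open W" "W \<subseteq> fst c"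
    and f: "continuous_on W f" "\<And>x. x \<notin> K \<Longrightarrow> f x = 0"
  shows "integrable (riem_vol A g) f" "integrable lborel (pull_integrand c f)"
    "integral\<^sup>L (riem_vol A g) f = integral\<^sup>L lborel (pull_integrand c f)"
proof -
  have "closed K" by (rule compact_imp_closed[OF K(1)])
  have "continuous_on (- K) f" using continuous_on_cong[of "-K" "-K" f "\<lambda>_. 0"] f(2) by simp
  then have "continuous_on (W \<union> - K) f"
    using f(1) W(1) \<open>closed K\<close> by (intro continuous_on_open_Un) auto
  moreover have "W \<union> - K = UNIV" using K(2) by blast
  ultimately have cont: "continuous_on UNIV f" by simp
  then have fm: "f \<in> borel_measurable borel" by (rule borel_measurable_continuous_onI)
  let ?K = "snd c ` K"
  have Kc: "K \<subseteq> fst c" using K W by blast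
  have K': "compact ?K"
    by (rule compact_continuous_image[OF continuous_on_subset[OF continuous_on_chart[OF c] Kc] K(1)])
  have KR: "?K \<subseteq> chart_range c" using Kc by (auto simp: chart_range_def)
  have "continuous_on ?K (\<lambda>y. vol_density c y *\<^sub>R f (chart_inv c y))"
    by (intro continuous_on_scaleR continuous_on_subset[OF smooth_on_continuous[OF smooth_on_vol_density[OF c]] KR]
        continuous_on_compose2[OF cont continuous_on_subset[OF continuous_on_chart_inv[OF c] KR]]) simp
  from borel_integrable_compact[OF K' this]
  have "integrable lborel (\<lambda>y. indicator ?K y *\<^sub>R (vol_density c y *\<^sub>R f (chart_inv c y)))" .
  moreover have "indicator ?K y *\<^sub>R (vol_density c y *\<^sub>R f (chart_inv c y)) = pull_integrand c f y" for y
    using image_chart_preimage[OF c Kc] f(2)[of "chart_inv c y"]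
    by (auto simp: pull_integrand_def indicator_def)
  ultimately show int: "integrable lborel (pull_integrand c f)" by simp
  have ind: "(\<lambda>x. indicator (fst c) x :: real) \<in> borel_measurable M" if "sets M = sets borel" for M
    using open_chart_dom[OF c] that by (intro borel_measurable_indicator) auto
  have fM: "f \<in> borel_measurable M" if "sets M = sets borel" for M
    using fm that measurable_cong_sets[of M borel] by blast
  have f_ind: "(\<lambda>x. indicator (fst c) x *\<^sub>R f x) = f"
    using f(2) Kc by (auto simp: indicator_def fun_eq_iff)
  have dens: "density (riem_vol A g) (\<lambda>x. ennreal (indicator (fst c) x)) =
      density (chart_measure c) (\<lambda>x. ennreal (indicator (fst c) x))"
    using density_riem_vol_chart[OF c] by (simp add: ennreal_indicator)
  note vs = riem_vol_chart_measure(1) and cs = sets_chart_measure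
  have pull: "ext_density c y *\<^sub>R f (ext_chart_inv c y) = pull_integrand c f y" for y
    by (simp add: pull_integrand_def ext_density_def ext_chart_inv_def)
  have em: "ext_density c \<in> borel_measurable lborel" using measurable_ext_density[OF c] by simp
  have pm: "ext_chart_inv c \<in> borel_measurable (density lborel (\<lambda>y. ennreal (ext_density c y)))"
    using measurable_ext_chart_inv[OF c] by simp
  have fpm: "(\<lambda>y. f (ext_chart_inv c y)) \<in> borel_measurable lborel"
    using measurable_compose[OF measurable_ext_chart_inv[OF c] fm] by simp
  have "integrable (chart_measure c) f \<longleftrightarrow> integrable lborel (pull_integrand c f)"
    unfolding chart_measure_def integrable_distr_eq[OF pm fm]
    using integrable_density[OF fpm em] ext_density_nonneg[OF c] by (simp add: pull)
  then have "integrable (chart_measure c) f" using int by simp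
  then show "integrable (riem_vol A g) f"
    using integrable_density[OF fM[OF vs] ind[OF vs]] integrable_density[OF fM[OF cs] ind[OF cs]]
    by (simp add: f_ind dens)
  have "integral\<^sup>L (riem_vol A g) f = integral\<^sup>L (chart_measure c) f"
    using integral_density[OF fM[OF vs] ind[OF vs]] integral_density[OF fM[OF cs] ind[OF cs]]
    by (simp add: f_ind dens)
  also have "\<dots> = integral\<^sup>L lborel (pull_integrand c f)"
    unfolding chart_measure_def integral_distr[OF pm fm]
    using integral_density[OF fpm em] ext_density_nonneg[OF c] by (simp add: pull)
  finally show "integral\<^sup>L (riem_vol A g) f = integral\<^sup>L lborel (pull_integrand c f)" .
qed

end

section \<open>Bump functions\<close>

text \<open>The functions \<open>q(1/t) exp(-1/t)\<close>, continued by \<open>0\<close> to the left of the origin, are closed under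
  differentiation because the exponential dominates every polynomial.\<close>

definition flat_poly :: "real poly \<Rightarrow> real \<Rightarrow> real" where
  "flat_poly q t = (if t > 0 then poly q (inverse t) * exp (- inverse t) else 0)"

lemma poly_exp_tendsto_0: "((\<lambda>x. poly q x * exp (- x)) \<longlongrightarrow> (0::real)) at_top"
proof -
  have "((\<lambda>x::real. \<Sum>i\<le>degree q. coeff q i * (x ^ i / exp x)) \<longlongrightarrow> (\<Sum>i\<le>degree q. coeff q i * 0)) at_top"
    by (intro tendsto_sum tendsto_mult tendsto_const tendsto_power_div_exp_0)
  then show ?thesis
    by (simp add: poly_altdef sum_distrib_right exp_minus divide_inverse mult.assoc)
qed

lemma flat_poly_tendsto_0: "((\<lambda>t. poly q (inverse t) * exp (- inverse t)) \<longlongrightarrow> (0::real)) (at_right 0)"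
  by (rule filterlim_compose[OF poly_exp_tendsto_0 filterlim_inverse_at_top_right])

lemma flat_poly_derivative:
  "(flat_poly q has_real_derivative flat_poly ([:0, 0, 1:] * (q - pderiv q)) t) (at t)"
proof -
  let ?q' = "[:0, 0, 1:] * (q - pderiv q)"
  consider "t > 0" | "t < 0" | "t = 0" by linarith
  then show ?thesis
  proof cases
    case 1
    have "((\<lambda>t. poly q (inverse t) * exp (- inverse t)) has_real_derivative
        poly q (inverse t) * (exp (- inverse t) * (inverse t * inverse t)) +
        (poly (pderiv q) (inverse t) * - (inverse t * inverse t)) * exp (- inverse t)) (at t)"
      using 1 by (auto intro!: derivative_eq_intros DERIV_chain2[OF poly_DERIV] simp: power2_eq_square divide_inverse)
    then have "((\<lambda>t. poly q (inverse t) * exp (- inverse t)) has_real_derivative flat_poly ?q' t) (at t)"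
      by (rule DERIV_cong) (use 1 in \<open>simp add: flat_poly_def algebra_simps\<close>)
    then show ?thesis
      by (rule has_field_derivative_transform_within_open[of _ _ _ "{0<..}"]) (use 1 in \<open>auto simp: flat_poly_def\<close>)
  next
    case 2
    have "((\<lambda>t. 0) has_real_derivative flat_poly ?q' t) (at t)" using 2 by (simp add: flat_poly_def)
    then show ?thesis
      by (rule has_field_derivative_transform_within_open[of _ _ _ "{..<0}"]) (use 2 in \<open>auto simp: flat_poly_def\<close>)
  next
    case 3
    have "((\<lambda>h. flat_poly q h / h) \<longlongrightarrow> 0) (at_right 0)"
    proof (rule Lim_transform_eventually[OF flat_poly_tendsto_0[of "[:0, 1:] * q"]])
      show "\<forall>\<^sub>F h in at_right 0. poly ([:0, 1:] * q) (inverse h) * exp (- inverse h) = flat_poly q h / h"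
        by (auto simp: eventually_at_filter flat_poly_def divide_inverse)
    qed
    moreover have "((\<lambda>h. flat_poly q h / h) \<longlongrightarrow> 0) (at_left 0)"
      by (rule Lim_transform_eventually[OF tendsto_const]) (auto simp: eventually_at_filter flat_poly_def)
    ultimately have "((\<lambda>h. flat_poly q h / h) \<longlongrightarrow> 0) (at 0)" by (rule filterlim_split_at[rotated])
    then show ?thesis unfolding 3 by (simp add: DERIV_def flat_poly_def)
  qed
qed

definition flat :: "real \<Rightarrow> real" where "flat = flat_poly 1"

lemma flat_pos: "t > 0 \<Longrightarrow> flat t > 0" and flat_zero: "t \<le> 0 \<Longrightarrow> flat t = 0" and flat_nonneg: "flat t \<ge> 0"
  by (simp_all add: flat_def flat_poly_def)

lemma smooth_on_flat:
  assumes "open S" "smooth_on S f"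
  shows "smooth_on S (\<lambda>y. flat (f y))"
  unfolding smooth_on_def
proof
  fix k
  have "\<exists>h'\<in>range flat_poly. \<forall>t\<in>UNIV. (h has_real_derivative h' t) (at t)" if "h \<in> range flat_poly" for h
  proof -
    from that obtain q where "h = flat_poly q" by (rule rangeE)
    then show ?thesis
      by (intro bexI[of _ "flat_poly ([:0, 0, 1:] * (q - pderiv q))"]) (simp_all only: flat_poly_derivative ball_UNIV, auto)
  qed
  then show "Ck_on k S (\<lambda>y. flat (f y))"
    by (rule Ck_on_scalar_compose[OF _ assms(1)]) (use assms(2) in \<open>auto simp: smooth_on_def flat_def\<close>)
qed

text \<open>A quotient \<open>u / (u + w)\<close>, where \<open>u\<close> is positive exactly inside the ball of radius \<open>r\<close> and \<open>w\<close> exactly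
  outside the closed ball of radius \<open>r/2\<close>; their sum vanishes nowhere.\<close>

lemma smooth_bump:
  fixes y0 :: "real^'n::finite"
  assumes "r > 0"
  shows "\<exists>b :: real^'n \<Rightarrow> real. smooth_on UNIV b \<and> (\<forall>y. 0 \<le> b y) \<and>
    (\<forall>y\<in>cball y0 (r / 2). b y = 1) \<and> (\<forall>y. y \<notin> ball y0 r \<longrightarrow> b y = 0)"
proof -
  define s where "s y = (y - y0) \<bullet> (y - y0)" for y
  define u where "u y = flat (r\<^sup>2 - s y)" for y
  define w where "w y = flat (s y - (r / 2)\<^sup>2)" for y
  have s: "s y = (dist y0 y)\<^sup>2" for y
    by (simp only: s_def power2_norm_eq_inner[symmetric] dist_norm norm_minus_commute)
  have lin: "smooth_on UNIV (\<lambda>y. y - y0)"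
    by (intro smooth_on_diff open_UNIV smooth_on_const smooth_on_linear_map bounded_linear_ident)
  have sm: "smooth_on UNIV s"
    unfolding s_def[abs_def] smooth_on_def
    using lin Ck_on_bilinear[OF bounded_bilinear_inner open_UNIV] by (auto simp: smooth_on_def)
  have su: "smooth_on UNIV u" and sw: "smooth_on UNIV w"
    unfolding u_def[abs_def] w_def[abs_def]
    by (intro smooth_on_flat smooth_on_diff open_UNIV smooth_on_const sm)+
  have pos: "u y + w y > 0" for y
  proof (cases "s y < r\<^sup>2")
    case True
    then show ?thesis using flat_pos[of "r\<^sup>2 - s y"] flat_nonneg[of "s y - (r / 2)\<^sup>2"] by (simp add: u_def w_def)
  next
    case False
    moreover have "(r / 2)\<^sup>2 < r\<^sup>2" using assms by (intro power_strict_mono) auto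
    ultimately show ?thesis
      using flat_pos[of "s y - (r / 2)\<^sup>2"] flat_nonneg[of "r\<^sup>2 - s y"] by (simp add: u_def w_def)
  qed
  show ?thesis
  proof (intro exI[of _ "\<lambda>y. u y * inverse (u y + w y)"] conjI allI ballI impI)
    show "smooth_on UNIV (\<lambda>y. u y * inverse (u y + w y))"
    proof (intro smooth_on_mult smooth_on_inverse smooth_on_add open_UNIV su sw)
      show "u y + w y \<noteq> 0" for y using pos[of y] by simp
    qed
    show "0 \<le> u y * inverse (u y + w y)" for y
      using pos[of y] by (simp add: u_def flat_nonneg)
    show "u y * inverse (u y + w y) = 1" if "y \<in> cball y0 (r / 2)" for y
    proof -
      have "s y \<le> (r / 2)\<^sup>2" unfolding s using that assms by (intro power_mono) auto
      then have "w y = 0" by (simp add: w_def flat_zero)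
      then show ?thesis using pos[of y] by simp
    qed
    show "u y * inverse (u y + w y) = 0" if "y \<notin> ball y0 r" for y
    proof -
      have "r\<^sup>2 \<le> s y" unfolding s using that assms by (intro power_mono) auto
      then show ?thesis by (simp add: u_def flat_zero)
    qed
  qed
qed


section \<open>Integration by parts\<close>

text \<open>The difference quotients of a compactly supported function integrate to \<open>0\<close> by translation
  invariance, and converge dominatedly to the directional derivative.\<close>

lemma integral_dirderiv_compact_support:
  fixes h :: "real^'n::finite \<Rightarrow> complex"
  assumes h: "smooth_on UNIV h" and K: "compact K" and zero: "\<And>y. y \<notin> K \<Longrightarrow> h y = 0"
  shows "integrable lborel (\<lambda>y. dirderiv h y v)" "(\<integral>y. dirderiv h y v \<partial>lborel) = 0"
proof -
  let ?D = "\<lambda>y. dirderiv h y v"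
  have cont: "continuous_on UNIV h" "continuous_on UNIV ?D"
    using smooth_on_continuous[OF h] smooth_on_continuous[OF smooth_on_dirderiv[OF h]] by auto
  have Dzero: "?D y = 0" if "y \<notin> K" for y
    using frechet_derivative_cong_open[of "- K" y h "\<lambda>_. 0"] open_Compl[OF compact_imp_closed[OF K]]
      that zero by simp
  have int_compact: "integrable lborel f" if "continuous_on UNIV f" "\<And>y. y \<notin> K \<Longrightarrow> f y = 0"
    for f :: "real^'n \<Rightarrow> complex"
  proof -
    have "integrable lborel (\<lambda>y. indicator K y *\<^sub>R f y)"
      by (rule borel_integrable_compact[OF K continuous_on_subset[OF that(1)]]) simp
    moreover have "(\<lambda>y. indicator K y *\<^sub>R f y) = f" using that(2) by (auto simp: indicator_def fun_eq_iff)
    ultimately show ?thesis by simp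
  qed
  show intD: "integrable lborel ?D" by (rule int_compact[OF cont(2) Dzero])
  have inth: "integrable lborel h" by (rule int_compact[OF cont(1) zero])
  have "compact (?D ` K)" by (rule compact_continuous_image[OF continuous_on_subset[OF cont(2)] K]) simp
  then have "bounded (?D ` K)" by (rule compact_imp_bounded)
  then obtain C0 where C0: "\<And>y. y \<in> K \<Longrightarrow> norm (?D y) \<le> C0"
    unfolding bounded_iff by blast
  define C where "C = max C0 0"
  have C: "norm (?D y) \<le> C" "C \<ge> 0" for y using C0[of y] Dzero[of y] by (cases "y \<in> K") (auto simp: C_def)
  obtain B0 where B0: "\<And>y. y \<in> K \<Longrightarrow> norm y \<le> B0" using compact_imp_bounded[OF K] unfolding bounded_iff by blast
  \<comment> \<open>The difference quotients with step at most \<open>1\<close> vanish outside the ball of radius \<open>B\<close>.\<close>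
  define B where "B = max B0 0 + norm v"
  define t where "t n = inverse (real (Suc n))" for n
  have t: "0 < t n" "t n \<le> 1" for n by (simp_all add: t_def inverse_le_1_iff)
  define q where "q n y = (1 / t n) *\<^sub>R (h (y + t n *\<^sub>R v) - h y)" for n y
  have curve: "((\<lambda>s. h (y + s *\<^sub>R v)) has_derivative (\<lambda>a. a *\<^sub>R ?D (y + s *\<^sub>R v))) (at s)" for y s
  proof -
    note D = smooth_on_has_derivative[OF h UNIV_I]
    have "((\<lambda>s. h (y + s *\<^sub>R v)) has_derivative (\<lambda>a. dirderiv h (y + s *\<^sub>R v) (a *\<^sub>R v))) (at s)"
      by (rule has_derivative_compose[of "\<lambda>s. y + s *\<^sub>R v" "\<lambda>a. a *\<^sub>R v", OF _ D])
        (auto intro!: derivative_eq_intros)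
    then show ?thesis by (simp only: linear_scale[OF has_derivative_linear[OF D]])
  qed
  have bound: "norm (q n y) \<le> C" for n y
  proof -
    have "norm (h (y + t n *\<^sub>R v) - h (y + 0 *\<^sub>R v)) \<le> C * norm (t n - 0)"
    proof (rule differentiable_bound[of "{0..t n}" "\<lambda>s. h (y + s *\<^sub>R v)" "\<lambda>s a. a *\<^sub>R ?D (y + s *\<^sub>R v)"])
      show "((\<lambda>s. h (y + s *\<^sub>R v)) has_derivative (\<lambda>a. a *\<^sub>R ?D (y + s *\<^sub>R v))) (at s within {0..t n})" for s
        by (rule has_derivative_at_withinI[OF curve])
      show "onorm (\<lambda>a. a *\<^sub>R ?D (y + s *\<^sub>R v)) \<le> C" for s
      proof (rule onorm_le)
        show "norm (a *\<^sub>R ?D (y + s *\<^sub>R v)) \<le> C * norm a" for a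
          using mult_right_mono[OF C(1)[of "y + s *\<^sub>R v"], of "\<bar>a\<bar>"] by (simp add: mult.commute)
      qed
    qed (use t[of n] in auto)
    moreover have "norm (q n y) = norm (h (y + t n *\<^sub>R v) - h y) / t n"
      unfolding q_def norm_scaleR using t(1)[of n] by simp
    ultimately show ?thesis using t(1)[of n] by (simp add: pos_divide_le_eq)
  qed
  have supp: "q n y = 0" if "y \<notin> cball 0 B" for n y
  proof -
    have "norm (t n *\<^sub>R v) \<le> norm v" using t[of n] by (simp add: mult_left_le_one_le)
    moreover have "norm y \<le> norm (y + t n *\<^sub>R v) + norm (t n *\<^sub>R v)"
      using norm_triangle_ineq4[of "y + t n *\<^sub>R v" "t n *\<^sub>R v"] by simp
    moreover have "norm y > B0 + norm v" using that by (simp add: B_def)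
    ultimately have "norm (y + t n *\<^sub>R v) > B0" "norm y > B0"
      using norm_ge_zero[of v] by linarith+
    then have "y + t n *\<^sub>R v \<notin> K" "y \<notin> K" using B0 by force+
    then show ?thesis by (simp add: q_def zero)
  qed
  have hb: "h \<in> borel_measurable borel" by (rule borel_measurable_continuous_onI[OF cont(1)])
  have shift: "integrable lborel (\<lambda>y. h (y + a))" "(\<integral>y. h (y + a) \<partial>lborel) = (\<integral>y. h y \<partial>lborel)" for a
  proof -
    have m: "(+) a \<in> lborel \<rightarrow>\<^sub>M borel" by simp
    show "integrable lborel (\<lambda>y. h (y + a))" "(\<integral>y. h (y + a) \<partial>lborel) = (\<integral>y. h y \<partial>lborel)"
      using integrable_distr_eq[OF m hb] integral_distr[OF m hb] inth
      by (simp_all add: lborel_distr_plus add.commute)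
  qed
  have q0: "(\<integral>y. q n y \<partial>lborel) = 0" for n
    using shift inth by (simp add: q_def)
  have "(\<lambda>n. \<integral>y. q n y \<partial>lborel) \<longlonglongrightarrow> (\<integral>y. ?D y \<partial>lborel)"
  proof (rule integral_dominated_convergence[where w="\<lambda>y. indicator (cball 0 B) y *\<^sub>R C"])
    show "integrable lborel (\<lambda>y. indicator (cball 0 B) y *\<^sub>R C)"
      by (rule borel_integrable_compact) (auto intro: continuous_on_const)
    show "?D \<in> borel_measurable lborel" using intD by (rule borel_measurable_integrable)
    show "q n \<in> borel_measurable lborel" for n
      unfolding q_def[abs_def] using shift(1)[of "t n *\<^sub>R v"] inth by (intro borel_measurable_integrable) auto
    show "AE y in lborel. norm (q n y) \<le> indicator (cball 0 B) y *\<^sub>R C" for n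
      by (rule AE_I2) (use bound[of n] supp[of _ n] in \<open>auto simp: indicator_def\<close>)
    show "AE y in lborel. (\<lambda>n. q n y) \<longlonglongrightarrow> ?D y"
    proof (rule AE_I2)
      fix y
      have L: "(\<lambda>s. norm (h (y + s *\<^sub>R v) - h y - s *\<^sub>R ?D y) / norm s) \<midarrow>0\<rightarrow> 0"
        using curve[of y 0] by (simp add: has_derivative_at)
      have E: "norm (h (y + s *\<^sub>R v) - h y - s *\<^sub>R ?D y) / norm s =
          norm ((1 / s) *\<^sub>R (h (y + s *\<^sub>R v) - h y) - ?D y)" if "s \<noteq> 0" for s
      proof -
        have "(1 / s) *\<^sub>R (h (y + s *\<^sub>R v) - h y) - ?D y = (1 / s) *\<^sub>R (h (y + s *\<^sub>R v) - h y - s *\<^sub>R ?D y)"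
          using that by (simp add: scaleR_diff_right)
        then show ?thesis by simp
      qed
      have "(\<lambda>s. norm ((1 / s) *\<^sub>R (h (y + s *\<^sub>R v) - h y) - ?D y)) \<midarrow>0\<rightarrow> 0"
        by (rule Lim_transform_eventually[OF L]) (unfold eventually_at_filter, intro always_eventually allI impI, rule E)
      then have "((\<lambda>s. (1 / s) *\<^sub>R (h (y + s *\<^sub>R v) - h y)) \<longlongrightarrow> ?D y) (at 0)"
        by (rule LIM_zero_cancel[OF tendsto_norm_zero_cancel])
      moreover have "filterlim t (at 0) sequentially"
        unfolding t_def[abs_def] filterlim_at using LIMSEQ_inverse_real_of_nat by auto
      ultimately show "(\<lambda>n. q n y) \<longlonglongrightarrow> ?D y"
        unfolding q_def by (rule filterlim_compose)
    qed
  qed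
  then show "(\<integral>y. ?D y \<partial>lborel) = 0" using q0 by (simp add: LIMSEQ_const_iff)
qed

lemma integral_dirderiv_compact_support_open:
  fixes h :: "real^'n::finite \<Rightarrow> complex"
  assumes R: "open R" and h: "smooth_on R h" and K: "compact K" "K \<subseteq> R"
    and zero: "\<And>y. y \<in> R \<Longrightarrow> y \<notin> K \<Longrightarrow> h y = 0"
  shows "integrable lborel (\<lambda>y. if y \<in> R then dirderiv h y v else 0)"
    "(\<integral>y. (if y \<in> R then dirderiv h y v else 0) \<partial>lborel) = 0"
proof -
  let ?h = "\<lambda>y. if y \<in> R then h y else 0"
  have cK: "open (- K)" by (rule open_Compl[OF compact_imp_closed[OF K(1)]])
  have s: "smooth_on UNIV ?h"
  proof (rule smooth_on_local)
    fix y
    show "\<exists>U. open U \<and> y \<in> U \<and> smooth_on U ?h"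
    proof (cases "y \<in> R")
      case True
      then show ?thesis using R smooth_on_cong[OF R h, of ?h] by auto
    next
      case False
      then show ?thesis using K(2) cK smooth_on_cong[OF cK smooth_on_const[of "-K" 0], of ?h] zero
        by (intro exI[of _ "- K"]) auto
    qed
  qed
  have "dirderiv ?h y v = (if y \<in> R then dirderiv h y v else 0)" for y
  proof (cases "y \<in> R")
    case True
    then show ?thesis using frechet_derivative_cong_open[OF R True, of ?h h] by simp
  next
    case False
    then have "frechet_derivative ?h (at y) = frechet_derivative (\<lambda>_. 0) (at y)"
      using K(2) zero by (intro frechet_derivative_cong_open[OF cK]) auto
    then show ?thesis using False by simp
  qed
  then show "integrable lborel (\<lambda>y. if y \<in> R then dirderiv h y v else 0)"
    "(\<integral>y. (if y \<in> R then dirderiv h y v else 0) \<partial>lborel) = 0"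
    using integral_dirderiv_compact_support[OF s K(1), of v] zero by auto
qed

section \<open>The codifferential in a chart\<close>

context riemannian_manifold
begin

text \<open>These are the components of the form with all indices raised, times the volume density. Their
  divergence in the first slot, with the remaining indices lowered again, is up to sign and density
  the codifferential.\<close>

definition density_form :: "('m, 'n) chart \<Rightarrow> ('m, 'n) form_field \<Rightarrow> real^'n \<Rightarrow> (real^'n) list \<Rightarrow> complex" where
  "density_form c \<omega> y us = of_real (vol_density c y) * loc_form A c \<omega> y (map ((*v) (loc_cogram c y)) us)"

definition loc_div :: "('m, 'n) chart \<Rightarrow> ('m, 'n) form_field \<Rightarrow> real^'n \<Rightarrow> (real^'n) list \<Rightarrow> complex" where
  "loc_div c \<omega> y us = (\<Sum>k\<in>UNIV. dirderiv (\<lambda>z. density_form c \<omega> z (axis k 1 # us)) y (axis k 1))"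

definition loc_codiff :: "('m, 'n) chart \<Rightarrow> ('m, 'n) form_field \<Rightarrow> real^'n \<Rightarrow> (real^'n) list \<Rightarrow> complex" where
  "loc_codiff c \<omega> y vs =
    of_real (- inverse (vol_density c y)) * loc_div c \<omega> y (map ((*v) (loc_gram c y)) vs)"

definition chart_lift :: "('m, 'n) chart \<Rightarrow> (real^'n \<Rightarrow> (real^'n) list \<Rightarrow> complex) \<Rightarrow> ('m, 'n) form_field" where
  "chart_lift c F x vs = F (snd c x) (map (from_ref c x) vs)"

definition codiff_form :: "('m, 'n) form_field \<Rightarrow> ('m, 'n) form_field" where
  "codiff_form \<omega> x = loc_codiff (ref_chart A x) \<omega> (ref_coord x)"

lemma smooth_on_density_form:
  assumes "\<omega> \<in> Omega A p" "c \<in> A"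
  shows "smooth_on (chart_range c) (\<lambda>y. density_form c \<omega> y us)"
  unfolding density_form_def
  by (intro smooth_on_mult smooth_on_of_real open_chart_range[OF assms(2)] smooth_on_vol_density[OF assms(2)]
      smooth_on_raised[OF assms])

lemma alt_form_density_form:
  assumes "\<omega> \<in> Omega A p" "c \<in> A" "y \<in> chart_range c"
  shows "alt_form p (density_form c \<omega> y)"
  unfolding density_form_def[abs_def]
  by (rule alt_form_scale[OF alt_form_compose[OF Omega_alt_loc[OF assms] matrix_vector_mul_linear]])

lemma smooth_on_loc_div:
  assumes "\<omega> \<in> Omega A p" "c \<in> A"
  shows "smooth_on (chart_range c) (\<lambda>y. loc_div c \<omega> y us)"
  unfolding loc_div_def
  by (intro smooth_on_sum smooth_on_dirderiv open_chart_range[OF assms(2)] smooth_on_density_form[OF assms])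

lemma alt_form_loc_div:
  assumes "\<omega> \<in> Omega A (Suc p)" "c \<in> A" "y \<in> chart_range c"
  shows "alt_form p (loc_div c \<omega> y)"
proof -
  have "alt_form p (\<lambda>us. dirderiv (\<lambda>z. density_form c \<omega> z (axis k 1 # us)) y (axis k 1))" for k
    by (rule alt_form_dirderiv[OF open_chart_range[OF assms(2)] assms(3)
          alt_form_tail[OF alt_form_density_form[OF assms(1,2)]] smooth_on_density_form[OF assms(1,2)]])
  then show ?thesis unfolding loc_div_def[abs_def] by (intro alt_form_sum)
qed

lemma alt_form_loc_codiff:
  assumes "\<omega> \<in> Omega A (Suc p)" "c \<in> A" "y \<in> chart_range c"
  shows "alt_form p (loc_codiff c \<omega> y)"
  unfolding loc_codiff_def[abs_def]
  by (rule alt_form_scale[OF alt_form_compose[OF alt_form_loc_div[OF assms] matrix_vector_mul_linear]])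

lemma smooth_on_loc_codiff:
  assumes "\<omega> \<in> Omega A (Suc p)" "c \<in> A"
  shows "smooth_on (chart_range c) (\<lambda>y. loc_codiff c \<omega> y vs)"
proof -
  note R = open_chart_range[OF assms(2)]
  show ?thesis
  proof (cases "length vs = p")
    case True
    have "smooth_on (chart_range c) (\<lambda>y. loc_div c \<omega> y (map ((*v) (loc_gram c y)) vs))"
      by (rule smooth_on_multilin[OF R])
        (use True alt_form_multilin[OF alt_form_loc_div[OF assms]] smooth_on_loc_div[OF assms]
          smooth_on_loc_gram[OF assms(2)] in auto)
    moreover have "vol_density c y \<noteq> 0" if "y \<in> chart_range c" for y
      using vol_density_pos[OF assms(2) that] by simp
    ultimately show ?thesis
      unfolding loc_codiff_def
      by (intro smooth_on_mult smooth_on_of_real smooth_on_minus smooth_on_inverse R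
          smooth_on_vol_density[OF assms(2)])
  next
    case False
    then show ?thesis
      by (intro smooth_on_cong[OF R smooth_on_const]) (simp add: alt_form_length[OF alt_form_loc_codiff[OF assms]])
  qed
qed

lemma loc_form_chart_lift:
  assumes "c \<in> A" "y \<in> chart_range c"
  shows "loc_form A c (chart_lift c F) y vs = F y vs"
  using from_ref_to_ref[OF assms(1) chart_inv_dom[OF assms]] chart_inv_right[OF assms]
  by (simp add: loc_form_def chart_lift_def o_def)

lemma alt_form_chart_lift:
  "c \<in> A \<Longrightarrow> x \<in> fst c \<Longrightarrow> alt_form p (F (snd c x)) \<Longrightarrow> alt_form p (chart_lift c F x)"
  unfolding chart_lift_def[abs_def] by (rule alt_form_compose[OF _ linear_from_ref])

lemma codiff_form_lift: "codiff_form \<omega> x = chart_lift (ref_chart A x) (loc_codiff (ref_chart A x) \<omega>) x"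
proof -
  have "from_ref (ref_chart A x) x = (\<lambda>v. v)"
    unfolding from_ref_def using jac_self[OF ref_chart(1) chart_in_range[OF ref_chart(2)]] by blast
  then show ?thesis by (intro ext) (simp add: codiff_form_def chart_lift_def)
qed

lemma form_inner_zero: "\<omega> x = (\<lambda>_. 0) \<Longrightarrow> form_inner g p \<omega> \<eta> x = 0"
  by (simp add: form_inner_def)

lemma ext_d_zero: "ext_d A (\<lambda>x vs. 0) x vs = 0"
  by (simp add: ext_d_altsum altsum_def loc_form_def)

lemma ext_d_zero_outside:
  assumes "closed K" "\<And>x. x \<notin> K \<Longrightarrow> \<phi> x = (\<lambda>_. 0)" "x \<notin> K"
  shows "ext_d A \<phi> x = (\<lambda>_. 0)"
proof -
  have "ext_d A \<phi> x = ext_d A (\<lambda>x vs. 0) x"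
    by (rule ext_d_local[OF open_Compl[OF assms(1)]]) (use assms in auto)
  then show ?thesis using ext_d_zero by auto
qed

text \<open>Raising indices involves only the inverse Gram matrix, which is continuous; the inner product is then
  continuous by its expression in the chart.\<close>

lemma continuous_on_form_inner_chart:
  assumes c: "c \<in> A" and W: "W \<subseteq> fst c" and alt: "\<And>x. x \<in> W \<Longrightarrow> alt_form p (\<omega> x)" "\<And>x. x \<in> W \<Longrightarrow> alt_form p (\<eta> x)"
    and cont: "\<And>vs. continuous_on (snd c ` W) (\<lambda>y. loc_form A c \<omega> y vs)"
      "\<And>vs. continuous_on (snd c ` W) (\<lambda>y. loc_form A c \<eta> y vs)"
  shows "continuous_on W (form_inner g p \<omega> \<eta>)"
    and "continuous_on (snd c ` W) (\<lambda>y. loc_form A c \<eta> y (map ((*v) (loc_cogram c y)) vs))"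
proof -
  let ?V = "snd c ` W"
  have VR: "?V \<subseteq> chart_range c" using W by (auto simp: chart_range_def)
  have raised: "continuous_on ?V (\<lambda>y. loc_form A c \<eta> y (map ((*v) (loc_cogram c y)) vs))" for vs
  proof (cases "length vs = p")
    case False
    have "loc_form A c \<eta> y (map ((*v) (loc_cogram c y)) vs) = 0" if "y \<in> ?V" for y
    proof -
      have "chart_inv c y \<in> W" using that W chart_inv_left[OF c] by auto
      then show ?thesis unfolding loc_form_def using False by (intro alt_form_length[OF alt(2)]) auto
    qed
    then show ?thesis using continuous_on_cong[of ?V ?V _ "\<lambda>_. 0"] by simp
  next
    case True
    have N: "continuous_on ?V (\<lambda>y. loc_cogram c y $ i $ j)" for i j
    proof -
      have "continuous_on ?V (\<lambda>y. (loc_cogram c y *v axis j 1) $ i)"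
        by (intro continuous_on_component continuous_on_subset[OF smooth_on_continuous[OF smooth_on_loc_cogram[OF c]] VR])
      then show ?thesis by (simp add: matrix_axis)
    qed
    have ml: "multilin (length vs) (loc_form A c \<eta> y)" if "y \<in> ?V" for y
    proof -
      have "chart_inv c y \<in> W" using that W chart_inv_left[OF c] by auto
      then show ?thesis unfolding True using that VR
        by (intro alt_form_multilin alt_form_loc_form[OF c _ alt(2)]) auto
    qed
    have "continuous_on S (\<lambda>y. F y (map ((*v) (loc_cogram c y)) ws))"
      if "S = ?V" "\<And>y. y \<in> S \<Longrightarrow> multilin (length ws) (F y)" "\<And>us. continuous_on S (\<lambda>y. F y us)"
      for F :: "real^'n \<Rightarrow> (real^'n) list \<Rightarrow> complex" and ws S
      using that(2,3)
    proof (induction ws arbitrary: F)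
      case Nil then show ?case by simp
    next
      case (Cons u us)
      have "continuous_on S (\<lambda>y. F y (axis k 1 # map ((*v) (loc_cogram c y)) us))" for k
        by (rule Cons.IH) (use Cons.prems in \<open>auto intro: multilin_tail\<close>)
      moreover have "continuous_on S (\<lambda>y. (loc_cogram c y *v u) $ k)" for k
        unfolding matrix_vector_mult_def that(1) by (simp, intro continuous_intros N)
      ultimately have "continuous_on S (\<lambda>y. \<Sum>k\<in>UNIV. ((loc_cogram c y *v u) $ k) *\<^sub>R F y (axis k 1 # map ((*v) (loc_cogram c y)) us))"
        by (intro continuous_on_sum continuous_on_scaleR)
      then show ?case
      proof (rule continuous_on_eq)
        fix y assume "y \<in> S"
        then show "(\<Sum>k\<in>UNIV. ((loc_cogram c y *v u) $ k) *\<^sub>R F y (axis k 1 # map ((*v) (loc_cogram c y)) us)) =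
            F y (map ((*v) (loc_cogram c y)) (u # us))"
          using Cons.prems(1)[of y] by (simp, intro multilin_head_expand[symmetric]) auto
      qed
    qed
    from this[OF refl ml cont(2)] show ?thesis .
  qed
  then show "continuous_on ?V (\<lambda>y. loc_form A c \<eta> y (map ((*v) (loc_cogram c y)) vs))" .
  let ?P = "\<lambda>y. (1 / fact p) * (\<Sum>I | length I = p. loc_form A c \<omega> y (ax I) *
      cnj (loc_form A c \<eta> y (map ((*v) (loc_cogram c y)) (ax I))))"
  have "continuous_on ?V ?P" by (intro continuous_intros cont(1) raised)
  then have "continuous_on W (\<lambda>x. ?P (snd c x))"
    by (rule continuous_on_compose2[OF _ continuous_on_subset[OF continuous_on_chart[OF c] W]]) simp
  then show "continuous_on W (form_inner g p \<omega> \<eta>)"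
    by (rule continuous_on_eq) (rule form_inner_chart[OF c _ alt, symmetric]; use W in blast)
qed

lemma loc_codiff_raised:
  assumes "c \<in> A" "y \<in> chart_range c"
  shows "loc_codiff c \<omega> y (map ((*v) (loc_cogram c y)) us) =
    of_real (- inverse (vol_density c y)) * loc_div c \<omega> y us"
  by (simp add: loc_codiff_def o_def loc_gram_inverse[OF assms])

text \<open>The local adjoint relation: the integrands differ by a divergence.\<close>

lemma adjoint_in_chart:
  assumes c: "c \<in> A" and \<omega>: "\<omega> \<in> Omega A (Suc q)" and \<phi>: "\<phi> \<in> Omega A q"
    and K: "compact K" "K \<subseteq> fst c" and zero: "\<And>x. x \<notin> K \<Longrightarrow> \<phi> x = (\<lambda>_. 0)"
  shows "integrable (riem_vol A g) (form_inner g (Suc q) (ext_d A \<phi>) \<omega>)"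
    "integrable (riem_vol A g) (form_inner g q \<phi> (chart_lift c (loc_codiff c \<omega>)))"
    "L2_inner A g (Suc q) (ext_d A \<phi>) \<omega> = L2_inner A g q \<phi> (chart_lift c (loc_codiff c \<omega>))"
proof -
  let ?R = "chart_range c" and ?\<eta> = "chart_lift c (loc_codiff c \<omega>)"
  let ?f1 = "form_inner g (Suc q) (ext_d A \<phi>) \<omega>" and ?f2 = "form_inner g q \<phi> ?\<eta>"
  have R: "open ?R" by (rule open_chart_range[OF c])
  have img: "snd c ` fst c = ?R" by (simp add: chart_range_def)
  have d\<phi>: "ext_d A \<phi> \<in> Omega A (Suc q)" by (rule Omega_ext_d[OF \<phi>])
  have alt\<eta>: "alt_form q (?\<eta> x)" if "x \<in> fst c" for x
    by (rule alt_form_chart_lift[of c x q "loc_codiff c \<omega>", OF c that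
          alt_form_loc_codiff[OF \<omega> c chart_in_range[OF that]]])
  have cont\<eta>: "continuous_on ?R (\<lambda>y. loc_form A c ?\<eta> y vs)" for vs
    using smooth_on_continuous[OF smooth_on_loc_codiff[OF \<omega> c]]
    by (rule continuous_on_eq) (simp add: loc_form_chart_lift[OF c])
  have cont1: "continuous_on (fst c) ?f1"
    by (rule continuous_on_form_inner_chart(1)[OF c])
      (auto simp: img intro: Omega_alt[OF d\<phi>] Omega_alt[OF \<omega>] smooth_on_continuous[OF Omega_smooth[OF d\<phi> c]]
        smooth_on_continuous[OF Omega_smooth[OF \<omega> c]])
  have cont2: "continuous_on (fst c) ?f2"
    by (rule continuous_on_form_inner_chart(1)[OF c])
      (auto simp: img intro: Omega_alt[OF \<phi>] alt\<eta> smooth_on_continuous[OF Omega_smooth[OF \<phi> c]] cont\<eta>)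
  have z1: "?f1 x = 0" if "x \<notin> K" for x
    by (rule form_inner_zero, rule ext_d_zero_outside[OF compact_imp_closed[OF K(1)] zero that])
  have z2: "?f2 x = 0" if "x \<notin> K" for x by (rule form_inner_zero, rule zero[OF that])
  note I1 = integral_riem_vol_chart[OF c K open_chart_dom[OF c] order_refl cont1 z1]
  note I2 = integral_riem_vol_chart[OF c K open_chart_dom[OF c] order_refl cont2 z2]
  show "integrable (riem_vol A g) ?f1" by (rule I1(1))
  show "integrable (riem_vol A g) ?f2" by (rule I2(1))
  let ?h = "\<lambda>k I y. loc_form A c \<phi> y (ax I) * cnj (density_form c \<omega> y (axis k 1 # ax I))"
  have "pull_integrand c ?f1 y - pull_integrand c ?f2 y =
      (1 / fact q) * (\<Sum>k\<in>UNIV. \<Sum>I | length I = q. if y \<in> ?R then dirderiv (?h k I) y (axis k 1) else 0)" for y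
  proof (cases "y \<in> ?R")
    case False then show ?thesis by (simp add: pull_integrand_def)
  next
    case True
    let ?x = "chart_inv c y" and ?v = "of_real (vol_density c y) :: complex"
    have x: "?x \<in> fst c" "snd c ?x = y" using chart_inv_dom[OF c True] chart_inv_right[OF c True] by auto
    have v: "?v \<noteq> 0" using vol_density_pos[OF c True] by simp
    let ?\<psi> = "\<lambda>us. cnj (loc_form A c \<omega> y (map ((*v) (loc_cogram c y)) us))"
    have \<psi>: "alt_form (Suc q) ?\<psi>"
      by (rule alt_form_cnj[OF alt_form_compose[OF Omega_alt_loc[OF \<omega> c True] matrix_vector_mul_linear]])
    have W: "cnj (density_form c \<omega> y us) = ?v * ?\<psi> us" for us by (simp add: density_form_def)
    let ?B = "\<lambda>v ws. dirderiv (\<lambda>z. loc_form A c \<phi> z ws) y v"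
    have "pull_integrand c ?f1 y = ?v * ((1 / fact (Suc q)) *
        (\<Sum>I | length I = Suc q. altsum ?B (ax I) * ?\<psi> (ax I)))"
      using form_inner_chart[of c ?x "Suc q" "ext_d A \<phi>" \<omega>, OF c x(1) Omega_alt[OF d\<phi>] Omega_alt[OF \<omega>]] True
      by (simp add: pull_integrand_def x(2) loc_form_ext_d[OF \<phi> c True] scaleR_conv_of_real)
    also have "\<dots> = (1 / fact q) * (?v * (\<Sum>k\<in>UNIV. \<Sum>I | length I = q. ?B (axis k 1) (ax I) * ?\<psi> (axis k 1 # ax I)))"
      unfolding sum_altsum_alt_form[OF \<psi>] by (simp add: field_simps del: of_nat_Suc)
    also have "\<dots> = (1 / fact q) * (\<Sum>k\<in>UNIV. \<Sum>I | length I = q.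
        ?B (axis k 1) (ax I) * cnj (density_form c \<omega> y (axis k 1 # ax I)))"
      unfolding W sum_distrib_left by (simp only: mult.left_commute)
    finally have 1: "pull_integrand c ?f1 y = (1 / fact q) * (\<Sum>k\<in>UNIV. \<Sum>I | length I = q.
        ?B (axis k 1) (ax I) * cnj (density_form c \<omega> y (axis k 1 # ax I)))" .
    have "pull_integrand c ?f2 y = ?v * ((1 / fact q) * (\<Sum>I | length I = q.
        loc_form A c \<phi> y (ax I) * cnj (loc_codiff c \<omega> y (map ((*v) (loc_cogram c y)) (ax I)))))"
      using form_inner_chart[of c ?x q \<phi> ?\<eta>, OF c x(1) Omega_alt[OF \<phi>] alt\<eta>[OF x(1)]] True
      by (simp add: pull_integrand_def x(2) loc_form_chart_lift[OF c True] scaleR_conv_of_real)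
    also have "\<dots> = (1 / fact q) * (\<Sum>I | length I = q. - (loc_form A c \<phi> y (ax I) * cnj (loc_div c \<omega> y (ax I))))"
      unfolding loc_codiff_raised[OF c True] using v by (simp add: sum_distrib_left sum_distrib_right field_simps sum_negf)
    also have "\<dots> = (1 / fact q) * (\<Sum>I | length I = q. \<Sum>k\<in>UNIV. - (loc_form A c \<phi> y (ax I) *
        cnj (dirderiv (\<lambda>z. density_form c \<omega> z (axis k 1 # ax I)) y (axis k 1))))"
      by (simp only: loc_div_def cnj_sum sum_distrib_left sum_negf)
    also have "\<dots> = (1 / fact q) * (\<Sum>k\<in>UNIV. \<Sum>I | length I = q. - (loc_form A c \<phi> y (ax I) *
        cnj (dirderiv (\<lambda>z. density_form c \<omega> z (axis k 1 # ax I)) y (axis k 1))))"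
      by (subst sum.swap) (rule refl)
    finally have 2: "pull_integrand c ?f2 y = \<dots>" .
    have 3: "dirderiv (?h k I) y (axis k 1) =
        loc_form A c \<phi> y (ax I) * cnj (dirderiv (\<lambda>z. density_form c \<omega> z (axis k 1 # ax I)) y (axis k 1)) +
        ?B (axis k 1) (ax I) * cnj (density_form c \<omega> y (axis k 1 # ax I))" for k I
      by (rule dirderiv_eq[OF has_derivative_mult[OF smooth_on_has_derivative[OF Omega_smooth[OF \<phi> c] True]
            bounded_linear.has_derivative[OF bounded_linear_cnj
              smooth_on_has_derivative[OF smooth_on_density_form[OF \<omega> c] True]]]])
    show ?thesis
      unfolding 1 2 3 right_diff_distrib[symmetric] sum_subtractf[symmetric] using True by (simp add: add.commute)
  qed
  moreover have "compact (snd c ` K)"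
    by (rule compact_continuous_image[OF continuous_on_subset[OF continuous_on_chart[OF c] K(2)] K(1)])
  moreover have "snd c ` K \<subseteq> ?R" using K(2) by (auto simp: chart_range_def)
  moreover have "?h k I y = 0" if "y \<in> ?R" "y \<notin> snd c ` K" for k I y
  proof -
    have "chart_inv c y \<notin> K" using that image_chart_preimage[OF c K(2)] by blast
    then show ?thesis by (simp add: loc_form_def zero)
  qed
  moreover have "smooth_on ?R (?h k I)" for k I
    by (intro smooth_on_mult smooth_on_cnj R Omega_smooth[OF \<phi> c] smooth_on_density_form[OF \<omega> c])
  ultimately have "integrable lborel (\<lambda>y. if y \<in> ?R then dirderiv (?h k I) y (axis k 1) else 0)"
    "(\<integral>y. (if y \<in> ?R then dirderiv (?h k I) y (axis k 1) else 0) \<partial>lborel) = 0"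
    "(\<lambda>y. pull_integrand c ?f1 y - pull_integrand c ?f2 y) = (\<lambda>y. (1 / fact q) * (\<Sum>k\<in>UNIV. \<Sum>I | length I = q.
      if y \<in> ?R then dirderiv (?h k I) y (axis k 1) else 0))" for k I
    using integral_dirderiv_compact_support_open[OF R, of "?h k I" "snd c ` K" "axis k 1"] by auto
  then have "(\<integral>y. pull_integrand c ?f1 y - pull_integrand c ?f2 y \<partial>lborel) = 0" by simp
  then have "integral\<^sup>L lborel (pull_integrand c ?f1) = integral\<^sup>L lborel (pull_integrand c ?f2)"
    using I1(2) I2(2) by simp
  from trans[OF trans[OF I1(3) this] I2(3)[symmetric]]
  show "L2_inner A g (Suc q) (ext_d A \<phi>) \<omega> = L2_inner A g q \<phi> ?\<eta>"
    unfolding L2_inner_def .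
qed

end

section \<open>Existence and uniqueness of the formal adjoint\<close>

context riemannian_manifold
begin

text \<open>Near a point outside the chart the form vanishes, because the compact set \<open>K\<close> is closed.\<close>

lemma Omega_supported_in_chart:
  assumes alt: "\<And>x. alt_form p (\<omega> x)" and c: "c \<in> A" and K: "compact K" "K \<subseteq> fst c"
    and zero: "\<And>x. x \<notin> K \<Longrightarrow> \<omega> x = (\<lambda>_. 0)"
    and smooth: "\<And>vs. smooth_on (chart_range c) (\<lambda>y. loc_form A c \<omega> y vs)"
  shows "\<omega> \<in> Omega A p"
proof (rule Omega_local[OF alt])
  fix x
  show "\<exists>c\<in>A. \<exists>U. open U \<and> x \<in> U \<and> U \<subseteq> fst c \<and> (\<forall>vs. smooth_on (snd c ` U) (\<lambda>y. loc_form A c \<omega> y vs))"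
  proof (cases "x \<in> fst c")
    case True
    then show ?thesis using c open_chart_dom[OF c] smooth unfolding chart_range_def by blast
  next
    case False
    let ?r = "ref_chart A x" and ?U = "- K \<inter> fst (ref_chart A x)"
    have U: "open ?U" using open_Compl[OF compact_imp_closed[OF K(1)]] open_chart_dom[OF ref_chart(1)] by blast
    have "open (snd ?r ` (- K \<inter> fst ?r))"
      by (rule open_image_chart[OF ref_chart(1) open_Compl[OF compact_imp_closed[OF K(1)]]])
    then have "smooth_on (snd ?r ` ?U) (\<lambda>y. loc_form A ?r \<omega> y vs)" for vs
    proof (rule smooth_on_cong[OF _ smooth_on_const])
      fix y assume "y \<in> snd ?r ` ?U"
      then have "chart_inv ?r y \<notin> K" using chart_inv_left[OF ref_chart(1)] by auto
      then show "0 = loc_form A ?r \<omega> y vs" by (simp add: loc_form_def zero)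
    qed
    moreover have "x \<in> ?U" using False K(2) ref_chart by blast
    ultimately show ?thesis using U ref_chart(1)[of x] by blast
  qed
qed

lemma compact_chart_ball:
  assumes "c \<in> A" "cball y r \<subseteq> chart_range c"
  shows "compact (chart_inv c ` cball y r)" "chart_inv c ` cball y r \<subseteq> fst c"
  using assms chart_inv_dom[OF assms(1)]
  by (auto intro!: compact_continuous_image continuous_on_subset[OF continuous_on_chart_inv])

lemma alt_form_eqI_axes:
  assumes "alt_form p f" "\<And>I. length I = p \<Longrightarrow> f (ax I) = 0"
  shows "f vs = 0"
proof (cases "length vs = p")
  case False then show ?thesis by (rule alt_form_length[OF assms(1)])
next
  case True
  have "multilin p f \<Longrightarrow> (\<And>I. length I = p \<Longrightarrow> f (ax I) = 0) \<Longrightarrow> length vs = p \<Longrightarrow> f vs = 0"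
    for f :: "(real^'k::finite) list \<Rightarrow> complex" and vs
  proof (induction p arbitrary: f vs)
    case 0 then show ?case by force
  next
    case (Suc p)
    obtain v us where vs: "vs = v # us" "length us = p" using Suc.prems(3) by (cases vs) auto
    have "f (axis k 1 # us) = 0" for k
    proof (rule Suc.IH[OF multilin_tail[OF Suc.prems(1)] _ vs(2)])
      show "f (axis k 1 # ax I) = 0" if "length I = p" for I using Suc.prems(2)[of "k # I"] that by simp
    qed
    then show ?case using multilin_head_expand[OF Suc.prems(1) vs(2), of v] vs(1) by simp
  qed
  from this[OF alt_form_multilin[OF assms(1)] assms(2) True] show ?thesis .
qed

text \<open>A form with constant components in a chart, built from the value of the difference at a point and cut
  off near that point, has a nonzero inner product with the difference unless this value is \<open>0\<close>.\<close>

lemma test_forms_separate: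
  assumes c: "c \<in> A" and W: "open W" "W \<subseteq> fst c"
    and alt: "\<And>x. x \<in> W \<Longrightarrow> alt_form p (\<xi> x)" "\<And>x. x \<in> W \<Longrightarrow> alt_form p (\<xi>' x)"
    and cont: "\<And>vs. continuous_on (snd c ` W) (\<lambda>y. loc_form A c \<xi> y vs)"
      "\<And>vs. continuous_on (snd c ` W) (\<lambda>y. loc_form A c \<xi>' y vs)"
    and test: "\<And>\<phi> K. \<phi> \<in> Omega A p \<Longrightarrow> compact K \<Longrightarrow> K \<subseteq> W \<Longrightarrow> (\<And>x. x \<notin> K \<Longrightarrow> \<phi> x = (\<lambda>_. 0)) \<Longrightarrow>
      L2_inner A g p \<phi> \<xi> = L2_inner A g p \<phi> \<xi>'"
    and pt: "pt \<in> W"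
  shows "\<xi> pt = \<xi>' pt"
proof (rule ccontr)
  assume ne: "\<xi> pt \<noteq> \<xi>' pt"
  define \<zeta> where "\<zeta> x vs = \<xi> x vs - \<xi>' x vs" for x vs
  let ?R = "chart_range c" and ?V = "snd c ` W"
  let ?y0 = "snd c pt"
  have R: "open ?R" by (rule open_chart_range[OF c])
  have y0: "?y0 \<in> ?V" "?y0 \<in> ?R" "chart_inv c ?y0 = pt"
    using pt W(2) chart_inv_left[OF c] by (auto simp: chart_range_def)
  have Vopen: "open ?V" using open_image_chart[OF c W(1)] W(2) by (simp add: Int_absorb2)
  have VR: "?V \<subseteq> ?R" using W(2) by (auto simp: chart_range_def)
  have alt\<zeta>: "alt_form p (\<zeta> x)" if "x \<in> W" for x
    using alt_form_add[OF alt(1)[OF that] alt_form_scale[OF alt(2)[OF that], of "-1"]]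
    by (simp add: \<zeta>_def[abs_def])
  have loc\<zeta>: "loc_form A c \<zeta> y vs = loc_form A c \<xi> y vs - loc_form A c \<xi>' y vs" for y vs
    by (simp add: loc_form_def \<zeta>_def)
  have cont\<zeta>: "continuous_on ?V (\<lambda>y. loc_form A c \<zeta> y vs)" for vs
    unfolding loc\<zeta> by (intro continuous_intros cont)
  define z0 where "z0 = loc_form A c \<zeta> ?y0"
  have altz0: "alt_form p z0"
    unfolding z0_def by (rule alt_form_loc_form[OF c y0(2)]) (simp add: y0(3) alt\<zeta>[OF pt])
  have "\<exists>I. length I = p \<and> z0 (ax I) \<noteq> 0"
  proof (rule ccontr)
    assume "\<not> ?thesis"
    then have "z0 vs = 0" for vs using alt_form_eqI_axes[OF altz0] by blast
    then have "\<zeta> pt vs = 0" for vs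
      using form_eq_loc_form[OF c, of pt \<zeta> vs] pt W(2) by (auto simp: z0_def)
    then show False using ne by (auto simp: \<zeta>_def fun_eq_iff)
  qed
  then obtain I0 where I0: "length I0 = p" "z0 (ax I0) \<noteq> 0" by blast
  \<comment> \<open>Applying the Gram matrix to the arguments cancels the raising of indices at the point, so that the inner product there becomes a sum of squares.\<close>
  define L where "L vs = z0 (map ((*v) (loc_gram c ?y0)) vs)" for vs
  have altL: "alt_form p L"
    unfolding L_def[abs_def] by (rule alt_form_compose[OF altz0 matrix_vector_mul_linear])
  define P where "P y = (\<Sum>I | length I = p. L (ax I) * cnj (loc_form A c \<zeta> y (map ((*v) (loc_cogram c y)) (ax I))))" for y
  have contP: "continuous_on ?V P"
    unfolding P_def[abs_def]
    by (intro continuous_intros continuous_on_form_inner_chart(2)[OF c W(2) alt\<zeta> alt\<zeta> cont\<zeta> cont\<zeta>])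
  have "Re (P ?y0) > 0"
  proof -
    have inner: "inner_form (loc_metric A c g ?y0)" by (rule loc_metric_inner_form[OF c y0(2)])
    have "loc_cogram c ?y0 ** transpose (loc_gram c ?y0) = mat 1"
      using inner_form_inverse(2)[OF inner] transpose_gram[OF inner] by (simp add: loc_cogram_def loc_gram_def)
    then have "P ?y0 = (\<Sum>I | length I = p. z0 (ax I) * cnj (z0 (ax I)))"
      using sum_multi_index_change_basis[OF alt_form_multilin[OF altz0] alt_form_multilin[OF alt_form_cnj[OF altz0]],
          of "loc_gram c ?y0" "loc_cogram c ?y0"]
      by (simp add: P_def L_def z0_def o_def)
    then have "P ?y0 = of_real (\<Sum>I | length I = p. (cmod (z0 (ax I)))\<^sup>2)"
      by (simp only: of_real_sum complex_norm_square)
    then have "Re (P ?y0) = (\<Sum>I | length I = p. (cmod (z0 (ax I)))\<^sup>2)"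
      by (simp only: Re_complex_of_real)
    also have "\<dots> > 0"
      by (rule sum_pos2[OF finite_multi_index, of I0]) (use I0 in auto)
    finally show ?thesis .
  qed
  moreover have "continuous_on ?V (\<lambda>y. Re (P y))" by (intro continuous_intros contP)
  ultimately have "open ((\<lambda>y. Re (P y)) -` {0<..} \<inter> ?V)" "?y0 \<in> {y \<in> ?V. Re (P y) > 0}"
    using continuous_on_open_vimage[OF Vopen, of "\<lambda>y. Re (P y)"] y0(1) open_greaterThan[of "0::real"]
    by blast+
  moreover have "(\<lambda>y. Re (P y)) -` {0<..} \<inter> ?V = {y \<in> ?V. Re (P y) > 0}" by auto
  ultimately have "open {y \<in> ?V. Re (P y) > 0}" "?y0 \<in> {y \<in> ?V. Re (P y) > 0}" by simp_all
  then obtain r where r: "r > 0" "cball ?y0 r \<subseteq> {y \<in> ?V. Re (P y) > 0}"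
    using open_contains_cball by blast
  have cbV: "cball ?y0 r \<subseteq> ?V" and cbR: "cball ?y0 r \<subseteq> ?R" using r(2) VR by auto
  have posP: "Re (P y) > 0" if "y \<in> cball ?y0 r" for y using r(2) that by auto
  obtain b :: "real^'n \<Rightarrow> real" where b: "smooth_on UNIV b" "\<And>y. 0 \<le> b y" "\<And>y. y \<in> cball ?y0 (r / 2) \<Longrightarrow> b y = 1"
    "\<And>y. y \<notin> ball ?y0 r \<Longrightarrow> b y = 0" using smooth_bump[OF r(1), of ?y0] by blast
  let ?K = "chart_inv c ` cball ?y0 r"
  define \<phi> where "\<phi> x = (if x \<in> fst c then chart_lift c (\<lambda>y vs. of_real (b y) * L vs) x else (\<lambda>_. 0))" for x
  have K: "compact ?K" "?K \<subseteq> fst c" by (rule compact_chart_ball[OF c cbR])+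
  have KW: "?K \<subseteq> W"
  proof
    fix x assume "x \<in> ?K"
    then obtain w where "w \<in> W" "x = chart_inv c (snd c w)" using cbV by blast
    then show "x \<in> W" using chart_inv_left[OF c] W(2) by auto
  qed
  have \<phi>0: "\<phi> x = (\<lambda>_. 0)" if "x \<notin> ?K" for x
  proof (cases "x \<in> fst c")
    case True
    then have "snd c x \<notin> cball ?y0 r" using that chart_inv_left[OF c True] by (metis imageI)
    then have "b (snd c x) = 0" by (intro b(4)) (auto simp: dist_commute)
    then show ?thesis by (simp add: \<phi>_def chart_lift_def fun_eq_iff)
  qed (simp add: \<phi>_def)
  have alt\<phi>: "alt_form p (\<phi> x)" for x
    using alt_form_chart_lift[of c x p "\<lambda>y vs. of_real (b y) * L vs", OF c _ alt_form_scale[OF altL]]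
    by (auto simp: \<phi>_def alt_form_zero)
  have loc\<phi>: "loc_form A c \<phi> y vs = of_real (b y) * L vs" if "y \<in> ?R" for y vs
    using loc_form_chart_lift[OF c that, of "\<lambda>y vs. of_real (b y) * L vs" vs] chart_inv_dom[OF c that]
    by (simp add: loc_form_def \<phi>_def)
  have sm\<phi>: "smooth_on ?R (\<lambda>y. loc_form A c \<phi> y vs)" for vs
    by (rule smooth_on_cong[OF R smooth_on_mult[OF R smooth_on_of_real[OF R smooth_on_subset[OF b(1)]]
            smooth_on_const[of ?R "L vs"]]]) (simp_all add: loc\<phi>)
  have \<phi>: "\<phi> \<in> Omega A p" by (rule Omega_supported_in_chart[OF alt\<phi> c K \<phi>0 sm\<phi>])
  have cont\<phi>: "continuous_on ?V (\<lambda>y. loc_form A c \<phi> y vs)" for vs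
    by (rule continuous_on_subset[OF smooth_on_continuous[OF Omega_smooth[OF \<phi> c]] VR])
  have fc: "continuous_on W (form_inner g p \<phi> \<theta>)"
    if "\<And>x. x \<in> W \<Longrightarrow> alt_form p (\<theta> x)" "\<And>vs. continuous_on ?V (\<lambda>y. loc_form A c \<theta> y vs)" for \<theta>
    by (rule continuous_on_form_inner_chart(1)[OF c W(2) alt\<phi> that(1) cont\<phi> that(2)])
  have f0: "form_inner g p \<phi> \<theta> x = 0" if "x \<notin> ?K" for x \<theta>
    by (rule form_inner_zero) (rule \<phi>0[OF that])
  note I1 = integral_riem_vol_chart(1)[OF c K(1) KW W fc[OF alt(1) cont(1)] f0]
  note I2 = integral_riem_vol_chart(1)[OF c K(1) KW W fc[OF alt(2) cont(2)] f0]
  note I = integral_riem_vol_chart(2,3)[OF c K(1) KW W fc[OF alt\<zeta> cont\<zeta>] f0]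
  have "form_inner g p \<phi> \<zeta> = (\<lambda>x. form_inner g p \<phi> \<xi> x - form_inner g p \<phi> \<xi>' x)"
    using form_inner_diff_right[of p \<phi> \<xi> \<xi>'] by (intro ext) (simp add: \<zeta>_def[abs_def])
  then have "integral\<^sup>L (riem_vol A g) (form_inner g p \<phi> \<zeta>) = L2_inner A g p \<phi> \<xi> - L2_inner A g p \<phi> \<xi>'"
    unfolding L2_inner_def using I1 I2 by simp
  also have "\<dots> = 0" using test[OF \<phi> K(1) KW \<phi>0] by simp
  finally have zero: "integral\<^sup>L lborel (pull_integrand c (form_inner g p \<phi> \<zeta>)) = 0" using I(2) by simp
  let ?F = "\<lambda>y. Re (pull_integrand c (form_inner g p \<phi> \<zeta>) y)"
  have F: "?F y = (if y \<in> cball ?y0 r then vol_density c y * b y * Re (P y) / fact p else 0)" for y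
  proof (cases "y \<in> cball ?y0 r")
    case True
    then have y: "y \<in> ?R" "chart_inv c y \<in> fst c" "chart_inv c y \<in> W" "snd c (chart_inv c y) = y"
      using cbR chart_inv_dom[OF c] chart_inv_right[OF c] KW by auto
    have "pull_integrand c (form_inner g p \<phi> \<zeta>) y = of_real (vol_density c y * b y / fact p) * P y"
      using form_inner_chart[of c "chart_inv c y" p \<phi> \<zeta>, OF c y(2) alt\<phi> alt\<zeta>[OF y(3)]] y
      by (simp add: pull_integrand_def loc\<phi> P_def scaleR_conv_of_real sum_distrib_left mult_ac)
    then have "?F y = vol_density c y * b y / fact p * Re (P y)"
      by (simp only: times_complex.simps Re_complex_of_real Im_complex_of_real mult_zero_left diff_zero)
    then show ?thesis using True by simp
  next
    case False
    have "form_inner g p \<phi> \<zeta> (chart_inv c y) = 0" if "y \<in> ?R"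
    proof (rule f0)
      show "chart_inv c y \<notin> ?K"
      proof
        assume "chart_inv c y \<in> ?K"
        then obtain w where w: "chart_inv c y = chart_inv c w" "w \<in> cball ?y0 r" by (rule imageE)
        have "snd c (chart_inv c y) = snd c (chart_inv c w)" by (simp only: w(1))
        then have "y = w"
          by (simp only: chart_inv_right[OF c that] chart_inv_right[OF c subsetD[OF cbR w(2)]])
        then have "y \<in> cball ?y0 r" by (simp only: w(2))
        with False show False by (rule notE)
      qed
    qed
    then show ?thesis using False by (simp add: pull_integrand_def)
  qed
  have Fint: "integrable lborel ?F" using I(1) by (rule integrable_Re)
  have Fnonneg: "0 \<le> ?F y" for y
    unfolding F using vol_density_pos[OF c, of y] posP[of y] b(2)[of y] cbR
    by (auto intro!: divide_nonneg_pos mult_nonneg_nonneg simp: subset_iff less_imp_le)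
  have "integral\<^sup>L lborel ?F = 0" using integral_Re[OF I(1)] zero by simp
  then have "AE y in lborel. ?F y = 0"
    using integral_nonneg_eq_0_iff_AE[OF Fint] Fnonneg by auto
  then have "AE y in lborel. y \<notin> ball ?y0 (r / 2)"
  proof (rule AE_mp, intro AE_I2 impI notI)
    fix y assume "?F y = 0" and "y \<in> ball ?y0 (r / 2)"
    moreover from this have "y \<in> cball ?y0 r" "b y = 1" using b(3)[of y] r(1) by auto
    ultimately show False
      using vol_density_pos[OF c, of y] posP[of y] cbR by (auto simp: F subset_iff)
  qed
  then have "emeasure lborel (ball ?y0 (r / 2)) = 0"
    by (subst (asm) AE_iff_measurable[of "ball ?y0 (r / 2)"]) auto
  moreover have "measure lborel (ball ?y0 (r / 2)) > 0" using r(1) by (intro content_ball_pos) simp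
  ultimately show False by (simp add: measure_def)
qed

text \<open>Both chart expressions are adjoint to the exterior derivative on forms supported in the overlap
  of the charts, so they agree there.\<close>

lemma codiff_form_chart:
  assumes c: "c \<in> A" "x \<in> fst c" and \<omega>: "\<omega> \<in> Omega A (Suc q)"
  shows "codiff_form \<omega> x = chart_lift c (loc_codiff c \<omega>) x"
proof -
  let ?r = "ref_chart A x"
  let ?W = "fst c \<inter> fst ?r"
  note r = ref_chart[of x]
  have V: "snd c ` ?W = overlap c ?r" by (simp add: overlap_eq[OF c(1)])
  have alt: "alt_form q (chart_lift c' (loc_codiff c' \<omega>) z)" if "c' \<in> A" "z \<in> fst c'" for c' z
    by (rule alt_form_chart_lift[of c' z q "loc_codiff c' \<omega>", OF that
          alt_form_loc_codiff[OF \<omega> that(1) chart_in_range[OF that(2)]]])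
  have "chart_lift c (loc_codiff c \<omega>) x = chart_lift ?r (loc_codiff ?r \<omega>) x"
  proof (rule test_forms_separate[where W="?W" and p=q and \<xi>="chart_lift c (loc_codiff c \<omega>)"
          and \<xi>'="chart_lift ?r (loc_codiff ?r \<omega>)" and pt=x, OF c(1)])
    show "open ?W" using open_chart_dom[OF c(1)] open_chart_dom[OF r(1)] by blast
    show "alt_form q (chart_lift c (loc_codiff c \<omega>) z)" "alt_form q (chart_lift ?r (loc_codiff ?r \<omega>) z)"
      if "z \<in> ?W" for z using that by (auto intro: alt[OF c(1)] alt[OF r(1)])
    have sub: "overlap c ?r \<subseteq> chart_range c" by (auto simp: overlap_def)
    show "continuous_on (snd c ` ?W) (\<lambda>y. loc_form A c (chart_lift c (loc_codiff c \<omega>)) y vs)" for vs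
      unfolding V
      by (rule continuous_on_eq[OF continuous_on_subset[OF smooth_on_continuous[OF smooth_on_loc_codiff[OF \<omega> c(1)]] sub]])
        (use sub loc_form_chart_lift[OF c(1)] in auto)
    note O = open_overlap[OF c(1) r(1)]
    have T: "transition c ?r y \<in> chart_range ?r" if "y \<in> overlap c ?r" for y
      using transition_in_overlap[OF c(1) r(1) that] by (simp add: overlap_def)
    have "smooth_on (overlap c ?r) (\<lambda>y. loc_codiff ?r \<omega> (transition c ?r y) (map (jac c ?r y) vs))"
      if "length vs = q" for vs
    proof (rule smooth_on_multilin[OF O])
      show "multilin (length vs) (loc_codiff ?r \<omega> (transition c ?r y))" if "y \<in> overlap c ?r" for y
        unfolding \<open>length vs = q\<close> by (rule alt_form_multilin[OF alt_form_loc_codiff[OF \<omega> r(1) T[OF that]]])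
      show "smooth_on (overlap c ?r) (\<lambda>y. loc_codiff ?r \<omega> (transition c ?r y) us)" for us
        by (rule smooth_on_compose[OF O _ smooth_on_loc_codiff[OF \<omega> r(1)] smooth_on_transition[OF c(1) r(1)]])
          (use T in auto)
      show "smooth_on (overlap c ?r) (\<lambda>y. jac c ?r y u)" for u by (rule smooth_on_jac[OF c(1) r(1)])
    qed
    then have s: "smooth_on (overlap c ?r) (\<lambda>y. loc_codiff ?r \<omega> (transition c ?r y) (map (jac c ?r y) vs))" for vs
      using smooth_on_cong[OF O smooth_on_const[of _ 0], of "\<lambda>y. loc_codiff ?r \<omega> (transition c ?r y) (map (jac c ?r y) vs)"]
        alt_form_length[OF alt_form_loc_codiff[OF \<omega> r(1) T], of _ "map (jac c ?r _) vs"]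
      by (cases "length vs = q") auto
    show "continuous_on (snd c ` ?W) (\<lambda>y. loc_form A c (chart_lift ?r (loc_codiff ?r \<omega>)) y vs)" for vs
      unfolding V
      by (rule continuous_on_eq[OF smooth_on_continuous[OF s]])
        (use T in \<open>simp add: loc_form_transition[OF c(1) r(1)] loc_form_chart_lift[OF r(1)]\<close>)
    show "x \<in> ?W" using c(2) r(2) by simp
    show "?W \<subseteq> fst c" by simp
    show "L2_inner A g q \<phi> (chart_lift c (loc_codiff c \<omega>)) = L2_inner A g q \<phi> (chart_lift ?r (loc_codiff ?r \<omega>))"
      if "\<phi> \<in> Omega A q" "compact K" "K \<subseteq> ?W" "\<And>x. x \<notin> K \<Longrightarrow> \<phi> x = (\<lambda>_. 0)" for \<phi> K
      using adjoint_in_chart(3)[OF c(1) \<omega> that(1,2) _ that(4)] adjoint_in_chart(3)[OF r(1) \<omega> that(1,2) _ that(4)]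
        that(3) by simp
  qed
  then show ?thesis by (simp add: codiff_form_lift)
qed

lemma Omega_codiff_form:
  assumes \<omega>: "\<omega> \<in> Omega A (Suc q)"
  shows "codiff_form \<omega> \<in> Omega A q"
  unfolding Omega_def
proof (intro CollectI conjI ballI allI)
  show "alt_form q (codiff_form \<omega> x)" for x
    unfolding codiff_form_def by (rule alt_form_loc_codiff[OF \<omega> ref_chart(1) chart_in_range[OF ref_chart(2)]])
  fix c vs assume c: "c \<in> A"
  show "smooth_on (chart_range c) (\<lambda>y. loc_form A c (codiff_form \<omega>) y vs)"
  proof (rule smooth_on_cong[OF open_chart_range[OF c] smooth_on_loc_codiff[OF \<omega> c]])
    fix y assume y: "y \<in> chart_range c"
    have "loc_form A c (codiff_form \<omega>) y vs = loc_form A c (chart_lift c (loc_codiff c \<omega>)) y vs"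
      unfolding loc_form_def codiff_form_chart[OF c chart_inv_dom[OF c y] \<omega>] ..
    then show "loc_codiff c \<omega> y vs = loc_form A c (codiff_form \<omega>) y vs" by (simp add: loc_form_chart_lift[OF c y])
  qed
qed

text \<open>Such functions split a compactly supported form into forms supported in charts.\<close>

lemma cutoff:
  obtains V c K and b :: "'m \<Rightarrow> complex" where "open V" "x \<in> V" "c \<in> A" "compact K" "K \<subseteq> fst c"
    "\<And>z. z \<in> V \<Longrightarrow> b z = 1" "\<And>z. z \<notin> K \<Longrightarrow> b z = 0"
    "\<And>\<phi> p. \<phi> \<in> Omega A p \<Longrightarrow> scale_form b \<phi> \<in> Omega A p"
proof -
  define c where "c = ref_chart A x"
  have c: "c \<in> A" "x \<in> fst c" using ref_chart by (auto simp: c_def)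
  let ?R = "chart_range c" and ?y = "snd c x"
  have R: "open ?R" by (rule open_chart_range[OF c(1)])
  obtain r where r: "r > 0" "cball ?y r \<subseteq> ?R"
    using open_contains_cball R chart_in_range[OF c(2)] by blast
  obtain \<beta> :: "real^'n \<Rightarrow> real" where \<beta>0: "smooth_on UNIV \<beta>" "\<And>y. 0 \<le> \<beta> y" "\<And>y. y \<in> cball ?y (r / 2) \<Longrightarrow> \<beta> y = 1"
    "\<And>y. y \<notin> ball ?y r \<Longrightarrow> \<beta> y = 0" using smooth_bump[OF r(1), of ?y] by blast
  note \<beta> = \<beta>0(1,3,4)
  let ?K = "chart_inv c ` cball ?y r"
  let ?V = "fst c \<inter> snd c -` ball ?y (r / 2)"
  define b where "b z = (if z \<in> fst c then of_real (\<beta> (snd c z)) else 0 :: complex)" for z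
  have K: "compact ?K" "?K \<subseteq> fst c" by (rule compact_chart_ball[OF c(1) r(2)])+
  have b0: "b z = 0" if "z \<notin> ?K" for z
  proof (cases "z \<in> fst c")
    case True
    then have "snd c z \<notin> cball ?y r" using that chart_inv_left[OF c(1) True] by (metis imageI)
    then show ?thesis using \<beta>(3)[of "snd c z"] by (auto simp: b_def)
  qed (simp add: b_def)
  have "scale_form b \<phi> \<in> Omega A p" if \<phi>: "\<phi> \<in> Omega A p" for \<phi> p
  proof (rule Omega_supported_in_chart[OF _ c(1) K])
    show "alt_form p (scale_form b \<phi> z)" for z
      unfolding scale_form_def by (rule alt_form_scale[OF Omega_alt[OF \<phi>]])
    show "scale_form b \<phi> z = (\<lambda>_. 0)" if "z \<notin> ?K" for z using b0[OF that] by (simp add: scale_form_def)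
    show "smooth_on ?R (\<lambda>y. loc_form A c (scale_form b \<phi>) y vs)" for vs
      by (rule smooth_on_cong[OF R smooth_on_mult[OF R smooth_on_of_real[OF R smooth_on_subset[OF \<beta>(1)]]
              Omega_smooth[OF \<phi> c(1), where vs=vs]]])
        (simp_all add: loc_form_def scale_form_def b_def chart_inv_dom[OF c(1)] chart_inv_right[OF c(1)])
  qed
  moreover have "open ?V"
    by (rule continuous_open_preimage[OF continuous_on_chart[OF c(1)] open_chart_dom[OF c(1)] open_ball])
  moreover have "x \<in> ?V" using c(2) r(1) by simp
  moreover have "b z = 1" if "z \<in> ?V" for z using that \<beta>(2)[of "snd c z"] by (auto simp: b_def)
  ultimately show ?thesis using that[of ?V c ?K b] c(1) K b0 by blast
qed

text \<open>Compactly supported forms are sums of forms supported in charts: the function \<open>b\<close> that is \<open>1\<close>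
  on \<open>V\<close> splits \<open>\<phi> = b \<phi> + (1 - b) \<phi>\<close>, and the second summand needs one open set less.\<close>

lemma codiff_form_adjoint:
  assumes \<omega>: "\<omega> \<in> Omega A (Suc q)" and \<phi>: "\<phi> \<in> Omega A q"
    and K: "compact K" "\<And>x. x \<notin> K \<Longrightarrow> \<phi> x = (\<lambda>_. 0)"
  shows "L2_inner A g (Suc q) (ext_d A \<phi>) \<omega> = L2_inner A g q \<phi> (codiff_form \<omega>)"
proof -
  define adj where "adj \<phi> \<longleftrightarrow> integrable (riem_vol A g) (form_inner g (Suc q) (ext_d A \<phi>) \<omega>) \<and>
    integrable (riem_vol A g) (form_inner g q \<phi> (codiff_form \<omega>)) \<and>
    L2_inner A g (Suc q) (ext_d A \<phi>) \<omega> = L2_inner A g q \<phi> (codiff_form \<omega>)" for \<phi>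
  have adj_chart: "adj \<phi>" if "\<phi> \<in> Omega A q" "c \<in> A" "compact K" "K \<subseteq> fst c" "\<And>x. x \<notin> K \<Longrightarrow> \<phi> x = (\<lambda>_. 0)"
    for \<phi> c K
  proof -
    have "form_inner g q \<phi> (codiff_form \<omega>) = form_inner g q \<phi> (chart_lift c (loc_codiff c \<omega>))"
    proof
      fix x
      show "form_inner g q \<phi> (codiff_form \<omega>) x = form_inner g q \<phi> (chart_lift c (loc_codiff c \<omega>)) x"
      proof (cases "x \<in> fst c")
        case True
        then show ?thesis by (simp add: form_inner_def codiff_form_chart[OF that(2) True \<omega>])
      next
        case False
        then show ?thesis using that(4,5) by (subst (1 2) form_inner_zero) auto
      qed
    qed
    then show ?thesis
      unfolding adj_def L2_inner_def
      using adjoint_in_chart[OF that(2) \<omega> that(1,3,4,5)] by (simp add: L2_inner_def)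
  qed
  have adj_add: "adj (\<lambda>x vs. \<phi>1 x vs + \<phi>2 x vs)"
    if "\<phi>1 \<in> Omega A q" "\<phi>2 \<in> Omega A q" "adj \<phi>1" "adj \<phi>2" for \<phi>1 \<phi>2
    using that(3,4) unfolding adj_def L2_inner_def ext_d_add[OF that(1,2)] form_inner_add_left[abs_def] by simp
  define good where "good V \<longleftrightarrow> open V \<and> (\<exists>c K. \<exists>b :: 'm \<Rightarrow> complex. c \<in> A \<and> compact K \<and> K \<subseteq> fst c \<and>
    (\<forall>z\<in>V. b z = 1) \<and> (\<forall>z. z \<notin> K \<longrightarrow> b z = 0) \<and> (\<forall>\<phi>\<in>Omega A q. scale_form b \<phi> \<in> Omega A q))" for V
  have ex: "\<exists>V. good V \<and> x \<in> V" for x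
    unfolding good_def using cutoff[of x] by metis
  have "adj \<phi>" if "finite F" "\<And>V. V \<in> F \<Longrightarrow> good V" "\<phi> \<in> Omega A q" "compact K" "K \<subseteq> \<Union>F"
    "\<And>x. x \<notin> K \<Longrightarrow> \<phi> x = (\<lambda>_. 0)" for F \<phi> K
    using that
  proof (induction F arbitrary: \<phi> K rule: finite_induct)
    case empty
    show ?case
    proof (rule adj_chart[of \<phi> "ref_chart A undefined" "{}"])
      show "\<phi> \<in> Omega A q" by (rule empty.prems(2))
      show "\<phi> x = (\<lambda>_. 0)" for x using empty.prems(4,5) by blast
    qed (simp_all add: ref_chart)
  next
    case (insert V F)
    have "good V" using insert.prems(1)[of V] by simp
    then obtain c K' and b :: "'m \<Rightarrow> complex" where b: "open V" "c \<in> A" "compact K'" "K' \<subseteq> fst c" "\<And>z. z \<in> V \<Longrightarrow> b z = 1"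
      "\<And>z. z \<notin> K' \<Longrightarrow> b z = 0" "\<And>\<phi>. \<phi> \<in> Omega A q \<Longrightarrow> scale_form b \<phi> \<in> Omega A q"
      unfolding good_def by blast
    let ?\<phi>1 = "scale_form b \<phi>"
    let ?\<phi>2 = "\<lambda>x vs. \<phi> x vs + (-1) * ?\<phi>1 x vs"
    have \<phi>1: "?\<phi>1 \<in> Omega A q" by (rule b(7)[OF insert.prems(2)])
    have \<phi>2: "?\<phi>2 \<in> Omega A q" by (rule Omega_add[OF insert.prems(2) Omega_scale_const[OF \<phi>1]])
    have "adj ?\<phi>1" by (rule adj_chart[OF \<phi>1 b(2-4)]) (simp add: scale_form_def b(6))
    moreover have "adj ?\<phi>2"
    proof (rule insert.IH[OF _ \<phi>2])
      show "good U" if "U \<in> F" for U using insert.prems(1) that by simp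
      show "compact (K - V)" using insert.prems(3) b(1) by (rule compact_diff)
      show "K - V \<subseteq> \<Union>F" using insert.prems(4) by auto
      show "?\<phi>2 x = (\<lambda>_. 0)" if "x \<notin> K - V" for x
        using that b(5)[of x] insert.prems(5)[of x] by (auto simp: scale_form_def fun_eq_iff)
    qed
    ultimately have "adj (\<lambda>x vs. ?\<phi>1 x vs + ?\<phi>2 x vs)" by (rule adj_add[OF \<phi>1 \<phi>2])
    then show ?case by simp
  qed
  note cover = this
  have "K \<subseteq> \<Union>{V. good V}" using ex by blast
  moreover have "open V" if "V \<in> {V. good V}" for V using that by (simp add: good_def)
  ultimately obtain F where F: "F \<subseteq> {V. good V}" "finite F" "K \<subseteq> \<Union>F"
    by (rule compactE[OF K(1)])
  then have "good V" if "V \<in> F" for V using that by blast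
  then have "adj \<phi>" by (rule cover[OF F(2) _ \<phi> K(1) F(3) K(2)])
  then show ?thesis by (simp add: adj_def)
qed

theorem codiff_eq_codiff_form:
  assumes \<omega>: "\<omega> \<in> Omega A (Suc q)"
  shows "codiff A g (Suc q) \<omega> = codiff_form \<omega>"
proof -
  have "(THE \<eta>. \<eta> \<in> Omega A q \<and>
      (\<forall>\<phi>\<in>Omega_c A q. L2_inner A g (Suc q) (ext_d A \<phi>) \<omega> = L2_inner A g q \<phi> \<eta>)) = codiff_form \<omega>"
  proof (rule the_equality)
    have "L2_inner A g (Suc q) (ext_d A \<phi>) \<omega> = L2_inner A g q \<phi> (codiff_form \<omega>)" if "\<phi> \<in> Omega_c A q" for \<phi>
    proof (rule codiff_form_adjoint[OF \<omega>])
      show "\<phi> \<in> Omega A q" "compact (closure {x. \<phi> x \<noteq> (\<lambda>_. 0)})" using that by (auto simp: Omega_c_def)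
      show "\<phi> x = (\<lambda>_. 0)" if "x \<notin> closure {x. \<phi> x \<noteq> (\<lambda>_. 0)}" for x
        using that closure_subset[of "{x. \<phi> x \<noteq> (\<lambda>_. 0)}"] by blast
    qed
    then show "codiff_form \<omega> \<in> Omega A q \<and>
        (\<forall>\<phi>\<in>Omega_c A q. L2_inner A g (Suc q) (ext_d A \<phi>) \<omega> = L2_inner A g q \<phi> (codiff_form \<omega>))"
      using Omega_codiff_form[OF \<omega>] by blast
  next
    fix \<eta>
    assume \<eta>: "\<eta> \<in> Omega A q \<and>
      (\<forall>\<phi>\<in>Omega_c A q. L2_inner A g (Suc q) (ext_d A \<phi>) \<omega> = L2_inner A g q \<phi> \<eta>)"
    show "\<eta> = codiff_form \<omega>"
    proof
      fix x
      let ?r = "ref_chart A x"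
      note r = ref_chart[of x]
      have img: "snd ?r ` fst ?r = chart_range ?r" by (simp add: chart_range_def)
      show "\<eta> x = codiff_form \<omega> x"
      proof (rule test_forms_separate[where p=q and \<xi>=\<eta> and \<xi>'="codiff_form \<omega>",
            OF r(1) open_chart_dom[OF r(1)] order_refl _ _ _ _ _ r(2)])
        show "alt_form q (\<eta> z)" "alt_form q (codiff_form \<omega> z)" for z
          using \<eta> Omega_codiff_form[OF \<omega>] Omega_alt by blast+
        show "continuous_on (snd ?r ` fst ?r) (\<lambda>y. loc_form A ?r \<eta> y vs)" for vs
          unfolding img using smooth_on_continuous[OF Omega_smooth[OF _ r(1)]] \<eta> by blast
        show "continuous_on (snd ?r ` fst ?r) (\<lambda>y. loc_form A ?r (codiff_form \<omega>) y vs)" for vs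
          unfolding img by (rule smooth_on_continuous[OF Omega_smooth[OF Omega_codiff_form[OF \<omega>] r(1)]])
        fix \<phi> K assume \<phi>: "\<phi> \<in> Omega A q" and K: "compact K" "\<And>x. x \<notin> K \<Longrightarrow> \<phi> x = (\<lambda>_. 0)"
        have "{x. \<phi> x \<noteq> (\<lambda>_. 0)} \<subseteq> K" using K(2) by blast
        then have "closure {x. \<phi> x \<noteq> (\<lambda>_. 0)} \<subseteq> K" using closure_minimal compact_imp_closed[OF K(1)] by blast
        then have "compact (closure {x. \<phi> x \<noteq> (\<lambda>_. 0)})"
          using compact_Int_closed[OF K(1) closed_closure, of "{x. \<phi> x \<noteq> (\<lambda>_. 0)}"]
          by (simp add: Int_absorb1)
        then have "\<phi> \<in> Omega_c A q" using \<phi> by (simp add: Omega_c_def)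
        then show "L2_inner A g q \<phi> \<eta> = L2_inner A g q \<phi> (codiff_form \<omega>)"
          using \<eta> codiff_form_adjoint[OF \<omega> \<phi> K] by simp
      qed
    qed
  qed
  then show ?thesis by (simp add: codiff_def)
qed

end

section \<open>Gauge transformations\<close>

context oriented_manifold
begin

lemma fun_form_Omega:
  assumes "smooth_fun A f"
  shows "fun_form f \<in> Omega A 0"
  unfolding Omega_def
proof (intro CollectI conjI ballI allI)
  show "alt_form 0 (fun_form f x)" for x by (simp add: alt_form_def fun_form_def)
  show "smooth_on (chart_range c) (\<lambda>y. loc_form A c (fun_form f) y vs)" if "c \<in> A" for c vs
    using assms that by (cases "vs = []") (simp_all add: smooth_fun_def loc_form_def fun_form_def o_def smooth_on_const)
qed

lemma smooth_fun_cnj: "smooth_fun A f \<Longrightarrow> smooth_fun A (\<lambda>x. cnj (f x))"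
  unfolding smooth_fun_def using smooth_on_cnj[OF open_chart_range] by (simp add: o_def)

lemma smooth_fun_chart: "smooth_fun A f \<Longrightarrow> c \<in> A \<Longrightarrow> smooth_on (chart_range c) (\<lambda>y. f (chart_inv c y))"
  unfolding smooth_fun_def by (simp add: o_def)

lemma ext_d_fun_form:
  assumes "smooth_fun A f" "c \<in> A" "y \<in> chart_range c"
  shows "ext_d A (fun_form f) (chart_inv c y) [to_ref A c (chart_inv c y) v] =
    dirderiv (\<lambda>z. f (chart_inv c z)) y v"
  using loc_form_ext_d[OF fun_form_Omega[OF assms(1)] assms(2,3), of "[v]"]
  by (simp add: loc_form_def altsum_def fun_form_def remove_nth_def)

text \<open>Differentiating \<open>\<tau> cnj \<tau> = 1\<close> shows that \<open>cnj \<tau> d\<tau>\<close> is purely imaginary. Hence \<open>d\<tau> / (i\<tau>)\<close> is real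
  and nothing is lost by taking its real part.\<close>

lemma alpha_tau_chart:
  assumes \<tau>: "smooth_fun A \<tau>" "\<And>x. cmod (\<tau> x) = 1" and c: "c \<in> A" "y \<in> chart_range c"
  shows "dirderiv (\<lambda>z. \<tau> (chart_inv c z)) y v =
      \<i> * \<tau> (chart_inv c y) * of_real (alpha_tau A \<tau> (chart_inv c y) (to_ref A c (chart_inv c y) v))"
    and "alpha_tau A \<tau> (chart_inv c y) (to_ref A c (chart_inv c y) v) =
      Re (- \<i> * cnj (\<tau> (chart_inv c y)) * dirderiv (\<lambda>z. \<tau> (chart_inv c z)) y v)"
proof -
  let ?t = "\<lambda>z. \<tau> (chart_inv c z)"
  let ?D = "dirderiv ?t y v"
  have unit: "\<tau> x * cnj (\<tau> x) = 1" for x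
    using complex_norm_square[of "\<tau> x"] \<tau>(2)[of x] by simp
  then have inv: "1 / \<tau> x = cnj (\<tau> x)" and nz: "\<tau> x \<noteq> 0" for x
    using \<tau>(2)[of x] by (auto simp: divide_eq_eq mult.commute)
  have D: "(?t has_derivative frechet_derivative ?t (at y)) (at y)"
    by (rule smooth_on_has_derivative[OF smooth_fun_chart[OF \<tau>(1) c(1)] c(2)])
  have "dirderiv (\<lambda>z. ?t z * cnj (?t z)) y v = ?t y * cnj ?D + ?D * cnj (?t y)"
    by (rule dirderiv_eq[OF has_derivative_mult[OF D bounded_linear.has_derivative[OF bounded_linear_cnj D]]])
  then have "?t y * cnj ?D + ?D * cnj (?t y) = 0" by (simp add: unit)
  then have re: "Re (?D * cnj (?t y)) = 0" by (simp add: complex_eq_iff algebra_simps)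
  have e: "?D / (\<i> * ?t y) = - \<i> * cnj (?t y) * ?D"
    using inv[of "chart_inv c y"] nz[of "chart_inv c y"] unit[of "chart_inv c y"]
    by (simp add: divide_eq_eq) (simp add: algebra_simps flip: mult.assoc)
  show 2: "alpha_tau A \<tau> (chart_inv c y) (to_ref A c (chart_inv c y) v) = Re (- \<i> * cnj (?t y) * ?D)"
    unfolding alpha_tau_def ext_d_fun_form[OF \<tau>(1) c] e ..
  have "Im (- \<i> * cnj (?t y) * ?D) = 0" using re by (simp add: algebra_simps)
  then have "of_real (Re (- \<i> * cnj (?t y) * ?D)) = - \<i> * cnj (?t y) * ?D"
    by (simp only: complex_eq_iff Re_complex_of_real Im_complex_of_real)
  also have "\<dots> = ?D / (\<i> * ?t y)" by (rule e[symmetric])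
  finally show "?D = \<i> * ?t y * of_real (alpha_tau A \<tau> (chart_inv c y) (to_ref A c (chart_inv c y) v))"
    unfolding 2 using nz by simp
qed

lemma alpha_tau_ref:
  assumes "smooth_fun A \<tau>" "\<And>x. cmod (\<tau> x) = 1"
  shows "dirderiv (\<lambda>z. \<tau> (chart_inv (ref_chart A x) z)) (ref_coord x) v =
    \<i> * \<tau> x * of_real (alpha_tau A \<tau> x v)"
  using alpha_tau_chart(1)[OF assms ref_chart(1) chart_in_range[OF ref_chart(2)], where v=v]
  by (simp add: chart_inv_left ref_chart to_ref_ref)

lemma real_one_form_alpha_tau:
  assumes \<tau>: "smooth_fun A \<tau>" "\<And>x. cmod (\<tau> x) = 1"
  shows "real_one_form A (alpha_tau A \<tau>)"
  unfolding real_one_form_def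
proof (intro conjI allI ballI)
  fix x
  let ?r = "ref_chart A x"
  let ?D = "frechet_derivative (\<lambda>z. \<tau> (chart_inv ?r z)) (at (ref_coord x))"
  have "linear ?D"
    by (rule has_derivative_linear[OF smooth_on_has_derivative[OF smooth_fun_chart[OF \<tau>(1) ref_chart(1)]
            chart_in_range[OF ref_chart(2)]]])
  from linear_compose[OF linear_mult_left[OF this, of "- \<i> * cnj (\<tau> x)"] bounded_linear.linear[OF bounded_linear_Re]]
  have "linear (\<lambda>v. Re (- \<i> * cnj (\<tau> x) * ?D v))" by (simp only: o_def)
  moreover have "alpha_tau A \<tau> x = (\<lambda>v. Re (- \<i> * cnj (\<tau> x) * ?D v))"
    using alpha_tau_chart(2)[OF \<tau> ref_chart(1) chart_in_range[OF ref_chart(2)]]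
    by (intro ext) (simp add: chart_inv_left ref_chart to_ref_ref)
  ultimately show "linear (alpha_tau A \<tau> x)" by simp
next
  fix c v assume c: "c \<in> A"
  note R = open_chart_range[OF c]
  have "smooth_on (chart_range c) (\<lambda>y. Re (- \<i> * cnj (\<tau> (chart_inv c y)) * dirderiv (\<lambda>z. \<tau> (chart_inv c z)) y v))"
    by (intro smooth_on_linear[OF bounded_linear_Re] smooth_on_mult smooth_on_const smooth_on_cnj R
        smooth_on_dirderiv smooth_fun_chart[OF \<tau>(1) c])
  then show "smooth_on (chart_range c) (\<lambda>y. alpha_tau A \<tau> (chart_inv c y) (to_ref A c (chart_inv c y) v))"
    by (rule smooth_on_cong[OF R]) (rule alpha_tau_chart(2)[OF \<tau> c, symmetric])
qed

lemma real_one_form_add: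
  "real_one_form A \<alpha> \<Longrightarrow> real_one_form A \<beta> \<Longrightarrow> real_one_form A (\<lambda>x v. \<alpha> x v + \<beta> x v)"
  unfolding real_one_form_def by (auto intro: linear_compose_add smooth_on_add[OF open_chart_range])

lemma wedge_one_altsum: "wedge_one \<alpha> \<omega> x vs = altsum (\<lambda>v ws. of_real (\<alpha> x v) * \<omega> x ws) vs"
  by (simp add: wedge_one_def altsum_def mult.assoc)

lemma Omega_wedge_one:
  assumes \<alpha>: "real_one_form A \<alpha>" and \<omega>: "\<omega> \<in> Omega A p"
  shows "wedge_one \<alpha> \<omega> \<in> Omega A (Suc p)"
  unfolding Omega_def
proof (intro CollectI conjI ballI allI)
  fix x
  have "linear (\<lambda>v. of_real (\<alpha> x v) * \<omega> x ws)" for ws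
  proof -
    have "linear (\<alpha> x)" using \<alpha> by (simp add: real_one_form_def)
    from linear_compose[OF this bounded_linear.linear[OF bounded_linear_of_real[where 'a=complex]]]
    have "linear (\<lambda>v. complex_of_real (\<alpha> x v))" by (simp only: o_def)
    then have "linear (\<lambda>v. \<omega> x ws * of_real (\<alpha> x v))" by (rule linear_mult_left)
    then show ?thesis by (simp add: mult.commute)
  qed
  then show "alt_form (Suc p) (wedge_one \<alpha> \<omega> x)"
    unfolding wedge_one_altsum[abs_def] by (intro alt_form_altsum alt_form_scale Omega_alt[OF \<omega>])
next
  fix c vs assume c: "c \<in> A"
  note R = open_chart_range[OF c]
  have "smooth_on (chart_range c) (\<lambda>y. \<Sum>i<length vs. (-1) ^ i *
      (of_real (\<alpha> (chart_inv c y) (to_ref A c (chart_inv c y) (vs ! i))) * loc_form A c \<omega> y (remove_nth i vs)))"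
    using \<alpha> c
    by (intro smooth_on_sum smooth_on_mult smooth_on_const smooth_on_of_real R Omega_smooth[OF \<omega> c])
      (simp add: real_one_form_def)
  then show "smooth_on (chart_range c) (\<lambda>y. loc_form A c (wedge_one \<alpha> \<omega>) y vs)"
    unfolding loc_form_def wedge_one_altsum altsum_map unfolding altsum_def .
qed

lemma Omega_mag_d:
  assumes "real_one_form A \<alpha>" "\<omega> \<in> Omega A p"
  shows "mag_d A \<alpha> \<omega> \<in> Omega A (Suc p)"
  unfolding mag_d_def
  by (rule Omega_add[OF Omega_ext_d[OF assms(2)] Omega_scale_const[OF Omega_wedge_one[OF assms]]])

text \<open>The Leibniz rule, in which \<open>d\<tau> = i \<tau> \<alpha>\<^sub>\<tau>\<close>.\<close>

lemma ext_d_scale_form: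
  assumes \<tau>: "smooth_fun A \<tau>" "\<And>x. cmod (\<tau> x) = 1" and \<omega>: "\<omega> \<in> Omega A p"
  shows "ext_d A (scale_form \<tau> \<omega>) x vs =
    \<tau> x * (ext_d A \<omega> x vs + \<i> * wedge_one (alpha_tau A \<tau>) \<omega> x vs)"
proof -
  let ?r = "ref_chart A x" and ?y = "ref_coord x"
  have y: "?y \<in> chart_range ?r" by (rule chart_in_range[OF ref_chart(2)])
  have x: "chart_inv ?r ?y = x" by (rule chart_inv_left[OF ref_chart])
  have "dirderiv (\<lambda>z. loc_form A ?r (scale_form \<tau> \<omega>) z ws) ?y v =
      \<tau> x * (dirderiv (\<lambda>z. loc_form A ?r \<omega> z ws) ?y v + \<i> * (of_real (alpha_tau A \<tau> x v) * \<omega> x ws))" for v ws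
  proof -
    have "dirderiv (\<lambda>z. \<tau> (chart_inv ?r z) * loc_form A ?r \<omega> z ws) ?y v =
        \<tau> (chart_inv ?r ?y) * dirderiv (\<lambda>z. loc_form A ?r \<omega> z ws) ?y v +
        dirderiv (\<lambda>z. \<tau> (chart_inv ?r z)) ?y v * loc_form A ?r \<omega> ?y ws"
      by (rule dirderiv_eq[OF has_derivative_mult[OF
              smooth_on_has_derivative[OF smooth_fun_chart[OF \<tau>(1) ref_chart(1)] y]
              smooth_on_has_derivative[OF Omega_smooth[OF \<omega> ref_chart(1)] y]]])
    then show ?thesis
      unfolding alpha_tau_ref[OF \<tau>] loc_form_ref x
      by (simp add: loc_form_def scale_form_def algebra_simps)
  qed
  then show ?thesis
    by (simp only: ext_d_altsum wedge_one_altsum altsum_add altsum_mult)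
qed

lemma mag_d_scale_form:
  assumes \<tau>: "smooth_fun A \<tau>" "\<And>x. cmod (\<tau> x) = 1" and \<omega>: "\<omega> \<in> Omega A p"
  shows "mag_d A \<alpha> (scale_form \<tau> \<omega>) = scale_form \<tau> (mag_d A (\<lambda>x v. \<alpha> x v + alpha_tau A \<tau> x v) \<omega>)"
proof (intro ext)
  fix x vs
  have "wedge_one \<alpha> (scale_form \<tau> \<omega>) x vs = \<tau> x * wedge_one \<alpha> \<omega> x vs"
    by (simp add: wedge_one_def scale_form_def sum_distrib_left mult_ac)
  moreover have "wedge_one (\<lambda>x v. \<alpha> x v + alpha_tau A \<tau> x v) \<omega> x vs =
      wedge_one \<alpha> \<omega> x vs + wedge_one (alpha_tau A \<tau>) \<omega> x vs"
    by (simp add: wedge_one_def algebra_simps sum.distrib)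
  ultimately show "mag_d A \<alpha> (scale_form \<tau> \<omega>) x vs =
      scale_form \<tau> (mag_d A (\<lambda>x v. \<alpha> x v + alpha_tau A \<tau> x v) \<omega>) x vs"
    unfolding mag_d_def ext_d_scale_form[OF \<tau> \<omega>] by (simp add: scale_form_def algebra_simps)
qed

end

context riemannian_manifold
begin

text \<open>In the divergence the product rule produces the extra term \<open>\<Sum>\<^sub>k \<partial>\<^sub>k\<tau> \<omega>\<^sup>k\<close>, which by
  \<open>\<partial>\<^sub>k\<tau> = i \<tau> \<alpha>\<^sub>\<tau>(e\<^sub>k)\<close> is the contraction with the dual field of \<open>\<alpha>\<^sub>\<tau>\<close>.\<close>

lemma codiff_form_scale_form:
  assumes \<tau>: "smooth_fun A \<tau>" "\<And>x. cmod (\<tau> x) = 1" and \<omega>: "\<omega> \<in> Omega A (Suc q)"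
  shows "codiff_form (scale_form \<tau> \<omega>) x vs =
    \<tau> x * (codiff_form \<omega> x vs - \<i> * contract (sharp g (alpha_tau A \<tau>)) \<omega> x vs)"
proof (cases "length vs = q")
  case False
  have "alt_form q (codiff_form \<omega>' x)" if "\<omega>' \<in> Omega A (Suc q)" for \<omega>'
    by (rule Omega_alt[OF Omega_codiff_form[OF that]])
  from alt_form_length[OF this] have "codiff_form (scale_form \<tau> \<omega>) x vs = 0" "codiff_form \<omega> x vs = 0"
    using False \<omega> Omega_scale_form[OF \<tau>(1) \<omega>] by auto
  moreover have "contract (sharp g (alpha_tau A \<tau>)) \<omega> x vs = 0"
    unfolding contract_def by (rule alt_form_length[OF Omega_alt[OF \<omega>]]) (simp add: False)
  ultimately show ?thesis by simp
next
  case True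
  let ?r = "ref_chart A x" and ?y = "ref_coord x"
  let ?N = "loc_cogram ?r ?y" and ?G = "loc_gram ?r ?y" and ?v = "vol_density ?r ?y"
  let ?a = "\<lambda>k. alpha_tau A \<tau> x (axis k 1)"
  have y: "?y \<in> chart_range ?r" by (rule chart_in_range[OF ref_chart(2)])
  have x: "chart_inv ?r ?y = x" by (rule chart_inv_left[OF ref_chart])
  have v: "?v \<noteq> 0" using vol_density_pos[OF ref_chart(1) y] by simp
  have div: "loc_div ?r (scale_form \<tau> \<omega>) ?y us =
      \<tau> x * (loc_div ?r \<omega> ?y us + \<i> * (\<Sum>k\<in>UNIV. of_real (?a k) * density_form ?r \<omega> ?y (axis k 1 # us)))" for us
  proof -
    have "dirderiv (\<lambda>z. density_form ?r (scale_form \<tau> \<omega>) z ws) ?y e =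
      \<tau> x * (dirderiv (\<lambda>z. density_form ?r \<omega> z ws) ?y e + \<i> * (of_real (alpha_tau A \<tau> x e) * density_form ?r \<omega> ?y ws))"
      for e ws
    proof -
      have "dirderiv (\<lambda>z. \<tau> (chart_inv ?r z) * density_form ?r \<omega> z ws) ?y e =
          \<tau> (chart_inv ?r ?y) * dirderiv (\<lambda>z. density_form ?r \<omega> z ws) ?y e +
          dirderiv (\<lambda>z. \<tau> (chart_inv ?r z)) ?y e * density_form ?r \<omega> ?y ws"
        by (rule dirderiv_eq[OF has_derivative_mult[OF
                smooth_on_has_derivative[OF smooth_fun_chart[OF \<tau>(1) ref_chart(1)] y]
                smooth_on_has_derivative[OF smooth_on_density_form[OF \<omega> ref_chart(1)] y]]])
      moreover have "density_form ?r (scale_form \<tau> \<omega>) z ws = \<tau> (chart_inv ?r z) * density_form ?r \<omega> z ws" for z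
        by (simp add: density_form_def loc_form_def scale_form_def mult.left_commute)
      ultimately show ?thesis
        unfolding alpha_tau_ref[OF \<tau>] x by (simp add: algebra_simps)
    qed
    then show ?thesis
      unfolding loc_div_def by (simp add: sum_distrib_left sum.distrib distrib_left)
  qed
  have alt: "alt_form (Suc q) (\<omega> x)" by (rule Omega_alt[OF \<omega>])
  have lin: "linear (\<lambda>u. \<omega> x (?N *v u # vs))"
    using linear_compose[OF matrix_vector_mul_linear multilin_head[OF alt_form_multilin[OF alt] True]]
    by (simp add: o_def)
  have "linear (alpha_tau A \<tau> x)" using real_one_form_alpha_tau[OF \<tau>] by (simp add: real_one_form_def)
  from from_ref_sharp[of ?r x "alpha_tau A \<tau>", OF ref_chart this]
  have sharp: "sharp g (alpha_tau A \<tau>) x = ?N *v (\<chi> k. ?a k)"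
    by (simp add: to_ref_ref from_ref_def jac_self[OF ref_chart(1) y])
  have "density_form ?r \<omega> ?y (axis k 1 # map ((*v) ?G) vs) = of_real ?v * \<omega> x (?N *v axis k 1 # vs)" for k
    unfolding density_form_def loc_form_ref by (simp add: o_def loc_gram_inverse[OF ref_chart(1) y])
  then have "(\<Sum>k\<in>UNIV. of_real (?a k) * density_form ?r \<omega> ?y (axis k 1 # map ((*v) ?G) vs)) =
      of_real ?v * (\<Sum>k\<in>UNIV. (?a k) *\<^sub>R \<omega> x (?N *v axis k 1 # vs))"
    by (simp add: sum_distrib_left scaleR_conv_of_real mult.left_commute)
  also have "(\<Sum>k\<in>UNIV. (?a k) *\<^sub>R \<omega> x (?N *v axis k 1 # vs)) = contract (sharp g (alpha_tau A \<tau>)) \<omega> x vs"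
    unfolding contract_def sharp using linear_expand[OF lin, of "\<chi> k. ?a k"] by simp
  finally show ?thesis
    unfolding codiff_form_def loc_codiff_def div using v by (simp add: field_simps)
qed

lemma mag_codiff_Suc:
  assumes "\<omega> \<in> Omega A (Suc q)"
  shows "mag_codiff A g \<alpha> (Suc q) \<omega> = (\<lambda>x vs. codiff_form \<omega> x vs + (- \<i>) * contract (sharp g \<alpha>) \<omega> x vs)"
  by (simp add: mag_codiff_def codiff_eq_codiff_form[OF assms])

lemma mag_codiff_0:
  assumes "\<omega> \<in> Omega A 0"
  shows "mag_codiff A g \<alpha> 0 \<omega> = (\<lambda>x vs. 0)"
  using alt_form_length[OF Omega_alt[OF assms]] by (simp add: mag_codiff_def codiff_def contract_def)

lemma Omega_mag_codiff:
  assumes "real_one_form A \<alpha>" "\<omega> \<in> Omega A p"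
  shows "mag_codiff A g \<alpha> p \<omega> \<in> Omega A (p - 1)"
proof (cases p)
  case 0 then show ?thesis using assms(2) by (simp add: mag_codiff_0 Omega_zero)
next
  case (Suc q)
  then have \<omega>: "\<omega> \<in> Omega A (Suc q)" using assms(2) by simp
  show ?thesis
    unfolding Suc mag_codiff_Suc[OF \<omega>] diff_Suc_1
    by (rule Omega_add[OF Omega_codiff_form[OF \<omega>] Omega_scale_const[OF Omega_contract_sharp[OF assms(1) \<omega>]]])
qed

lemma mag_codiff_scale_form:
  assumes \<alpha>: "real_one_form A \<alpha>" and \<tau>: "smooth_fun A \<tau>" "\<And>x. cmod (\<tau> x) = 1" and \<omega>: "\<omega> \<in> Omega A p"
  shows "mag_codiff A g \<alpha> p (scale_form \<tau> \<omega>) =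
    scale_form \<tau> (mag_codiff A g (\<lambda>x v. \<alpha> x v + alpha_tau A \<tau> x v) p \<omega>)"
proof (cases p)
  case 0
  then show ?thesis
    using \<omega> Omega_scale_form[OF \<tau>(1) \<omega>] by (simp add: mag_codiff_0 scale_form_def)
next
  case (Suc q)
  then have \<omega>: "\<omega> \<in> Omega A (Suc q)" using \<omega> by simp
  show ?thesis
  proof (intro ext)
    fix x vs
    let ?\<beta> = "\<lambda>x v. \<alpha> x v + alpha_tau A \<tau> x v"
    have lin: "linear (\<alpha> x)" "linear (alpha_tau A \<tau> x)"
      using \<alpha> real_one_form_alpha_tau[OF \<tau>] by (simp_all add: real_one_form_def)
    have "contract (sharp g ?\<beta>) \<omega> x vs = contract (sharp g \<alpha>) \<omega> x vs + contract (sharp g (alpha_tau A \<tau>)) \<omega> x vs"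
    proof (cases "length vs = q")
      case True
      then show ?thesis
        unfolding contract_def sharp_add[of \<alpha> x "alpha_tau A \<tau>", OF lin]
        by (intro linear_add[OF multilin_head[OF alt_form_multilin[OF Omega_alt[OF \<omega>]]]])
    next
      case False
      then show ?thesis by (simp add: contract_def alt_form_length[OF Omega_alt[OF \<omega>]])
    qed
    moreover have "contract (sharp g \<alpha>) (scale_form \<tau> \<omega>) x vs = \<tau> x * contract (sharp g \<alpha>) \<omega> x vs"
      by (simp add: contract_def scale_form_def)
    ultimately show "mag_codiff A g \<alpha> p (scale_form \<tau> \<omega>) x vs = scale_form \<tau> (mag_codiff A g ?\<beta> p \<omega>) x vs"
      unfolding Suc mag_codiff_Suc[OF \<omega>] mag_codiff_Suc[OF Omega_scale_form[OF \<tau>(1) \<omega>]]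
        codiff_form_scale_form[OF \<tau> \<omega>]
      by (simp add: scale_form_def algebra_simps)
  qed
qed

theorem mag_laplacian_scale_form:
  assumes \<alpha>: "real_one_form A \<alpha>" and \<tau>: "smooth_fun A \<tau>" "\<And>x. cmod (\<tau> x) = 1" and \<omega>: "\<omega> \<in> Omega A p"
  shows "mag_laplacian A g \<alpha> p (scale_form \<tau> \<omega>) =
    scale_form \<tau> (mag_laplacian A g (\<lambda>x v. \<alpha> x v + alpha_tau A \<tau> x v) p \<omega>)"
proof -
  have \<beta>: "real_one_form A (\<lambda>x v. \<alpha> x v + alpha_tau A \<tau> x v)"
    by (rule real_one_form_add[OF \<alpha> real_one_form_alpha_tau[OF \<tau>]])
  show ?thesis
    unfolding mag_laplacian_def mag_codiff_scale_form[OF \<alpha> \<tau> \<omega>] mag_d_scale_form[OF \<tau> \<omega>]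
      mag_d_scale_form[OF \<tau> Omega_mag_codiff[OF \<beta> \<omega>]] mag_codiff_scale_form[OF \<alpha> \<tau> Omega_mag_d[OF \<beta> \<omega>]]
    by (simp add: scale_form_def distrib_left)
qed


section \<open>Unitarily equivalent operators have the same spectrum\<close>

lemma scale_form_inverse:
  "(\<And>x. \<sigma> x * \<rho> x = 1) \<Longrightarrow> scale_form \<sigma> (scale_form \<rho> \<omega>) = \<omega>"
  by (simp add: scale_form_def fun_eq_iff mult.assoc[symmetric])

lemma form_inner_scale_unit:
  assumes "\<And>x. cmod (\<sigma> x) = 1"
  shows "form_inner g p (scale_form \<sigma> \<omega>) (scale_form \<sigma> \<omega>) = form_inner g p \<omega> \<omega>"
proof
  fix x
  have "cnj (\<sigma> x) * \<sigma> x = 1"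
    using complex_norm_square[of "\<sigma> x"] assms[of x] by (simp add: mult.commute)
  then show "form_inner g p (scale_form \<sigma> \<omega>) (scale_form \<sigma> \<omega>) x = form_inner g p \<omega> \<omega> x"
    by (simp add: form_inner_scale_left form_inner_scale_right mult.assoc[symmetric])
qed

lemma L2_norm_scale_form:
  "(\<And>x. cmod (\<sigma> x) = 1) \<Longrightarrow> L2_norm_form A g p (scale_form \<sigma> \<omega>) = L2_norm_form A g p \<omega>"
  by (simp add: L2_norm_form_def L2_inner_def form_inner_scale_unit)

lemma L2_forms_scale_form:
  assumes \<sigma>: "smooth_fun A \<sigma>" "\<And>x. cmod (\<sigma> x) = 1" and u: "u \<in> L2_forms A g p"
  shows "scale_form \<sigma> u \<in> L2_forms A g p"
  unfolding L2_forms_def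
proof (intro CollectI conjI allI ballI)
  show "alt_form p (scale_form \<sigma> u x)" for x
    using u unfolding L2_forms_def scale_form_def by (intro alt_form_scale) auto
  show "integrable (riem_vol A g) (form_inner g p (scale_form \<sigma> u) (scale_form \<sigma> u))"
    using u by (simp add: L2_forms_def form_inner_scale_unit[OF \<sigma>(2)])
  fix c vs assume c: "c \<in> A"
  have "(\<lambda>y. \<sigma> (chart_inv c y)) \<in> borel_measurable (restrict_space borel (chart_range c))"
    by (rule borel_measurable_continuous_on_restrict[OF smooth_on_continuous[OF smooth_fun_chart[OF \<sigma>(1) c]]])
  moreover have "(\<lambda>y. loc_form A c u y vs) \<in> borel_measurable (restrict_space borel (chart_range c))"
    using u c by (simp add: L2_forms_def)
  ultimately have "(\<lambda>y. \<sigma> (chart_inv c y) * loc_form A c u y vs) \<in> borel_measurable (restrict_space borel (chart_range c))"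
    by (rule borel_measurable_times)
  then show "(\<lambda>y. loc_form A c (scale_form \<sigma> u) y vs) \<in> borel_measurable (restrict_space borel (chart_range c))"
    by (simp add: loc_form_def scale_form_def)
qed

text \<open>An approximating sequence is multiplied by \<open>\<sigma>\<close> term by term; all norms stay the same.\<close>

lemma closure_graph_scale_form:
  assumes \<sigma>: "smooth_fun A \<sigma>" "\<And>x. cmod (\<sigma> x) = 1"
    and T: "\<And>s. s \<in> Omega A p \<Longrightarrow> T' (scale_form \<sigma> s) = scale_form \<sigma> (T s)"
    and uf: "(u, f) \<in> closure_graph A g p T"
  shows "(scale_form \<sigma> u, scale_form \<sigma> f) \<in> closure_graph A g p T'"
proof -
  obtain s where L2: "u \<in> L2_forms A g p" "f \<in> L2_forms A g p" and s: "\<And>k::nat. s k \<in> Omega A p"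
    and lim: "(\<lambda>k. L2_norm_form A g p (\<lambda>x vs. s k x vs - u x vs)) \<longlonglongrightarrow> 0"
      "(\<lambda>k. L2_norm_form A g p (\<lambda>x vs. T (s k) x vs - f x vs)) \<longlonglongrightarrow> 0"
    using uf unfolding closure_graph_def by blast
  have diff: "(\<lambda>x vs. scale_form \<sigma> a x vs - scale_form \<sigma> b x vs) = scale_form \<sigma> (\<lambda>x vs. a x vs - b x vs)" for a b :: "('m, 'n) form_field"
    by (simp add: scale_form_def right_diff_distrib)
  have "(\<lambda>k. L2_norm_form A g p (\<lambda>x vs. scale_form \<sigma> (s k) x vs - scale_form \<sigma> u x vs)) \<longlonglongrightarrow> 0"
    "(\<lambda>k. L2_norm_form A g p (\<lambda>x vs. T' (scale_form \<sigma> (s k)) x vs - scale_form \<sigma> f x vs)) \<longlonglongrightarrow> 0"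
    unfolding T[OF s] diff L2_norm_scale_form[OF \<sigma>(2)] by (rule lim)+
  then show ?thesis
    unfolding closure_graph_def
    using L2_forms_scale_form[OF \<sigma> L2(1)] L2_forms_scale_form[OF \<sigma> L2(2)] Omega_scale_form[OF \<sigma>(1) s]
    by (intro CollectI case_prodI conjI exI[of _ "\<lambda>k. scale_form \<sigma> (s k)"] allI)
qed

text \<open>If \<open>u\<close> solves the resolvent equation of \<open>T\<close> with right-hand side \<open>cnj \<sigma> f\<close>, then \<open>\<sigma> u\<close> solves that
  of \<open>T'\<close> with right-hand side \<open>f\<close>, and conversely.\<close>

lemma resolvent_set_scale_form:
  assumes \<sigma>: "smooth_fun A \<sigma>" "\<And>x. cmod (\<sigma> x) = 1"
    and T: "\<And>s. s \<in> Omega A p \<Longrightarrow> T' (scale_form \<sigma> s) = scale_form \<sigma> (T s)"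
  shows "resolvent_set A g p T \<subseteq> resolvent_set A g p T'"
proof
  define \<rho> where "\<rho> x = cnj (\<sigma> x)" for x
  have \<rho>: "smooth_fun A \<rho>" "cmod (\<rho> x) = 1" for x
    using smooth_fun_cnj[OF \<sigma>(1)] \<sigma>(2) by (simp_all add: \<rho>_def[abs_def])
  have \<sigma>\<rho>: "\<sigma> x * \<rho> x = 1" and \<rho>\<sigma>: "\<rho> x * \<sigma> x = 1" for x
    using complex_norm_square[of "\<sigma> x"] \<sigma>(2)[of x] by (simp_all add: \<rho>_def mult.commute)
  note inv = scale_form_inverse[of \<sigma> \<rho>, OF \<sigma>\<rho>] scale_form_inverse[of \<rho> \<sigma>, OF \<rho>\<sigma>]
  have T_inv: "T (scale_form \<rho> s) = scale_form \<rho> (T' s)" if "s \<in> Omega A p" for s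
    using T[OF Omega_scale_form[OF \<rho>(1) that]] by (simp add: inv)
  have lin: "scale_form \<theta> (\<lambda>x vs. f x vs + z * u x vs) =
      (\<lambda>x vs. scale_form \<theta> f x vs + z * scale_form \<theta> u x vs)" for \<theta> f z and u :: "('m, 'n) form_field"
    by (simp add: scale_form_def distrib_left mult.left_commute)
  have diff: "scale_form \<theta> (\<lambda>x vs. a x vs - b x vs) = (\<lambda>x vs. scale_form \<theta> a x vs - scale_form \<theta> b x vs)"
    for \<theta> and a b :: "('m, 'n) form_field"
    by (simp add: scale_form_def right_diff_distrib)
  fix z assume "z \<in> resolvent_set A g p T"
  then obtain C where C: "\<And>f. f \<in> L2_forms A g p \<Longrightarrow> \<exists>u.
     (u, \<lambda>x vs. f x vs + z * u x vs) \<in> closure_graph A g p T \<and>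
     (\<forall>u'. (u', \<lambda>x vs. f x vs + z * u' x vs) \<in> closure_graph A g p T \<longrightarrow>
        L2_norm_form A g p (\<lambda>x vs. u' x vs - u x vs) = 0) \<and>
     L2_norm_form A g p u \<le> C * L2_norm_form A g p f"
    unfolding resolvent_set_def by blast
  have "\<exists>u. (u, \<lambda>x vs. f x vs + z * u x vs) \<in> closure_graph A g p T' \<and>
     (\<forall>u'. (u', \<lambda>x vs. f x vs + z * u' x vs) \<in> closure_graph A g p T' \<longrightarrow>
        L2_norm_form A g p (\<lambda>x vs. u' x vs - u x vs) = 0) \<and>
     L2_norm_form A g p u \<le> C * L2_norm_form A g p f" if f: "f \<in> L2_forms A g p" for f
  proof -
    obtain u where u: "(u, \<lambda>x vs. scale_form \<rho> f x vs + z * u x vs) \<in> closure_graph A g p T"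
      and uniq: "\<And>u'. (u', \<lambda>x vs. scale_form \<rho> f x vs + z * u' x vs) \<in> closure_graph A g p T \<Longrightarrow>
        L2_norm_form A g p (\<lambda>x vs. u' x vs - u x vs) = 0"
      and bound: "L2_norm_form A g p u \<le> C * L2_norm_form A g p (scale_form \<rho> f)"
      using C[OF L2_forms_scale_form[OF \<rho> f]] by blast
    have "(scale_form \<sigma> u, \<lambda>x vs. f x vs + z * scale_form \<sigma> u x vs) \<in> closure_graph A g p T'"
      using closure_graph_scale_form[of \<sigma> p T' T, OF \<sigma> T u] by (simp add: lin inv)
    moreover have "L2_norm_form A g p (\<lambda>x vs. u' x vs - scale_form \<sigma> u x vs) = 0"
      if "(u', \<lambda>x vs. f x vs + z * u' x vs) \<in> closure_graph A g p T'" for u'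
    proof -
      have "(scale_form \<rho> u', \<lambda>x vs. scale_form \<rho> f x vs + z * scale_form \<rho> u' x vs) \<in> closure_graph A g p T"
        using closure_graph_scale_form[of \<rho> p T T', OF \<rho> T_inv that] by (simp add: lin)
      from uniq[OF this] have "L2_norm_form A g p (scale_form \<sigma> (\<lambda>x vs. scale_form \<rho> u' x vs - u x vs)) = 0"
        by (simp add: L2_norm_scale_form[OF \<sigma>(2)])
      then show ?thesis by (simp add: diff inv)
    qed
    moreover have "L2_norm_form A g p (scale_form \<sigma> u) \<le> C * L2_norm_form A g p f"
      using bound by (simp add: L2_norm_scale_form[OF \<sigma>(2)] L2_norm_scale_form[OF \<rho>(2)])
    ultimately show ?thesis by blast
  qed
  then show "z \<in> resolvent_set A g p T'" unfolding resolvent_set_def by blast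
qed

lemma eigen_mult_scale_form:
  assumes \<sigma>: "smooth_fun A \<sigma>" "\<And>x. cmod (\<sigma> x) = 1"
    and T: "\<And>s. s \<in> Omega A p \<Longrightarrow> T' (scale_form \<sigma> s) = scale_form \<sigma> (T s)"
  shows "eigen_mult A g p T z \<le> eigen_mult A g p T' z"
  unfolding eigen_mult_def
proof (rule Sup_subset_mono, rule subsetI)
  fix e assume "e \<in> {enat k | k. \<exists>u :: nat \<Rightarrow> ('m, 'n) form_field.
     (\<forall>i<k. (u i, \<lambda>x vs. z * u i x vs) \<in> closure_graph A g p T) \<and>
     (\<forall>a :: nat \<Rightarrow> complex. L2_norm_form A g p (\<lambda>x vs. \<Sum>i<k. a i * u i x vs) = 0 \<longrightarrow> (\<forall>i<k. a i = 0))}"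
  then obtain k and u :: "nat \<Rightarrow> ('m, 'n) form_field" where e: "e = enat k"
    and u: "\<And>i. i < k \<Longrightarrow> (u i, \<lambda>x vs. z * u i x vs) \<in> closure_graph A g p T"
    and indep: "\<And>a :: nat \<Rightarrow> complex. L2_norm_form A g p (\<lambda>x vs. \<Sum>i<k. a i * u i x vs) = 0 \<Longrightarrow> \<forall>i<k. a i = 0"
    by blast
  have "(scale_form \<sigma> (u i), \<lambda>x vs. z * scale_form \<sigma> (u i) x vs) \<in> closure_graph A g p T'" if "i < k" for i
    using closure_graph_scale_form[of \<sigma> p T' T, OF \<sigma> T u[OF that]] by (simp add: scale_form_def mult.left_commute)
  moreover have "\<forall>i<k. a i = 0"
    if "L2_norm_form A g p (\<lambda>x vs. \<Sum>i<k. a i * scale_form \<sigma> (u i) x vs) = 0" for a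
  proof (rule indep)
    have "(\<lambda>x vs. \<Sum>i<k. a i * scale_form \<sigma> (u i) x vs) = scale_form \<sigma> (\<lambda>x vs. \<Sum>i<k. a i * u i x vs)"
      by (simp add: scale_form_def sum_distrib_left mult.left_commute)
    then show "L2_norm_form A g p (\<lambda>x vs. \<Sum>i<k. a i * u i x vs) = 0"
      using that by (simp add: L2_norm_scale_form[OF \<sigma>(2)])
  qed
  ultimately show "e \<in> {enat k | k. \<exists>u :: nat \<Rightarrow> ('m, 'n) form_field.
     (\<forall>i<k. (u i, \<lambda>x vs. z * u i x vs) \<in> closure_graph A g p T') \<and>
     (\<forall>a :: nat \<Rightarrow> complex. L2_norm_form A g p (\<lambda>x vs. \<Sum>i<k. a i * u i x vs) = 0 \<longrightarrow> (\<forall>i<k. a i = 0))}"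
    using e by (intro CollectI exI[of _ k] conjI exI[of _ "\<lambda>i. scale_form \<sigma> (u i)"]) auto
qed

end

theorem corollary3p8:
  fixes A :: "('m::{t2_space, second_countable_topology}, 'n::finite) chart set"
    and g :: "('m, 'n) metric"
    and \<alpha> :: "'m \<Rightarrow> real^'n \<Rightarrow> real"
    and \<tau> :: "'m \<Rightarrow> complex"
    and p :: nat
  assumes "oriented_atlas A"
    and "riemannian_metric A g"
    and "real_one_form A \<alpha>"
    and "smooth_fun A \<tau>"
    and "\<And>x. \<tau> x \<in> sphere 0 1"
  shows "(\<forall>\<omega>\<in>Omega A p.
            scale_form (\<lambda>x. cnj (\<tau> x)) (mag_laplacian A g \<alpha> p (scale_form \<tau> \<omega>)) =
            mag_laplacian A g (\<lambda>x v. \<alpha> x v + alpha_tau A \<tau> x v) p \<omega>) \<and>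
         (compact (UNIV :: 'm set) \<longrightarrow>
            op_spectrum A g p (mag_laplacian A g \<alpha> p) =
            op_spectrum A g p (mag_laplacian A g (\<lambda>x v. \<alpha> x v + alpha_tau A \<tau> x v) p) \<and>
            (\<forall>z. eigen_mult A g p (mag_laplacian A g \<alpha> p) z =
                 eigen_mult A g p (mag_laplacian A g (\<lambda>x v. \<alpha> x v + alpha_tau A \<tau> x v) p) z))"
proof -
  interpret riemannian_manifold A g
    using assms(1,2) by unfold_locales
  let ?T = "mag_laplacian A g \<alpha> p" and ?T' = "mag_laplacian A g (\<lambda>x v. \<alpha> x v + alpha_tau A \<tau> x v) p"
  let ?\<tau>' = "\<lambda>x. cnj (\<tau> x)"
  have \<tau>: "cmod (\<tau> x) = 1" "cmod (?\<tau>' x) = 1" for x using assms(5)[of x] by simp_all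
  have \<tau>\<tau>': "\<tau> x * ?\<tau>' x = 1" "?\<tau>' x * \<tau> x = 1" for x
    using complex_norm_square[of "\<tau> x"] \<tau>(1)[of x] by (simp_all add: mult.commute)
  note inv = scale_form_inverse[of \<tau> ?\<tau>', OF \<tau>\<tau>'(1)] scale_form_inverse[of ?\<tau>' \<tau>, OF \<tau>\<tau>'(2)]
  have \<tau>': "smooth_fun A ?\<tau>'" by (rule smooth_fun_cnj[OF assms(4)])
  have T: "?T (scale_form \<tau> s) = scale_form \<tau> (?T' s)" if "s \<in> Omega A p" for s
    by (rule mag_laplacian_scale_form[OF assms(3,4) \<tau>(1) that])
  have T': "?T' (scale_form ?\<tau>' s) = scale_form ?\<tau>' (?T s)" if "s \<in> Omega A p" for s
    using T[OF Omega_scale_form[OF \<tau>' that]] by (simp add: inv)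
  have "resolvent_set A g p ?T = resolvent_set A g p ?T'"
    using resolvent_set_scale_form[of \<tau> p ?T ?T', OF assms(4) \<tau>(1) T]
      resolvent_set_scale_form[of ?\<tau>' p ?T' ?T, OF \<tau>' \<tau>(2) T'] by blast
  moreover have "eigen_mult A g p ?T z = eigen_mult A g p ?T' z" for z
    using eigen_mult_scale_form[of \<tau> p ?T ?T' z, OF assms(4) \<tau>(1) T]
      eigen_mult_scale_form[of ?\<tau>' p ?T' ?T z, OF \<tau>' \<tau>(2) T'] by (rule antisym[rotated])
  ultimately show ?thesis by (simp add: op_spectrum_def T inv)
qed

end
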